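(* Let $R$ be a finite truncated discrete valuation ring. Let $\mathfrak g$ be a finite nilpotent Lie $R$-algebra of class $c$ such that $c!\in R^\times$. Let $G=\exp(\mathfrak g)$ be the finite $p$-group corresponding to $\mathfrak g$ under the Lazard correspondence. Then $$\operatorname{k}(G)=\operatorname{ask}(\operatorname{ad}_{\mathfrak g})=\operatorname{ask}(\operatorname{ad}_{\mathfrak g}^\bullet).$$
   Context: Rings are associative, commutative, and unital. Maps act on the right. A truncated discrete valuation ring is a ring isomorphic to $\mathfrak O/\mathfrak P^n$ for some discrete valuation ring $\mathfrak O$ with maximal ideal $\mathfrak P$ and some $n\ge0$. $\operatorname{k}(G)$ denotes the number of conjugacy classes of a finite group $G$. The group $\exp(\mathfrak g)$ has underlying set $\mathfrak g$ and multiplication given by the Hausdorff (Baker–Campbell–Hausdorff) series $\log(\exp(X)\exp(Y))=X+Y+\frac12[X,Y]+\dotsb$, evaluated in $\mathfrak g$. A module representation over $R$ is an $R$-module homomorphism $\theta\colon M\to\operatorname{Hom}(V,W)$, where $M,V,W$ are $R$-modules. If $M$ and $V$ are finite as sets, $\operatorname{ask}(\theta)=\frac1{|M|}\sum_{a\in M}|\operatorname{Ker}(a\theta)|$. With $U^*=\operatorname{Hom}(U,R)$, the module representation $\theta^\bullet\colon W^*\to\operatorname{Hom}(V,M^* )$ is $\psi\mapsto\bigl(x\mapsto(a\mapsto(x(a\theta))\psi)\bigr)$. The adjoint representation $\operatorname{ad}_{\mathfrak g}\colon\mathfrak g\to\operatorname{Hom}(\mathfrak g,\mathfrak g)$, $a\mapsto(x\mapsto[x,a])$,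 is regarded as a module representation over $R$. *)

theory Defs
  imports "HOL-Algebra.Algebra" "HOL.Rat"
begin

section \<open>Truncated discrete valuation rings\<close>

definition discrete_valuation_ring :: "('o, 'm) ring_scheme \<Rightarrow> bool" where
  "discrete_valuation_ring D \<longleftrightarrow>
     principal_domain D \<and> \<not> field D \<and> (\<exists>!P. maximalideal P D)"

text \<open>
  The ring \<open>R\<close> is isomorphic to \<open>D/P\<^sup>n\<close> for some \<open>n \<ge> 0\<close>, where \<open>P\<close> is the maximal ideal of
  the discrete valuation ring \<open>D\<close>. Powers are taken in the monoid of ideals of \<open>D\<close>, so
  \<open>P\<^sup>0 = D\<close> and \<open>n = 0\<close> gives the zero ring. As one cannot quantify over types inside a formula,
  \<open>D\<close> is a parameter; in the hypothesis of a theorem, a universally quantified \<open>D\<close> (over an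
  arbitrary type) amounts to the existence of \<open>D\<close>.
\<close>

definition truncated_dvr :: "('o, 'm) ring_scheme \<Rightarrow> ('r, 'n) ring_scheme \<Rightarrow> bool" where
  "truncated_dvr D R \<longleftrightarrow>
     cring R \<and> discrete_valuation_ring D \<and>
     (\<exists>P (n::nat). maximalideal P D \<and> R \<simeq> D Quot (P [^]\<^bsub>ideals_set D\<^esub> n))"


section \<open>Lie algebras\<close>

text \<open>
  As for the library's modules, the ring multiplication and unit that a module record inherits
  are ignored; the Lie bracket is a separate field.
\<close>

record ('r, 'g) lie = "('r, 'g) module" +
  lbracket :: "'g \<Rightarrow> 'g \<Rightarrow> 'g"

locale lie_algebra = module R L
  for R :: "('r, 'm) ring_scheme" (structure) and L :: "('r, 'g, 'n) lie_scheme" (structure) +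
  assumes lbracket_closed:
      "\<lbrakk>x \<in> carrier L; y \<in> carrier L\<rbrakk> \<Longrightarrow> lbracket L x y \<in> carrier L"
    and lbracket_add_left:
      "\<lbrakk>x \<in> carrier L; y \<in> carrier L; z \<in> carrier L\<rbrakk> \<Longrightarrow>
       lbracket L (x \<oplus>\<^bsub>L\<^esub> y) z = lbracket L x z \<oplus>\<^bsub>L\<^esub> lbracket L y z"
    and lbracket_add_right:
      "\<lbrakk>x \<in> carrier L; y \<in> carrier L; z \<in> carrier L\<rbrakk> \<Longrightarrow>
       lbracket L z (x \<oplus>\<^bsub>L\<^esub> y) = lbracket L z x \<oplus>\<^bsub>L\<^esub> lbracket L z y"
    and lbracket_smult_left:
      "\<lbrakk>r \<in> carrier R; x \<in> carrier L; y \<in> carrier L\<rbrakk> \<Longrightarrow>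
       lbracket L (r \<odot>\<^bsub>L\<^esub> x) y = r \<odot>\<^bsub>L\<^esub> lbracket L x y"
    and lbracket_smult_right:
      "\<lbrakk>r \<in> carrier R; x \<in> carrier L; y \<in> carrier L\<rbrakk> \<Longrightarrow>
       lbracket L x (r \<odot>\<^bsub>L\<^esub> y) = r \<odot>\<^bsub>L\<^esub> lbracket L x y"
    and lbracket_self:
      "x \<in> carrier L \<Longrightarrow> lbracket L x x = \<zero>\<^bsub>L\<^esub>"
    and jacobi:
      "\<lbrakk>x \<in> carrier L; y \<in> carrier L; z \<in> carrier L\<rbrakk> \<Longrightarrow>
       lbracket L x (lbracket L y z) \<oplus>\<^bsub>L\<^esub> lbracket L y (lbracket L z x)
         \<oplus>\<^bsub>L\<^esub> lbracket L z (lbracket L x y) = \<zero>\<^bsub>L\<^esub>"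

definition submodule_span ::
    "('r, 'm) ring_scheme \<Rightarrow> ('r, 'g, 'n) module_scheme \<Rightarrow> 'g set \<Rightarrow> 'g set" where
  "submodule_span R M A = \<Inter>{N. submodule N R M \<and> A \<subseteq> N}"

text \<open>Indexing starts at 0: \<open>lower_central R L i\<close> is usually written \<open>\<gamma>\<^sub>i\<^sub>+\<^sub>1\<close>.\<close>

primrec lower_central ::
    "('r, 'm) ring_scheme \<Rightarrow> ('r, 'g, 'n) lie_scheme \<Rightarrow> nat \<Rightarrow> 'g set" where
  "lower_central R L 0 = carrier L"
| "lower_central R L (Suc i) =
     submodule_span R L {lbracket L x y | x y. x \<in> lower_central R L i \<and> y \<in> carrier L}"

definition lie_nilpotent :: "('r, 'm) ring_scheme \<Rightarrow> ('r, 'g, 'n) lie_scheme \<Rightarrow> bool" where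
  "lie_nilpotent R L \<longleftrightarrow> (\<exists>c. lower_central R L c = {\<zero>\<^bsub>L\<^esub>})"

definition nilpotency_class :: "('r, 'm) ring_scheme \<Rightarrow> ('r, 'g, 'n) lie_scheme \<Rightarrow> nat" where
  "nilpotency_class R L = (LEAST c. lower_central R L c = {\<zero>\<^bsub>L\<^esub>})"


section \<open>The Hausdorff series\<close>

datatype letter = LetterX | LetterY

text \<open>
  A formal power series over the rationals in two non-commuting variables, given by its
  coefficients at words.
\<close>

type_synonym nc_series = "letter list \<Rightarrow> rat"

definition nc_var :: "letter \<Rightarrow> nc_series" where
  "nc_var l = (\<lambda>w. if w = [l] then 1 else 0)"

definition nc_one :: nc_series where
  "nc_one = (\<lambda>w. if w = [] then 1 else 0)"

definition nc_mult :: "nc_series \<Rightarrow> nc_series \<Rightarrow> nc_series" where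
  "nc_mult P Q = (\<lambda>w. \<Sum>i\<le>length w. P (take i w) * Q (drop i w))"

primrec nc_power :: "nc_series \<Rightarrow> nat \<Rightarrow> nc_series" where
  "nc_power P 0 = nc_one"
| "nc_power P (Suc n) = nc_mult (nc_power P n) P"

text \<open>
  \<open>nc_exp P\<close> is \<open>\<Sum>n. P\<^sup>n / n!\<close> for \<open>P\<close> with constant term 0, and \<open>nc_log P\<close> is
  \<open>\<Sum>n\<ge>1. (- 1)\<^sup>n\<^sup>+\<^sup>1 (P - 1)\<^sup>n / n\<close> for \<open>P\<close> with constant term 1. The \<open>n\<close>-th power of a series with
  constant term 0 vanishes at all words of length less than \<open>n\<close>, whence the finite sums.
\<close>

definition nc_exp :: "nc_series \<Rightarrow> nc_series" where
  "nc_exp P = (\<lambda>w. \<Sum>n\<le>length w. nc_power P n w / fact n)"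

definition nc_log :: "nc_series \<Rightarrow> nc_series" where
  "nc_log P =
     (\<lambda>w. \<Sum>n=1..length w. (- 1) ^ (n + 1) / of_nat n * nc_power (\<lambda>v. P v - nc_one v) n w)"

definition hausdorff :: nc_series where
  "hausdorff = nc_log (nc_mult (nc_exp (nc_var LetterX)) (nc_exp (nc_var LetterY)))"

definition nc_truncate :: "nat \<Rightarrow> nc_series \<Rightarrow> nc_series" where
  "nc_truncate c P = (\<lambda>w. if length w \<le> c then P w else 0)"


section \<open>The group \<open>exp(L)\<close>\<close>

text \<open>
  A rational number \<open>a/b\<close> in lowest terms makes sense in \<open>R\<close> if the image of \<open>b\<close> is a unit.
\<close>

definition rat_defined_in :: "('r, 'm) ring_scheme \<Rightarrow> rat \<Rightarrow> bool" where
  "rat_defined_in R q \<longleftrightarrow> add_pow R (snd (quotient_of q)) \<one>\<^bsub>R\<^esub> \<in> Units R"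

definition rat_to_ring :: "('r, 'm) ring_scheme \<Rightarrow> rat \<Rightarrow> 'r" where
  "rat_to_ring R q =
     add_pow R (fst (quotient_of q)) \<one>\<^bsub>R\<^esub> \<otimes>\<^bsub>R\<^esub>
       inv\<^bsub>R\<^esub> (add_pow R (snd (quotient_of q)) \<one>\<^bsub>R\<^esub>)"

text \<open>
  \<open>lie_evaluates R L x y P z\<close>: the series \<open>P\<close> is a Lie polynomial, and writing it as a linear
  combination of iterated commutators of the variables (with coefficients that make sense in
  \<open>R\<close>) and substituting \<open>x\<close>, \<open>y\<close> for the variables and the bracket of \<open>L\<close> for the commutator
  gives \<open>z\<close>. In a Lie algebra, \<open>z\<close> does not depend on the way in which \<open>P\<close> is written, since
  free Lie rings embed into free associative rings.
\<close>

inductive lie_evaluates ::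
    "('r, 'm) ring_scheme \<Rightarrow> ('r, 'g, 'n) lie_scheme \<Rightarrow> 'g \<Rightarrow> 'g \<Rightarrow> nc_series \<Rightarrow> 'g \<Rightarrow> bool"
  for R L x y where
  var_X: "lie_evaluates R L x y (nc_var LetterX) x"
| var_Y: "lie_evaluates R L x y (nc_var LetterY) y"
| add: "lie_evaluates R L x y P u \<Longrightarrow> lie_evaluates R L x y Q v \<Longrightarrow>
    lie_evaluates R L x y (\<lambda>w. P w + Q w) (u \<oplus>\<^bsub>L\<^esub> v)"
| scale: "lie_evaluates R L x y P u \<Longrightarrow> rat_defined_in R q \<Longrightarrow>
    lie_evaluates R L x y (\<lambda>w. q * P w) (rat_to_ring R q \<odot>\<^bsub>L\<^esub> u)"
| commutator: "lie_evaluates R L x y P u \<Longrightarrow> lie_evaluates R L x y Q v \<Longrightarrow>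
    lie_evaluates R L x y (\<lambda>w. nc_mult P Q w - nc_mult Q P w) (lbracket L u v)"

text \<open>
  If \<open>L\<close> is nilpotent of class \<open>c\<close>, then the terms of degree greater than \<open>c\<close> of the Hausdorff
  series vanish in \<open>L\<close>. The terms of degree at most \<open>c\<close> can be written with denominators all of
  whose prime factors are at most \<open>c\<close>, so they can be evaluated in \<open>L\<close> if \<open>c!\<close> is a unit of \<open>R\<close>.
\<close>

definition lie_exp :: "('r, 'm) ring_scheme \<Rightarrow> ('r, 'g, 'n) lie_scheme \<Rightarrow> 'g monoid" where
  "lie_exp R L =
     \<lparr>carrier = carrier L,
      monoid.mult = (\<lambda>x y. THE z.
        lie_evaluates R L x y (nc_truncate (nilpotency_class R L) hausdorff) z),
      one = \<zero>\<^bsub>L\<^esub>\<rparr>"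

definition num_conjugacy_classes :: "('a, 'm) monoid_scheme \<Rightarrow> nat" where
  "num_conjugacy_classes G =
     card (orbits G (carrier G) (\<lambda>g. \<lambda>h \<in> carrier G. g \<otimes>\<^bsub>G\<^esub> h \<otimes>\<^bsub>G\<^esub> inv\<^bsub>G\<^esub> g))"


section \<open>Module representations\<close>

text \<open>
  The module of homomorphisms consists of extensional functions, so that distinct elements are
  distinct maps on the carrier. The inherited ring multiplication and unit are irrelevant.
\<close>

definition hom_module :: "('r, 'm) ring_scheme \<Rightarrow> ('r, 'v, 'n) module_scheme \<Rightarrow>
    ('r, 'w, 'k) module_scheme \<Rightarrow> ('r, 'v \<Rightarrow> 'w) module" where
  "hom_module R V W =
     \<lparr>carrier = {f \<in> carrier V \<rightarrow>\<^sub>E carrier W.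
        (\<forall>x\<in>carrier V. \<forall>y\<in>carrier V. f (x \<oplus>\<^bsub>V\<^esub> y) = f x \<oplus>\<^bsub>W\<^esub> f y) \<and>
        (\<forall>r\<in>carrier R. \<forall>x\<in>carrier V. f (r \<odot>\<^bsub>V\<^esub> x) = r \<odot>\<^bsub>W\<^esub> f x)},
      monoid.mult = undefined,
      one = undefined,
      ring.zero = (\<lambda>x\<in>carrier V. \<zero>\<^bsub>W\<^esub>),
      add = (\<lambda>f g. \<lambda>x\<in>carrier V. f x \<oplus>\<^bsub>W\<^esub> g x),
      smult = (\<lambda>r f. \<lambda>x\<in>carrier V. r \<odot>\<^bsub>W\<^esub> f x)\<rparr>"

definition regular_module :: "('r, 'm) ring_scheme \<Rightarrow> ('r, 'r) module" where
  "regular_module R =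
     \<lparr>carrier = carrier R, monoid.mult = monoid.mult R, one = one R, ring.zero = ring.zero R,
      add = add R, smult = monoid.mult R\<rparr>"

definition dual_module ::
    "('r, 'm) ring_scheme \<Rightarrow> ('r, 'v, 'n) module_scheme \<Rightarrow> ('r, 'v \<Rightarrow> 'r) module" where
  "dual_module R U = hom_module R U (regular_module R)"

definition module_rep :: "('r, 'm) ring_scheme \<Rightarrow> ('r, 'a, 'i) module_scheme \<Rightarrow>
    ('r, 'v, 'j) module_scheme \<Rightarrow> ('r, 'w, 'k) module_scheme \<Rightarrow> ('a \<Rightarrow> 'v \<Rightarrow> 'w) \<Rightarrow> bool" where
  "module_rep R M V W \<theta> \<longleftrightarrow> \<theta> \<in> carrier (hom_module R M (hom_module R V W))"

text \<open>The average size of the kernels of a module representation \<open>\<theta>\<close> of \<open>M\<close> in \<open>Hom(V,W)\<close>.\<close>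

definition ask :: "('r, 'a, 'i) module_scheme \<Rightarrow> ('r, 'v, 'j) module_scheme \<Rightarrow>
    ('r, 'w, 'k) module_scheme \<Rightarrow> ('a \<Rightarrow> 'v \<Rightarrow> 'w) \<Rightarrow> rat" where
  "ask M V W \<theta> =
     1 / of_nat (card (carrier M)) * (\<Sum>a\<in>carrier M. of_nat (card (a_kernel V W (\<theta> a))))"

text \<open>
  For \<open>\<theta>\<close> from \<open>M\<close> to \<open>Hom(V,W)\<close>, this is the map from \<open>W\<^sup>*\<close> to \<open>Hom(V,M\<^sup>*)\<close> that sends \<open>\<psi>\<close>
  to the map taking \<open>x\<close> to the functional whose value at \<open>a\<close> is \<open>\<psi> (\<theta> a x)\<close>.
\<close>

definition rep_bullet :: "('r, 'm) ring_scheme \<Rightarrow> ('r, 'a, 'i) module_scheme \<Rightarrow>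
    ('r, 'v, 'j) module_scheme \<Rightarrow> ('r, 'w, 'k) module_scheme \<Rightarrow> ('a \<Rightarrow> 'v \<Rightarrow> 'w) \<Rightarrow>
    ('w \<Rightarrow> 'r) \<Rightarrow> 'v \<Rightarrow> 'a \<Rightarrow> 'r" where
  "rep_bullet R M V W \<theta> =
     (\<lambda>\<psi>\<in>carrier (dual_module R W). \<lambda>x\<in>carrier V. \<lambda>a\<in>carrier M. \<psi> (\<theta> a x))"

definition lie_ad :: "('r, 'g, 'n) lie_scheme \<Rightarrow> 'g \<Rightarrow> 'g \<Rightarrow> 'g" where
  "lie_ad L = (\<lambda>a\<in>carrier L. \<lambda>x\<in>carrier L. lbracket L x a)"

lemma (in lie_algebra) module_rep_lie_ad: "module_rep R L L L (lie_ad L)"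
  unfolding module_rep_def hom_module_def lie_ad_def
  by (auto simp: fun_eq_iff lbracket_closed lbracket_add_left lbracket_add_right
      lbracket_smult_left lbracket_smult_right)

lemma module_rep_bullet:
  assumes "module R M" "module R V" "module R W" "module_rep R M V W \<theta>"
  shows "module_rep R (dual_module R W) V (dual_module R M) (rep_bullet R M V W \<theta>)"
proof -
  interpret M: module R M by fact
  interpret V: module R V by fact
  interpret W: module R W by fact
  have t1: "\<theta> a x \<in> carrier W" if "a \<in> carrier M" "x \<in> carrier V" for a x
    using assms(4) that by (auto simp: module_rep_def hom_module_def Pi_iff PiE_iff)
  have t2: "\<theta> (a \<oplus>\<^bsub>M\<^esub> b) x = \<theta> a x \<oplus>\<^bsub>W\<^esub> \<theta> b x"
    if "a \<in> carrier M" "b \<in> carrier M" "x \<in> carrier V" for a b x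
    using assms(4) that by (auto simp: module_rep_def hom_module_def)
  have t3: "\<theta> (r \<odot>\<^bsub>M\<^esub> a) x = r \<odot>\<^bsub>W\<^esub> \<theta> a x"
    if "a \<in> carrier M" "r \<in> carrier R" "x \<in> carrier V" for a r x
    using assms(4) that by (auto simp: module_rep_def hom_module_def)
  have t4: "\<theta> a (x \<oplus>\<^bsub>V\<^esub> y) = \<theta> a x \<oplus>\<^bsub>W\<^esub> \<theta> a y"
    if "a \<in> carrier M" "x \<in> carrier V" "y \<in> carrier V" for a x y
    using assms(4) that by (auto simp: module_rep_def hom_module_def Pi_iff PiE_iff)
  have t5: "\<theta> a (r \<odot>\<^bsub>V\<^esub> x) = r \<odot>\<^bsub>W\<^esub> \<theta> a x"
    if "a \<in> carrier M" "r \<in> carrier R" "x \<in> carrier V" for a r x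
    using assms(4) that by (auto simp: module_rep_def hom_module_def Pi_iff PiE_iff)
  show ?thesis
    unfolding module_rep_def hom_module_def rep_bullet_def dual_module_def regular_module_def
    by (auto simp: fun_eq_iff t1 t2 t3 t4 t5 Pi_iff PiE_iff M.R.a_ac M.R.m_ac
        M.R.r_distr)
qed

end

theory Submission
  imports Defs "HOL-Computational_Algebra.Formal_Power_Series"
begin

text \<open>
  Write \<open>x \<star> y\<close> for the Hausdorff product in a nilpotent Lie algebra \<open>L\<close> of class \<open>c\<close>, and
  \<open>h \<cdot> e\<^sup>u = \<Sum>k. [..[h, u], .., u] / k!\<close> for the exponential of the right adjoint action of \<open>u\<close>.

  The first equality is Burnside's count of orbits. Conjugation in \<open>exp(L)\<close> is
  \<open>x \<star> h \<star> (-x) = h \<cdot> e\<^sup>-\<^sup>x\<close> (\<open>bch_prod_conj\<close>), and \<open>h \<cdot> e\<^sup>x\<^sup>\<star>\<^sup>y = (h \<cdot> e\<^sup>x) \<cdot> e\<^sup>y\<close>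
  (\<open>exp_ad_bch_prod\<close>), so the conjugacy class of \<open>h\<close> is its orbit under \<open>h \<mapsto> h \<cdot> e\<^sup>u\<close>. As the
  adjoint action is nilpotent, \<open>h \<cdot> e\<^sup>u = h\<close> exactly if \<open>[h, u] = 0\<close> (\<open>exp_ad_fixed_iff\<close>). Hence
  \<open>|L|\<close> times the number of classes is the number of commuting pairs, which is \<open>|L|\<close> times the
  average size of the kernels of \<open>ad\<close>.

  The identities for \<open>\<star>\<close> are identities of power series in two non-commuting variables. Their
  transfer to \<open>L\<close> needs two facts. The value of a Lie series in \<open>L\<close> is determined by its
  components of degree at most \<open>c\<close> (\<open>lie_eval_unique\<close>): by the argument of Dynkin, Specht and
  Wever, replacing each word of a homogeneous Lie polynomial of degree \<open>n\<close> by the left-normed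
  bracket of its letters multiplies the value by \<open>n\<close>, and \<open>n\<close> is a unit of \<open>R\<close> for
  \<open>1 \<le> n \<le> c\<close>. And the components of degree at most \<open>c\<close> of the Hausdorff series \<open>H\<close> are Lie
  polynomials with denominators that divide powers of \<open>c!\<close> (\<open>ex_lie_eval_hausdorff\<close>): comparing
  \<open>exp H\<close> with \<open>exp X * exp Y\<close> under the derivation that multiplies degree \<open>n\<close> by \<open>n\<close> expresses
  \<open>n H\<^sub>n\<close> through iterated brackets of \<open>X\<close>, \<open>Y\<close> and the components of lower degree, divided by
  factorials \<open>k!\<close> with \<open>k \<le> n\<close> (\<open>hausdorff_recursion\<close>).

  The second equality holds for every module representation \<open>\<theta>\<close> over a finite ring with principal
  ideals. Exchanging summations, \<open>ask(\<theta>)\<close> is the sum over \<open>x\<close> of \<open>1 / |I\<^sub>x|\<close> with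
  \<open>I\<^sub>x = {x(a\<theta>)}\<close>, and \<open>ask(\<theta>\<^sup>\<bullet>)\<close> is the sum over \<open>x\<close> of the proportion of functionals on \<open>W\<close>
  that vanish on \<open>I\<^sub>x\<close>. Over such a ring, \<open>|W| / |I|\<close> functionals vanish on a submodule \<open>I\<close>
  (\<open>card_functionals\<close>), because functionals extend along each step \<open>N \<subseteq> N + R u\<close> and the number of
  extensions is the index.
\<close>


section \<open>Non-commutative power series\<close>

text \<open>
  A type of its own for the series lets the ring structure of \<open>\<rat>\<langle>\<langle>X, Y\<rangle>\<rangle>\<close> be an instance of the
  type class of rings.
\<close>

typedef ncs = "UNIV :: nc_series set"
  morphisms coef Series ..

declare Series_inverse [simplified, simp]

lemma ncs_eqI: "(\<And>w. coef P w = coef Q w) \<Longrightarrow> P = Q"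
  by (metis coef_inject ext)

instantiation ncs :: ab_group_add
begin

definition "0 = Series (\<lambda>w. 0)"
definition "P + Q = Series (\<lambda>w. coef P w + coef Q w)"
definition "P - Q = Series (\<lambda>w. coef P w - coef Q w)"
definition "- P = Series (\<lambda>w. - coef P w)"

instance
  by standard (rule ncs_eqI;
      simp add: zero_ncs_def plus_ncs_def minus_ncs_def uminus_ncs_def)+

end

lemma coef_zero [simp]: "coef 0 w = 0"
  and coef_add [simp]: "coef (P + Q) w = coef P w + coef Q w"
  and coef_diff [simp]: "coef (P - Q) w = coef P w - coef Q w"
  and coef_uminus [simp]: "coef (- P) w = - coef P w"
  by (simp_all add: zero_ncs_def plus_ncs_def minus_ncs_def uminus_ncs_def)

lemma coef_sum [simp]: "coef (sum f A) w = (\<Sum>i\<in>A. coef (f i) w)"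
  by (induction A rule: infinite_finite_induct) auto

definition qscale :: "rat \<Rightarrow> ncs \<Rightarrow> ncs" where
  "qscale q P = Series (\<lambda>w. q * coef P w)"

lemma coef_qscale [simp]: "coef (qscale q P) w = q * coef P w"
  by (simp add: qscale_def)

text \<open>
  The left derivatives are the terms of the decomposition \<open>P = p + X * P\<^sub>X + Y * P\<^sub>Y\<close> with a
  rational number \<open>p\<close>. With their product rule they turn statements about words into inductions
  on the length.
\<close>

definition lderiv :: "letter \<Rightarrow> ncs \<Rightarrow> ncs" where
  "lderiv l P = Series (\<lambda>w. coef P (l # w))"

lemma coef_lderiv [simp]: "coef (lderiv l P) w = coef P (l # w)"
  by (simp add: lderiv_def)

lemma lderiv_simps [simp]:
  "lderiv l 0 = 0" "lderiv l (P + Q) = lderiv l P + lderiv l Q" "lderiv l (P - Q) = lderiv l P - lderiv l Q"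
  "lderiv l (- P) = - lderiv l P" "lderiv l (qscale q P) = qscale q (lderiv l P)"
  by (auto intro!: ncs_eqI)

interpretation qscale: vector_space qscale
  by standard (auto intro!: ncs_eqI simp: algebra_simps)

lemma nc_mult_Nil: "nc_mult P Q [] = P [] * Q []"
  by (simp add: nc_mult_def)

text \<open>
  A splitting of \<open>l # w\<close> into two words has an empty first part, or its first part starts with \<open>l\<close>.
\<close>

lemma nc_mult_Cons:
  "nc_mult P Q (l # w) = P [] * Q (l # w) + nc_mult (\<lambda>v. P (l # v)) Q w"
  unfolding nc_mult_def by (simp add: sum.atMost_Suc_shift del: sum.atMost_Suc)

instantiation ncs :: ring_1
begin

definition "1 = Series nc_one"
definition "P * Q = Series (nc_mult (coef P) (coef Q))"

lemma coef_times: "coef (P * Q) = nc_mult (coef P) (coef Q)"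
  by (simp add: times_ncs_def)

lemma coef_times_Nil [simp]: "coef (P * Q) [] = coef P [] * coef Q []"
  by (simp add: coef_times nc_mult_Nil)

lemma lderiv_times [simp]: "lderiv l (P * Q) = lderiv l P * Q + qscale (coef P []) (lderiv l Q)"
  by (rule ncs_eqI) (simp add: coef_times nc_mult_Cons lderiv_def)

lemma coef_times_add:
  "coef ((P + Q) * T) w = coef (P * T) w + coef (Q * T) w"
  by (simp add: coef_times nc_mult_def algebra_simps sum.distrib)

lemma coef_times_qscale:
  "coef (qscale q P * T) w = q * coef (P * T) w"
  by (simp add: coef_times nc_mult_def sum_distrib_left mult.assoc)

instance
proof
  show "1 * P = P" for P :: ncs
  proof (rule ncs_eqI)
    show "coef (1 * P) w = coef P w" for w
    proof -
      have "coef (1 * P) w = (\<Sum>i\<le>length w. (if i = 0 then 1 else 0) * coef P (drop i w))"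
        unfolding coef_times one_ncs_def nc_mult_def by (auto intro!: sum.cong simp: nc_one_def)
      also have "\<dots> = coef P w" 
        by (subst sum.remove[of _ 0]) auto
      finally show ?thesis .
    qed
  qed
  show "P * 1 = P" for P :: ncs
  proof (rule ncs_eqI)
    show "coef (P * 1) w = coef P w" for w
    proof -
      have "coef (P * 1) w = (\<Sum>i\<le>length w. coef P (take i w) * (if i = length w then 1 else 0))"
        unfolding coef_times one_ncs_def nc_mult_def by (auto intro!: sum.cong simp: nc_one_def)
      also have "\<dots> = coef P w" 
        by (subst sum.remove[of _ "length w"]) auto
      finally show ?thesis .
    qed
  qed
  show "(P + Q) * T = P * T + Q * T" for P Q T :: ncs
    by (rule ncs_eqI) (simp add: coef_times_add)
  show "P * (Q + T) = P * Q + P * T" for P Q T :: ncs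
    by (rule ncs_eqI) (simp add: coef_times nc_mult_def algebra_simps sum.distrib)
  show "P * Q * T = P * (Q * T)" for P Q T :: ncs
  proof (rule ncs_eqI)
    show "coef (P * Q * T) w = coef (P * (Q * T)) w" for w
    \<comment> \<open>By the product rule, both sides have the same left derivatives up to shorter words.\<close>
    proof (induction w arbitrary: P)
      case (Cons l w)
      have "coef (P * Q * T) (l # w) = coef (lderiv l (P * Q * T)) w" by (simp only: coef_lderiv)
      also have "\<dots> = coef (lderiv l P * (Q * T)) w + coef P [] * coef (lderiv l (Q * T)) w"
        by (simp add: coef_times_add coef_times_qscale Cons.IH algebra_simps del: coef_lderiv)
      also have "\<dots> = coef (lderiv l (P * (Q * T))) w" by (simp only: lderiv_times coef_add coef_qscale)
      finally show ?case by (simp only: coef_lderiv)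
    qed simp
  qed
  have "coef (0::ncs) [] \<noteq> coef 1 []" by (simp add: one_ncs_def nc_one_def)
  then show "0 \<noteq> (1::ncs)" by metis
qed

end

lemma coef_one: "coef 1 w = (if w = [] then 1 else 0)"
  by (simp add: one_ncs_def nc_one_def)

lemma coef_one_Nil [simp]: "coef 1 [] = 1"
  by (simp add: coef_one)

lemma lderiv_one [simp]: "lderiv l 1 = 0"
  by (rule ncs_eqI) (simp add: coef_one)

lemma qscale_mult_left [simp]: "qscale q P * Q = qscale q (P * Q)"
  by (rule ncs_eqI) (simp add: coef_times_qscale)

lemma qscale_mult_right [simp]: "P * qscale q Q = qscale q (P * Q)"
  by (rule ncs_eqI) (simp add: coef_times nc_mult_def sum_distrib_left mult_ac)

lemma coef_power: "coef (P ^ n) = nc_power (coef P) n"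
  by (induction n) (simp_all add: one_ncs_def coef_times power_Suc2 del: power_Suc)


subsection \<open>Order filtration and locally finite sums\<close>

definition deg_ge :: "nat \<Rightarrow> ncs \<Rightarrow> bool" where
  "deg_ge n P \<longleftrightarrow> (\<forall>w. length w < n \<longrightarrow> coef P w = 0)"

lemma deg_geD: "deg_ge n P \<Longrightarrow> length w < n \<Longrightarrow> coef P w = 0"
  by (simp add: deg_ge_def)

lemma deg_ge_0 [simp]: "deg_ge 0 P"
  by (simp add: deg_ge_def)

lemma deg_ge_1_iff: "deg_ge (Suc 0) P \<longleftrightarrow> coef P [] = 0"
  by (simp add: deg_ge_def)

lemma deg_ge_zero [simp]: "deg_ge n 0"
  by (simp add: deg_ge_def)

lemma deg_ge_add: "deg_ge n P \<Longrightarrow> deg_ge n Q \<Longrightarrow> deg_ge n (P + Q)"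
  by (simp add: deg_ge_def)

lemma deg_ge_diff: "deg_ge n P \<Longrightarrow> deg_ge n Q \<Longrightarrow> deg_ge n (P - Q)"
  by (simp add: deg_ge_def)

lemma deg_ge_qscale: "deg_ge n P \<Longrightarrow> deg_ge n (qscale q P)"
  by (simp add: deg_ge_def)

lemma deg_ge_sum: "(\<And>i. i \<in> A \<Longrightarrow> deg_ge n (f i)) \<Longrightarrow> deg_ge n (sum f A)"
  by (simp add: deg_ge_def)

lemma deg_ge_times:
  assumes "deg_ge m P" "deg_ge n Q"
  shows "deg_ge (m + n) (P * Q)"
proof -
  have "nc_mult (coef P) (coef Q) w = 0" if w: "length w < m + n" for w
    unfolding nc_mult_def
  proof (rule sum.neutral, rule ballI)
    fix i assume "i \<in> {..length w}"
    then have "length (take i w) < m \<or> length (drop i w) < n" using w by auto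
    then show "coef P (take i w) * coef Q (drop i w) = 0"
      using deg_geD[OF assms(1)] deg_geD[OF assms(2)] by auto
  qed
  then show ?thesis by (simp add: deg_ge_def coef_times)
qed

lemma deg_ge_power: "deg_ge (Suc 0) P \<Longrightarrow> deg_ge n (P ^ n)"
  using deg_ge_times[of "Suc 0" P] by (induction n) auto

text \<open>
  For members of order at least their index, the infinite sum is locally finite: only those with
  index at most the length of a word contribute to its coefficient.
\<close>

definition tsum :: "(nat \<Rightarrow> ncs) \<Rightarrow> ncs" where
  "tsum a = Series (\<lambda>w. \<Sum>n\<le>length w. coef (a n) w)"

lemma coef_tsum: "coef (tsum a) w = (\<Sum>n\<le>length w. coef (a n) w)"
  by (simp add: tsum_def)

lemma coef_tsum_upto:
  assumes "\<And>n. deg_ge n (a n)" "length w \<le> m"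
  shows "coef (tsum a) w = (\<Sum>n\<le>m. coef (a n) w)"
  unfolding coef_tsum
  by (rule sum.mono_neutral_left) (use assms(2) in \<open>auto intro: deg_geD[OF assms(1)]\<close>)

lemma deg_ge_tsum:
  assumes "\<And>n. deg_ge n (a n)" 
  shows "deg_ge (Suc m) (tsum a - (\<Sum>n\<le>m. a n))"
  unfolding deg_ge_def using coef_tsum_upto[OF assms] by auto

lemma tsum_add: "tsum (\<lambda>n. a n + b n) = tsum a + tsum b"
  by (rule ncs_eqI) (simp add: coef_tsum sum.distrib)

lemma tsum_qscale: "tsum (\<lambda>n. qscale q (a n)) = qscale q (tsum a)"
  by (rule ncs_eqI) (simp add: coef_tsum sum_distrib_left)

text \<open>
  The coefficient of \<open>w\<close> on the left is the sum of the coefficients of \<open>a j * b k\<close> over all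
  \<open>j, k \<le> |w|\<close>, and for \<open>j + k > |w|\<close> the order of \<open>a j * b k\<close> is too large for a contribution.
\<close>

lemma tsum_cauchy:
  assumes a: "\<And>n. deg_ge n (a n)" and b: "\<And>n. deg_ge n (b n)"
  shows "tsum a * tsum b = tsum (\<lambda>n. \<Sum>k\<le>n. a (n - k) * b k)"
proof (rule ncs_eqI)
  fix w :: "letter list"
  let ?m = "length w"
  have "coef (tsum a * tsum b) w
      = (\<Sum>i\<le>?m. (\<Sum>j\<le>?m. coef (a j) (take i w)) * (\<Sum>k\<le>?m. coef (b k) (drop i w)))"
    unfolding coef_times nc_mult_def 
    by (rule sum.cong[OF refl]) (simp add: coef_tsum_upto[OF a, where m = ?m] coef_tsum_upto[OF b, where m = ?m])
  also have "\<dots> = (\<Sum>i\<le>?m. \<Sum>j\<le>?m. \<Sum>k\<le>?m. coef (a j) (take i w) * coef (b k) (drop i w))"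
    by (simp add: sum_product)
  also have "\<dots> = (\<Sum>j\<le>?m. \<Sum>i\<le>?m. \<Sum>k\<le>?m. coef (a j) (take i w) * coef (b k) (drop i w))"
    by (rule sum.swap)
  also have "\<dots> = (\<Sum>j\<le>?m. \<Sum>k\<le>?m. \<Sum>i\<le>?m. coef (a j) (take i w) * coef (b k) (drop i w))"
    by (rule sum.cong[OF refl], rule sum.swap)
  also have "\<dots> = (\<Sum>j\<le>?m. \<Sum>k\<le>?m. coef (a j * b k) w)"
    by (simp add: coef_times nc_mult_def)
  also have "\<dots> = (\<Sum>(j,k)\<in>{..?m}\<times>{..?m}. coef (a j * b k) w)"
    by (simp add: sum.cartesian_product)
  also have "\<dots> = (\<Sum>(j,k)\<in>{(j,k). j + k \<le> ?m}. coef (a j * b k) w)"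
  proof (rule sum.mono_neutral_right)
    show "\<forall>p\<in>{..?m} \<times> {..?m} - {(j, k). j + k \<le> ?m}. (case p of (j, k) \<Rightarrow> coef (a j * b k) w) = 0"
      by (auto simp: not_le intro!: deg_geD[OF deg_ge_times[OF a b]])
  qed auto
  also have "\<dots> = (\<Sum>n\<le>?m. \<Sum>k\<le>n. coef (a (n - k) * b k) w)"
    by (subst sum.Sigma, simp, simp,
        rule sum.reindex_bij_witness[of _ "\<lambda>(n,k). (n - k, k)" "\<lambda>(j,k). (j + k, k)"]) auto
  finally show "coef (tsum a * tsum b) w = coef (tsum (\<lambda>n. \<Sum>k\<le>n. a (n - k) * b k)) w"
    by (simp add: coef_tsum)
qed

lemma tsum_single: "tsum (\<lambda>n. if n = 0 then P else 0) = P"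
proof (rule ncs_eqI)
  show "coef (tsum (\<lambda>n. if n = 0 then P else 0)) w = coef P w" for w
    unfolding coef_tsum by (subst sum.remove[of _ 0]) auto
qed

lemma tsum_mult_left:
  assumes "\<And>n. deg_ge n (a n)"
  shows "P * tsum a = tsum (\<lambda>n. P * a n)"
proof -
  have "P * tsum a = tsum (\<lambda>n. \<Sum>k\<le>n. (if n - k = 0 then P else 0) * a k)"
    using tsum_cauchy[of "\<lambda>n. if n = 0 then P else 0" a] assms by (simp add: tsum_single)
  moreover have "(\<Sum>k\<le>n. (if n - k = 0 then P else 0) * a k) = P * a n" for n
    by (subst sum.remove[of _ n]) auto
  ultimately show ?thesis by simp
qed


subsection \<open>Evaluating univariate power series\<close>

text \<open>
  For \<open>P\<close> without constant term, this is the continuous homomorphism from \<open>\<rat>[[T]]\<close> that maps \<open>T\<close>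
  to \<open>P\<close>. Through it, the facts that \<open>exp\<close> and \<open>log\<close> are inverse to each other and that
  \<open>exp(T) exp(-T) = 1\<close> carry over from commutative power series.
\<close>

definition fps_eval :: "rat fps \<Rightarrow> ncs \<Rightarrow> ncs" where
  "fps_eval f P = tsum (\<lambda>n. qscale (fps_nth f n) (P ^ n))"

lemma deg_ge_fps_eval_term: "deg_ge (Suc 0) P \<Longrightarrow> deg_ge n (qscale q (P ^ n))"
  by (intro deg_ge_qscale deg_ge_power)

lemma coef_fps_eval_Nil [simp]: "coef (fps_eval f P) [] = fps_nth f 0"
  by (simp add: fps_eval_def coef_tsum)

lemma fps_eval_add: "fps_eval (f + g) P = fps_eval f P + fps_eval g P"
  unfolding fps_eval_def tsum_add[symmetric] by (simp add: qscale.scale_left_distrib)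

lemma fps_eval_times:
  assumes P: "deg_ge (Suc 0) P"
  shows "fps_eval (f * g) P = fps_eval f P * fps_eval g P"
proof -
  have "(\<Sum>k\<le>n. qscale (fps_nth f (n - k)) (P ^ (n - k)) * qscale (fps_nth g k) (P ^ k))
      = qscale (fps_nth (f * g) n) (P ^ n)" for n
  proof -
    have "(\<Sum>k\<le>n. qscale (fps_nth f (n - k)) (P ^ (n - k)) * qscale (fps_nth g k) (P ^ k))
        = (\<Sum>k\<le>n. qscale (fps_nth g k * fps_nth f (n - k)) (P ^ n))"
      by (rule sum.cong) (simp_all flip: power_add)
    also have "\<dots> = qscale (fps_nth (g * f) n) (P ^ n)"
      by (simp add: fps_mult_nth qscale.scale_sum_left atLeast0AtMost)
    finally show ?thesis by (simp add: mult.commute)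
  qed
  then show ?thesis
    unfolding fps_eval_def using P by (subst tsum_cauchy) (simp_all add: deg_ge_fps_eval_term)
qed

lemma fps_eval_one [simp]: "fps_eval 1 P = 1"
proof -
  have "(\<lambda>n. qscale (fps_nth 1 n) (P ^ n)) = (\<lambda>n. if n = 0 then 1 else 0)"
    by auto
  then show ?thesis by (simp only: fps_eval_def tsum_single)
qed

lemma fps_eval_X: 
  assumes "deg_ge (Suc 0) P"
  shows "fps_eval fps_X P = P"
proof (rule ncs_eqI)
  fix w :: "letter list"
  have "coef (fps_eval fps_X P) w = (\<Sum>n\<le>Suc (length w). coef (qscale (fps_nth fps_X n) (P ^ n)) w)"
    unfolding fps_eval_def using assms by (intro coef_tsum_upto deg_ge_fps_eval_term) auto
  also have "\<dots> = coef P w"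
    by (subst sum.remove[of _ "Suc 0"]) (auto intro!: sum.neutral simp: fps_X_def)
  finally show "coef (fps_eval fps_X P) w = coef P w" .
qed

lemma fps_eval_power: "deg_ge (Suc 0) P \<Longrightarrow> fps_eval (f ^ n) P = fps_eval f P ^ n"
  by (induction n) (simp_all add: fps_eval_times)

lemma deg_ge_fps_eval: "fps_nth f 0 = 0 \<Longrightarrow> deg_ge (Suc 0) (fps_eval f P)"
  by (simp add: deg_ge_1_iff)

text \<open>
  Both sides are the double sum of \<open>f\<^sub>n (g\<^sup>n)\<^sub>k P\<^sup>k\<close>; the terms with \<open>n > k\<close> vanish because \<open>g\<close> has no
  constant term.
\<close>

lemma fps_eval_compose:
  assumes P: "deg_ge (Suc 0) P" and g: "fps_nth g 0 = 0"
  shows "fps_eval (f oo g) P = fps_eval f (fps_eval g P)"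
proof (rule ncs_eqI)
  fix w :: "letter list"
  let ?m = "length w"
  have "coef (fps_eval f (fps_eval g P)) w = (\<Sum>n\<le>?m. fps_nth f n * coef (fps_eval (g ^ n) P) w)"
    using P by (simp add: fps_eval_def[of f] coef_tsum fps_eval_power)
  also have "\<dots> = (\<Sum>n\<le>?m. \<Sum>k\<le>?m. fps_nth f n * (fps_nth (g ^ n) k * coef (P ^ k) w))"
    by (simp add: fps_eval_def coef_tsum sum_distrib_left)
  also have "\<dots> = (\<Sum>k\<le>?m. \<Sum>n\<le>?m. fps_nth f n * (fps_nth (g ^ n) k * coef (P ^ k) w))"
    by (rule sum.swap)
  also have "\<dots> = (\<Sum>k\<le>?m. fps_nth (f oo g) k * coef (P ^ k) w)"
  proof (rule sum.cong[OF refl])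
    fix k assume "k \<in> {..?m}"
    then have "(\<Sum>n\<in>{0..k}. fps_nth f n * fps_nth (g ^ n) k)
        = (\<Sum>n\<le>?m. fps_nth f n * fps_nth (g ^ n) k)"
      using startsby_zero_power_prefix[OF g] by (intro sum.mono_neutral_left) auto
    then show "(\<Sum>n\<le>?m. fps_nth f n * (fps_nth (g ^ n) k * coef (P ^ k) w))
        = fps_nth (f oo g) k * coef (P ^ k) w"
      by (simp add: fps_compose_nth sum_distrib_right mult.assoc)
  qed
  also have "\<dots> = coef (fps_eval (f oo g) P) w"
    by (simp add: fps_eval_def coef_tsum)
  finally show "coef (fps_eval (f oo g) P) w = coef (fps_eval f (fps_eval g P)) w" by simp
qed

text \<open>
  These agree with the explicit sums in the definition of the Hausdorff series, see
  \<open>coef_ncs_exp\<close> and \<open>coef_ncs_log\<close>.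
\<close>

definition ncs_exp :: "ncs \<Rightarrow> ncs" where "ncs_exp P = fps_eval (fps_exp 1) P"
definition ncs_log :: "ncs \<Rightarrow> ncs" where "ncs_log W = fps_eval (fps_ln 1) (W - 1)"

lemma ncs_exp_eq: "ncs_exp P = tsum (\<lambda>n. qscale (1 / fact n) (P ^ n))"
  by (simp add: ncs_exp_def fps_eval_def)

lemma coef_ncs_exp_Nil [simp]: "coef (ncs_exp P) [] = 1"
  by (simp add: ncs_exp_def)

lemma coef_ncs_exp: "coef (ncs_exp P) = nc_exp (coef P)"
  by (simp add: ncs_exp_eq coef_tsum nc_exp_def coef_power fun_eq_iff)

lemma coef_ncs_log: "coef (ncs_log W) = nc_log (coef W)"
proof
  fix w
  have "coef (W - 1) = (\<lambda>v. coef W v - nc_one v)"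
    by (simp add: fun_eq_iff one_ncs_def)
  then have "coef (ncs_log W) w
      = (\<Sum>n\<le>length w. fps_nth (fps_ln 1) n * nc_power (\<lambda>v. coef W v - nc_one v) n w)"
    by (simp add: ncs_log_def fps_eval_def coef_tsum coef_power)
  also have "\<dots> = (\<Sum>n=1..length w. fps_nth (fps_ln 1) n * nc_power (\<lambda>v. coef W v - nc_one v) n w)"
    by (rule sum.mono_neutral_right) (auto simp: fps_ln_nth)
  also have "\<dots> = nc_log (coef W) w"
    unfolding nc_log_def by (rule sum.cong) (auto simp: fps_ln_nth power_diff)
  finally show "coef (ncs_log W) w = nc_log (coef W) w" .
qed

lemma ncs_exp_ncs_log:
  assumes "coef W [] = 1"
  shows "ncs_exp (ncs_log W) = W"
proof -
  have "fps_exp 1 - 1 oo fps_ln (1::rat) = fps_X"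
    by (simp only: fps_ln_fps_exp_inv[OF one_neq_zero] fps_inv_fps_exp_compose(2)[OF one_neq_zero])
  then have *: "fps_exp 1 oo fps_ln (1::rat) = fps_X + 1"
    by (simp add: fps_compose_sub_distrib diff_eq_eq)
  have "deg_ge (Suc 0) (W - 1)" using assms by (simp add: deg_ge_1_iff)
  then show ?thesis
    by (simp add: ncs_exp_def ncs_log_def fps_eval_compose[symmetric] * fps_eval_add fps_eval_X)
qed

lemma ncs_log_ncs_exp:
  assumes P: "deg_ge (Suc 0) P"
  shows "ncs_log (ncs_exp P) = P"
proof -
  have *: "fps_ln 1 oo (fps_exp 1 - 1) = (fps_X :: rat fps)"
    by (simp only: fps_ln_fps_exp_inv[OF one_neq_zero] fps_inv_fps_exp_compose(1)[OF one_neq_zero])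
  have "ncs_exp P - 1 = fps_eval (fps_exp 1 - 1) P"
    using fps_eval_add[of "fps_exp 1 - 1" 1 P] by (simp add: ncs_exp_def)
  then have "ncs_log (ncs_exp P) = fps_eval (fps_ln 1 oo (fps_exp 1 - 1)) P"
    using P by (simp add: ncs_log_def fps_eval_compose)
  then show ?thesis using P by (simp add: * fps_eval_X)
qed

lemma deg_ge_ncs_log: "deg_ge (Suc 0) (ncs_log W)"
  by (simp add: ncs_log_def deg_ge_fps_eval)

lemma ncs_exp_uminus: "ncs_exp (- P) = fps_eval (fps_exp (-1)) P"
proof -
  have "(- P) ^ n = qscale ((-1) ^ n) (P ^ n)" for n
    by (induction n) auto
  then show ?thesis by (simp add: ncs_exp_def fps_eval_def)
qed

lemma ncs_exp_times_uminus:
  assumes "deg_ge (Suc 0) P"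
  shows "ncs_exp P * ncs_exp (- P) = 1" "ncs_exp (- P) * ncs_exp P = 1"
  using assms by (simp_all add: ncs_exp_uminus, simp_all add: ncs_exp_def flip: fps_eval_times fps_exp_add_mult)


subsection \<open>Conjugation and the derivative of the exponential\<close>

text \<open>The right adjoint action \<open>W \<mapsto> [W, Z]\<close>.\<close>

definition cmt :: "ncs \<Rightarrow> ncs \<Rightarrow> ncs" where
  "cmt Z W = W * Z - Z * W"

lemma deg_ge_cmt:
  assumes "deg_ge (Suc 0) Z" "deg_ge n W"
  shows "deg_ge (Suc n) (cmt Z W)"
  using deg_ge_times[OF assms] deg_ge_times[OF assms(2,1)]
  by (simp add: cmt_def deg_ge_diff)

lemma deg_ge_cmt_funpow:
  assumes "deg_ge (Suc 0) Z" "deg_ge n W"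
  shows "deg_ge (n + k) ((cmt Z ^^ k) W)"
  using assms by (induction k) (auto intro: deg_ge_cmt)

text \<open>
  Right multiplication by \<open>Z\<close> is the sum of two commuting operators, left multiplication by \<open>Z\<close> and
  \<open>cmt Z\<close>; this is the binomial theorem for its \<open>n\<close>-th power.
\<close>

lemma times_power_eq_cmt:
  "W * Z ^ n = (\<Sum>k\<le>n. qscale (of_nat (n choose k)) (Z ^ (n - k) * (cmt Z ^^ k) W))"
proof (induction n)
  case (Suc n)
  let ?r = "\<lambda>k. (cmt Z ^^ k) W"
  let ?c = "\<lambda>n k. of_nat (n choose k) :: rat"
  have "W * Z ^ Suc n = (\<Sum>k\<le>n. qscale (?c n k) (Z ^ (n - k) * (?r k * Z)))"
    by (simp only: power_Suc2 mult.assoc[symmetric] Suc.IH)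
      (simp add: sum_distrib_right mult.assoc)
  also have "\<dots> = (\<Sum>k\<le>n. qscale (?c n k) (Z ^ (Suc n - k) * ?r k))
      + (\<Sum>k\<le>n. qscale (?c n k) (Z ^ (n - k) * ?r (Suc k)))"
    unfolding sum.distrib[symmetric]
  proof (rule sum.cong[OF refl])
    fix k assume "k \<in> {..n}"
    moreover have "?r k * Z = Z * ?r k + ?r (Suc k)" by (simp add: cmt_def)
    ultimately show "qscale (?c n k) (Z ^ (n - k) * (?r k * Z))
        = qscale (?c n k) (Z ^ (Suc n - k) * ?r k) + qscale (?c n k) (Z ^ (n - k) * ?r (Suc k))"
      by (simp add: Suc_diff_le distrib_left qscale.scale_right_distrib power_Suc2 mult.assoc
          del: power_Suc funpow.simps)
  qed
  also have "(\<Sum>k\<le>n. qscale (?c n k) (Z ^ (Suc n - k) * ?r k))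
      = (\<Sum>k\<le>Suc n. qscale (?c n k) (Z ^ (Suc n - k) * ?r k))"
    by simp
  also have "\<dots> = Z ^ Suc n * W + (\<Sum>k\<le>n. qscale (?c n (Suc k)) (Z ^ (n - k) * ?r (Suc k)))"
    by (subst sum.atMost_Suc_shift) simp
  finally show ?case
    by (subst sum.atMost_Suc_shift)
      (simp add: qscale.scale_left_distrib sum.distrib algebra_simps del: funpow.simps)
qed simp

text \<open>
  This is \<open>e\<^sup>-\<^sup>Z W e\<^sup>Z = \<Sum>k. (cmt Z)\<^sup>k(W) / k!\<close>: division by \<open>n!\<close> turns the binomial expansion of
  \<open>W * Z\<^sup>n\<close> into a Cauchy product.
\<close>

lemma times_ncs_exp:
  assumes Z: "deg_ge (Suc 0) Z"
  shows "W * ncs_exp Z = ncs_exp Z * tsum (\<lambda>k. qscale (1 / fact k) ((cmt Z ^^ k) W))"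
proof -
  have "W * ncs_exp Z = tsum (\<lambda>n. qscale (1 / fact n) (W * Z ^ n))"
    using Z by (simp add: ncs_exp_eq tsum_mult_left deg_ge_fps_eval_term)
  also have "(\<lambda>n. qscale (1 / fact n) (W * Z ^ n))
      = (\<lambda>n. \<Sum>k\<le>n. qscale (1 / fact (n - k)) (Z ^ (n - k)) * qscale (1 / fact k) ((cmt Z ^^ k) W))"
    by (auto simp: times_power_eq_cmt qscale.scale_sum_right binomial_fact intro!: sum.cong)
  also have "tsum \<dots> = ncs_exp Z * tsum (\<lambda>k. qscale (1 / fact k) ((cmt Z ^^ k) W))"
    unfolding ncs_exp_eq using Z deg_ge_cmt_funpow[OF Z, of 0 W]
    by (intro tsum_cauchy[symmetric]) (auto intro: deg_ge_fps_eval_term deg_ge_qscale)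
  finally show ?thesis .
qed

text \<open>The Euler derivation of the grading by degree.\<close>

definition euler :: "ncs \<Rightarrow> ncs" where
  "euler P = Series (\<lambda>w. of_nat (length w) * coef P w)"

lemma coef_euler [simp]: "coef (euler P) w = of_nat (length w) * coef P w"
  by (simp add: euler_def)

lemma euler_simps:
  "euler 0 = 0" "euler 1 = 0" "euler (P + Q) = euler P + euler Q"
  "euler (P - Q) = euler P - euler Q" "euler (qscale q P) = qscale q (euler P)"
  by (auto intro!: ncs_eqI simp: algebra_simps coef_one)

lemma euler_times: "euler (P * Q) = euler P * Q + P * euler Q"
proof (rule ncs_eqI)
  fix w
  show "coef (euler (P * Q)) w = coef (euler P * Q + P * euler Q) w"
    by (simp add: coef_times nc_mult_def sum_distrib_left flip: sum.distrib)
      (rule sum.cong, auto simp: of_nat_diff algebra_simps)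
qed

lemma deg_ge_euler: "deg_ge n P \<Longrightarrow> deg_ge n (euler P)"
  by (simp add: deg_ge_def)

lemma deg_ge_1_euler: "deg_ge (Suc 0) (euler P)"
  by (simp add: deg_ge_def)

lemma euler_tsum: "euler (tsum a) = tsum (\<lambda>n. euler (a n))"
  by (rule ncs_eqI) (simp add: coef_tsum sum_distrib_left)

text \<open>
  The derivation yields the sum of \<open>Z\<^sup>i (euler Z) Z\<^sup>j\<close> over \<open>i + j = n - 1\<close>. Moving the powers of \<open>Z\<close>
  to the left by the binomial expansion adds up binomial coefficients, here by Pascal's rule in an
  induction on \<open>n\<close>.
\<close>

lemma euler_power:
  "euler (Z ^ n)
    = (\<Sum>k<n. qscale (of_nat (n choose Suc k)) (Z ^ (n - Suc k) * (cmt Z ^^ k) (euler Z)))"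
proof (induction n)
  case (Suc n)
  let ?r = "\<lambda>k. (cmt Z ^^ k) (euler Z)"
  let ?c = "\<lambda>n k. of_nat (n choose k) :: rat"
  have "euler (Z ^ Suc n) = euler Z * Z ^ n + Z * euler (Z ^ n)"
    by (simp add: euler_times)
  also have "Z * euler (Z ^ n) = (\<Sum>k<n. qscale (?c n (Suc k)) (Z ^ (n - k) * ?r k))"
    unfolding Suc.IH sum_distrib_left
    by (rule sum.cong) (auto simp: Suc_diff_Suc simp flip: mult.assoc power_Suc)
  also have "\<dots> = (\<Sum>k\<le>n. qscale (?c n (Suc k)) (Z ^ (n - k) * ?r k))"
    by (simp add: lessThan_Suc_atMost[symmetric])
  finally show ?case
    unfolding times_power_eq_cmt
    by (simp add: lessThan_Suc_atMost qscale.scale_left_distrib flip: sum.distrib)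
qed (simp add: euler_simps)

text \<open>
  The formula for the differential of the exponential map,
  \<open>e\<^sup>-\<^sup>Z d(e\<^sup>Z) = \<Sum>k. (cmt Z)\<^sup>k(dZ) / (k + 1)!\<close>.
\<close>

lemma euler_ncs_exp:
  assumes Z: "deg_ge (Suc 0) Z"
  shows "euler (ncs_exp Z) = ncs_exp Z * tsum (\<lambda>k. qscale (1 / fact (Suc k)) ((cmt Z ^^ k) (euler Z)))"
proof -
  let ?r = "\<lambda>k. (cmt Z ^^ k) (euler Z)"
  \<comment> \<open>The derivative of the \<open>(n+1)\<close>-st term of the exponential is the \<open>n\<close>-th term of the Cauchy product.\<close>
  let ?b = "\<lambda>n. qscale (1 / fact n) (euler (Z ^ n))"
  let ?d = "\<lambda>n. \<Sum>k\<le>n. qscale (1 / fact (n - k)) (Z ^ (n - k)) * qscale (1 / fact (Suc k)) (?r k)"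
  have b: "deg_ge n (?b n)" for n
    using Z by (intro deg_ge_qscale deg_ge_euler deg_ge_power)
  have bd: "?b (Suc n) = ?d n" for n
    by (auto simp: euler_power qscale.scale_sum_right binomial_fact lessThan_Suc_atMost
        simp del: fact_Suc binomial_Suc_Suc power_Suc intro!: sum.cong)
  have "euler (ncs_exp Z) = tsum ?b"
    by (simp add: ncs_exp_eq euler_tsum euler_simps)
  also have "\<dots> = tsum ?d"
  proof (rule ncs_eqI)
    fix w :: "letter list"
    have "coef (tsum ?b) w = (\<Sum>n\<le>Suc (length w). coef (?b n) w)"
      by (rule coef_tsum_upto[OF b]) simp
    also have "\<dots> = (\<Sum>n\<le>length w. coef (?d n) w)"
      by (subst sum.atMost_Suc_shift) (simp only: bd, simp add: euler_simps)
    finally show "coef (tsum ?b) w = coef (tsum ?d) w" by (simp only: coef_tsum)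
  qed
  also have "\<dots> = ncs_exp Z * tsum (\<lambda>k. qscale (1 / fact (Suc k)) (?r k))"
    unfolding ncs_exp_eq using Z deg_ge_cmt_funpow[OF Z, of 0 "euler Z"]
    by (intro tsum_cauchy[symmetric]) (auto intro: deg_ge_fps_eval_term deg_ge_qscale)
  finally show ?thesis .
qed


subsection \<open>The Hausdorff series\<close>

definition var :: "letter \<Rightarrow> ncs" where "var l = Series (nc_var l)"

abbreviation "VX \<equiv> var LetterX"
abbreviation "VY \<equiv> var LetterY"

definition bch :: ncs where "bch = ncs_log (ncs_exp VX * ncs_exp VY)"

lemma coef_var: "coef (var l) = nc_var l"
  by (simp add: var_def)

lemma coef_bch: "coef bch = hausdorff"
  by (simp add: bch_def hausdorff_def coef_ncs_log coef_times coef_ncs_exp coef_var)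

lemma coef_var_Nil [simp]: "coef (var l) [] = 0"
  by (simp add: coef_var nc_var_def)

lemma lderiv_var: "lderiv l (var m) = (if l = m then 1 else 0)"
  by (auto intro!: ncs_eqI simp: coef_var nc_var_def coef_one)

lemma deg_ge_var: "deg_ge (Suc 0) (var l)"
  by (simp add: deg_ge_1_iff)

lemma deg_ge_bch: "deg_ge (Suc 0) bch"
  by (simp add: bch_def deg_ge_ncs_log)

lemma euler_var [simp]: "euler (var l) = var l"
  by (auto intro!: ncs_eqI simp: coef_var nc_var_def)

lemma ncs_exp_bch: "ncs_exp bch = ncs_exp VX * ncs_exp VY"
  by (simp add: bch_def ncs_exp_ncs_log)

lemma cmt_self: "(cmt Z ^^ k) Z = (if k = 0 then Z else 0)"
proof (induction k)
  case (Suc k)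
  then show ?case by (cases k) (simp_all add: cmt_def)
qed simp

lemma tsum_cmt_self: "a 0 = 1 \<Longrightarrow> tsum (\<lambda>k. qscale (a k) ((cmt Z ^^ k) Z)) = Z"
proof -
  assume "a 0 = 1"
  then have "(\<lambda>k. qscale (a k) ((cmt Z ^^ k) Z)) = (\<lambda>k. if k = 0 then Z else 0)"
    by (auto simp: cmt_self)
  then show ?thesis by (simp only: tsum_single)
qed

text \<open>
  Let \<open>E = exp H = exp X * exp Y\<close>. The derivation maps \<open>E\<close> to \<open>X * E + E * Y\<close>, as \<open>X\<close> and \<open>Y\<close> commute
  with their own exponentials; division by \<open>E\<close> on the left gives the right-hand side. In degree
  \<open>n\<close> the left-hand side is \<open>n H\<^sub>n\<close> plus brackets of components of \<open>H\<close> of degree less than \<open>n\<close>.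
\<close>

theorem hausdorff_recursion:
  "tsum (\<lambda>k. qscale (1 / fact (Suc k)) ((cmt bch ^^ k) (euler bch)))
    = tsum (\<lambda>k. qscale (1 / fact k) ((cmt bch ^^ k) VX)) + VY" (is "?l = ?r + VY")
proof -
  have ex: "euler (ncs_exp (var l)) = ncs_exp (var l) * var l" for l
    using euler_ncs_exp[OF deg_ge_var, of l] tsum_cmt_self[of "\<lambda>k. 1 / fact (Suc k)" "var l"] by simp
  have cx: "var l * ncs_exp (var l) = ncs_exp (var l) * var l" for l
    using times_ncs_exp[OF deg_ge_var, of "var l" l] tsum_cmt_self[of "\<lambda>k. 1 / fact k" "var l"] by simp
  have cx': "VX * (ncs_exp VX * W) = ncs_exp VX * (VX * W)" for W
    by (simp add: cx flip: mult.assoc)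
  have "ncs_exp bch * ?l = euler (ncs_exp bch)"
    by (rule euler_ncs_exp[OF deg_ge_bch, symmetric])
  also have "\<dots> = VX * ncs_exp bch + ncs_exp bch * VY"
    unfolding ncs_exp_bch by (simp add: euler_times ex cx' mult.assoc)
  also have "\<dots> = ncs_exp bch * (?r + VY)"
    by (simp add: times_ncs_exp[OF deg_ge_bch] distrib_left)
  finally have "ncs_exp (- bch) * (ncs_exp bch * ?l) = ncs_exp (- bch) * (ncs_exp bch * (?r + VY))" by simp
  then show ?thesis
    by (simp only: mult.assoc[symmetric] ncs_exp_times_uminus[OF deg_ge_bch] mult_1_left)
qed


subsection \<open>Substitution\<close>

text \<open>
  The substitution of \<open>P\<close> and \<open>Q\<close> for the variables, first in the component of degree \<open>n\<close>, by
  recursion on the first letter of its words.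
\<close>

primrec subst_homog :: "ncs \<Rightarrow> ncs \<Rightarrow> nat \<Rightarrow> ncs \<Rightarrow> ncs" where
  "subst_homog P Q 0 T = qscale (coef T []) 1"
| "subst_homog P Q (Suc n) T = P * subst_homog P Q n (lderiv LetterX T) + Q * subst_homog P Q n (lderiv LetterY T)"

definition substitute :: "ncs \<Rightarrow> ncs \<Rightarrow> ncs \<Rightarrow> ncs" where
  "substitute P Q T = tsum (\<lambda>n. subst_homog P Q n T)"

lemma subst_homog_add: "subst_homog P Q n (T + U) = subst_homog P Q n T + subst_homog P Q n U"
  by (induction n arbitrary: T U) (auto simp: qscale.scale_left_distrib algebra_simps)

lemma subst_homog_qscale: "subst_homog P Q n (qscale q T) = qscale q (subst_homog P Q n T)"
  by (induction n arbitrary: T) (auto simp: qscale.scale_right_distrib)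

lemma subst_homog_cong:
  "(\<And>w. length w = n \<Longrightarrow> coef T w = coef U w) \<Longrightarrow> subst_homog P Q n T = subst_homog P Q n U"
proof (induction n arbitrary: T U)
  case (Suc n)
  have "subst_homog P Q n (lderiv l T) = subst_homog P Q n (lderiv l U)" for l
    by (rule Suc.IH) (simp add: Suc.prems)
  then show ?case by simp
qed simp

lemma subst_homog_times:
  "subst_homog P Q n (T * U) = (\<Sum>k\<le>n. subst_homog P Q (n - k) T * subst_homog P Q k U)"
proof (induction n arbitrary: T U)
  case (Suc n)
  show ?case
    by (subst sum.atMost_Suc)
     (simp add: Suc.IH subst_homog_add subst_homog_qscale sum_distrib_left sum.distrib algebra_simps Suc_diff_le
        qscale.scale_right_distrib)
qed simp

lemma deg_ge_subst_homog:
  assumes "deg_ge (Suc 0) P" "deg_ge (Suc 0) Q"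
  shows "deg_ge n (subst_homog P Q n T)"
  using deg_ge_times[OF assms(1)] deg_ge_times[OF assms(2)]
  by (induction n arbitrary: T) (auto intro!: deg_ge_add)

context
  fixes P Q :: ncs
  assumes P: "deg_ge (Suc 0) P" and Q: "deg_ge (Suc 0) Q"
begin

lemma substitute_add: "substitute P Q (T + U) = substitute P Q T + substitute P Q U"
  by (simp add: substitute_def subst_homog_add tsum_add)

lemma substitute_qscale: "substitute P Q (qscale q T) = qscale q (substitute P Q T)"
  by (simp add: substitute_def subst_homog_qscale tsum_qscale)

lemma substitute_uminus: "substitute P Q (- T) = - substitute P Q T"
  using substitute_qscale[of "-1" T] by simp

lemma substitute_diff: "substitute P Q (T - U) = substitute P Q T - substitute P Q U"
  using substitute_add[of T "- U"] by (simp add: substitute_uminus)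

lemma substitute_times: "substitute P Q (T * U) = substitute P Q T * substitute P Q U"
  unfolding substitute_def by (subst tsum_cauchy) (simp_all add: deg_ge_subst_homog P Q subst_homog_times)

lemma substitute_zero [simp]: "substitute P Q 0 = 0"
  using substitute_add[of 0 0] by simp

lemma subst_homog_one: "subst_homog P Q n 1 = (if n = 0 then 1 else 0)"
proof -
  have "subst_homog P Q n 0 = 0" for n by (induction n) auto
  then show ?thesis by (cases n) auto
qed

lemma substitute_one [simp]: "substitute P Q 1 = 1"
  unfolding substitute_def subst_homog_one by (rule tsum_single)

lemma substitute_var: "substitute P Q VX = P" "substitute P Q VY = Q"
proof -
  have "subst_homog P Q n 0 = 0" for n by (induction n) auto
  then have *: "subst_homog P Q n (var l)
      = (if n = Suc 0 then if l = LetterX then P else Q else 0)" for n l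
    by (cases n; cases l) (auto simp: lderiv_var subst_homog_one)
  have "substitute P Q (var l) = (if l = LetterX then P else Q)" for l
  proof (rule ncs_eqI)
    fix w :: "letter list"
    have "coef (substitute P Q (var l)) w = (\<Sum>n\<le>Suc (length w). coef (subst_homog P Q n (var l)) w)"
      unfolding substitute_def using P Q by (intro coef_tsum_upto deg_ge_subst_homog) auto
    also have "\<dots> = coef (if l = LetterX then P else Q) w"
      by (subst sum.remove[of _ "Suc 0"]) (auto simp: * simp del: subst_homog.simps)
    finally show "coef (substitute P Q (var l)) w = coef (if l = LetterX then P else Q) w" .
  qed
  then show "substitute P Q VX = P" "substitute P Q VY = Q" by simp_all
qed

lemma substitute_power: "substitute P Q (T ^ n) = substitute P Q T ^ n"
  by (induction n) (simp_all add: substitute_times)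

text \<open>
  As \<open>P\<close> and \<open>Q\<close> have no constant term, words longer than \<open>w\<close> do not contribute to the coefficient
  of \<open>w\<close>.
\<close>

lemma substitute_cong_words:
  assumes "\<And>v. length v \<le> length w \<Longrightarrow> coef T v = coef U v"
  shows "coef (substitute P Q T) w = coef (substitute P Q U) w"
  unfolding substitute_def coef_tsum
  by (rule sum.cong[OF refl], rule arg_cong[of _ _ "\<lambda>P. coef P w"], rule subst_homog_cong)
    (use assms in auto)

lemma substitute_sum: "substitute P Q (\<Sum>i\<in>A. f i) = (\<Sum>i\<in>A. substitute P Q (f i))"
  by (induction A rule: infinite_finite_induct) (auto simp: substitute_add)

lemma substitute_tsum:
  assumes a: "\<And>n. deg_ge n (a n)"
  shows "substitute P Q (tsum a) = tsum (\<lambda>n. substitute P Q (a n))"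
proof (rule ncs_eqI)
  fix w :: "letter list"
  have "coef (substitute P Q (tsum a)) w = coef (substitute P Q (\<Sum>n\<le>length w. a n)) w"
    by (rule substitute_cong_words) (simp add: coef_tsum_upto[OF a])
  then show "coef (substitute P Q (tsum a)) w = coef (tsum (\<lambda>n. substitute P Q (a n))) w"
    by (simp add: substitute_sum coef_tsum)
qed

lemma substitute_fps_eval:
  assumes "deg_ge (Suc 0) T"
  shows "substitute P Q (fps_eval f T) = fps_eval f (substitute P Q T)"
  unfolding fps_eval_def using assms
  by (subst substitute_tsum) (simp_all add: deg_ge_fps_eval_term substitute_qscale substitute_power)

lemma substitute_bch: "substitute P Q bch = ncs_log (ncs_exp P * ncs_exp Q)"
proof -
  have 1: "deg_ge (Suc 0) (ncs_exp VX * ncs_exp VY - 1)"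
    by (simp add: deg_ge_1_iff)
  show ?thesis
    unfolding bch_def ncs_log_def substitute_fps_eval[OF 1] substitute_diff substitute_times substitute_one
    by (simp add: ncs_exp_def substitute_fps_eval[OF deg_ge_var] substitute_var)
qed

end

lemma deg_ge_times_diff:
  assumes "deg_ge m (P - P')" "deg_ge m (Q - Q')"
  shows "deg_ge m (P * Q - P' * Q')"
proof -
  have "P * Q - P' * Q' = (P - P') * Q + P' * (Q - Q')"
    by (simp add: algebra_simps)
  then show ?thesis
    using deg_ge_times[OF assms(1), of 0 Q] deg_ge_times[of 0 P', OF _ assms(2)]
    by (auto intro: deg_ge_add)
qed

text \<open>
  Substitution is compatible with congruence modulo terms of degree at least \<open>m\<close>, since these terms
  form an ideal. This justifies working with truncated series.
\<close>

lemma deg_ge_substitute_diff: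
  assumes "deg_ge m (P - P')" "deg_ge m (Q - Q')" "deg_ge m (T - T')"
    "deg_ge (Suc 0) P" "deg_ge (Suc 0) Q"
  shows "deg_ge m (substitute P Q T - substitute P' Q' T')"
proof -
  have 1: "deg_ge m (subst_homog P Q n T - subst_homog P' Q' n T)" for n T
  proof (induction n arbitrary: T)
    case (Suc n)
    have *: "subst_homog P Q (Suc n) T - subst_homog P' Q' (Suc n) T
       = (P * subst_homog P Q n (lderiv LetterX T) - P' * subst_homog P' Q' n (lderiv LetterX T))
       + (Q * subst_homog P Q n (lderiv LetterY T) - Q' * subst_homog P' Q' n (lderiv LetterY T))" by simp
    show ?case unfolding * using assms Suc by (intro deg_ge_add deg_ge_times_diff)
  qed simp
  have 2: "coef (substitute P Q T) w = coef (substitute P Q T') w" if "length w < m" for w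
    by (rule substitute_cong_words) (use that deg_geD[OF assms(3)] assms(4,5) in auto)
  show ?thesis unfolding deg_ge_def
  proof (intro allI impI)
    fix w :: "letter list" assume w: "length w < m"
    have "coef (subst_homog P Q n T') w = coef (subst_homog P' Q' n T') w" for n
      using deg_geD[OF 1 w] by simp
    then have "coef (substitute P Q T') w = coef (substitute P' Q' T') w"
      by (simp add: substitute_def coef_tsum)
    then show "coef (substitute P Q T - substitute P' Q' T') w = 0"
      using 2[OF w] by simp
  qed
qed

lemma conj_ncs_exp:
  assumes Z: "deg_ge (Suc 0) Z"
  shows "ncs_exp (- Z) * W * ncs_exp Z = tsum (\<lambda>k. qscale (1 / fact k) ((cmt Z ^^ k) W))"
  using times_ncs_exp[OF Z, of W] ncs_exp_times_uminus(2)[OF Z]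
  by (metis mult.assoc mult_1_left)

lemma conj_power:
  assumes "V * U = (1 :: ncs)"
  shows "(U * W * V) ^ n * U = U * W ^ n"
proof (induction n)
  case (Suc n)
  have "(U * W * V) ^ Suc n * U = U * W * V * ((U * W * V) ^ n * U)"
    by (simp add: mult.assoc)
  also have "\<dots> = U * W * (V * U) * W ^ n"
    unfolding Suc by (simp add: mult.assoc)
  finally show ?case using assms by (simp add: mult.assoc)
qed simp

text \<open>
  Since conjugation commutes with the exponential function, \<open>e\<^sup>X e\<^sup>Y e\<^sup>-\<^sup>X\<close> is the exponential of
  \<open>e\<^sup>X Y e\<^sup>-\<^sup>X\<close>, and \<open>H(H(X,Y),-X)\<close> is its logarithm.
\<close>

lemma hausdorff_conjugation:
  "substitute bch (- VX) bch = tsum (\<lambda>k. qscale (1 / fact k) ((cmt (- VX) ^^ k) VY))"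
proof -
  let ?U = "ncs_exp VX" and ?V = "ncs_exp (- VX)"
  have d: "deg_ge (Suc 0) (- VX)" by (simp add: deg_ge_1_iff)
  let ?C = "?U * VY * ?V"
  have C: "deg_ge (Suc 0) ?C" by (simp add: deg_ge_1_iff)
  have VU: "?V * ?U = 1" and UV: "?U * ?V = 1"
    using ncs_exp_times_uminus[OF deg_ge_var] by auto
  have "ncs_exp ?C * ?U = ?U * ncs_exp VY"
  proof (rule ncs_eqI)
    fix w :: "letter list"
    have "?U * ncs_exp VY = tsum (\<lambda>n. qscale (1 / fact n) (?C ^ n * ?U))"
      unfolding conj_power[OF VU] by (simp add: ncs_exp_eq[of VY] tsum_mult_left deg_ge_fps_eval_term deg_ge_var)
    moreover have "ncs_exp ?C * ?U = tsum (\<lambda>n. qscale (1 / fact n) (?C ^ n * ?U))"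
    proof -
      have "tsum (\<lambda>n. qscale (1 / fact n) (?C ^ n)) * tsum (\<lambda>n. if n = 0 then ?U else 0)
         = tsum (\<lambda>n. \<Sum>k\<le>n. qscale (1 / fact (n - k)) (?C ^ (n - k)) * (if k = 0 then ?U else 0))"
        using C by (intro tsum_cauchy) (auto intro: deg_ge_fps_eval_term)
      moreover have "(\<Sum>k\<le>n. qscale (1 / fact (n - k)) (?C ^ (n - k)) * (if k = 0 then ?U else 0))
          = qscale (1 / fact n) (?C ^ n * ?U)" for n
        by (subst sum.remove[of _ 0]) (auto intro!: sum.neutral)
      ultimately show ?thesis by (simp add: ncs_exp_eq[of ?C] tsum_single)
    qed
    ultimately show "coef (ncs_exp ?C * ?U) w = coef (?U * ncs_exp VY) w" by simp
  qed
  then have "ncs_exp ?C = ncs_exp VX * ncs_exp VY * ncs_exp (- VX)"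
    by (metis UV mult.assoc mult.right_neutral)
  then have "substitute bch (- VX) bch = ?C"
    using ncs_log_ncs_exp[OF C] by (simp add: substitute_bch deg_ge_bch d ncs_exp_bch)
  also have "?C = tsum (\<lambda>k. qscale (1 / fact k) ((cmt (- VX) ^^ k) VY))"
    using conj_ncs_exp[OF d, of VY] by simp
  finally show ?thesis .
qed

lemma hausdorff_left_inverse: "substitute (- VX) bch bch = VY"
proof -
  have d: "deg_ge (Suc 0) (- VX)" by (simp add: deg_ge_1_iff)
  have "ncs_exp (- VX) * ncs_exp bch = ncs_exp VY"
    by (simp add: ncs_exp_bch ncs_exp_times_uminus deg_ge_var flip: mult.assoc)
  then show ?thesis by (simp add: substitute_bch deg_ge_bch d ncs_log_ncs_exp deg_ge_var)
qed

lemma hausdorff_right_inverse: "substitute bch (- VY) bch = VX"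
proof -
  have d: "deg_ge (Suc 0) (- VY)" by (simp add: deg_ge_1_iff)
  have "ncs_exp bch * ncs_exp (- VY) = ncs_exp VX"
    by (simp add: ncs_exp_bch ncs_exp_times_uminus deg_ge_var mult.assoc)
  then show ?thesis by (simp add: substitute_bch deg_ge_bch d ncs_log_ncs_exp deg_ge_var)
qed

lemma ncs_exp_zero [simp]: "ncs_exp 0 = 1"
proof -
  have "(\<lambda>n. qscale (1 / fact n) (0 ^ n)) = (\<lambda>n. if n = 0 then 1 else 0)"
    by (rule ext) (simp add: power_0_left)
  then show ?thesis by (simp only: ncs_exp_eq tsum_single)
qed

lemma hausdorff_zero: "substitute VX 0 bch = VX"
  using ncs_log_ncs_exp[OF deg_ge_var] by (simp add: substitute_bch deg_ge_var)

lemma hausdorff_uminus: "substitute VX (- VX) bch = 0" "substitute (- VX) VX bch = 0"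
proof -
  have d: "deg_ge (Suc 0) (- VX)" by (simp add: deg_ge_1_iff)
  show "substitute VX (- VX) bch = 0" "substitute (- VX) VX bch = 0"
    using d ncs_log_ncs_exp[of 0] by (simp_all add: substitute_bch deg_ge_var ncs_exp_times_uminus)
qed


subsection \<open>Truncation\<close>

definition trunc :: "nat \<Rightarrow> ncs \<Rightarrow> ncs" where
  "trunc c P = Series (nc_truncate c (coef P))"

definition homog_part :: "nat \<Rightarrow> ncs \<Rightarrow> ncs" where
  "homog_part n P = Series (\<lambda>w. if length w = n then coef P w else 0)"

lemma coef_trunc: "coef (trunc c P) w = (if length w \<le> c then coef P w else 0)"
  by (simp add: trunc_def nc_truncate_def)

lemma coef_homog_part: "coef (homog_part n P) w = (if length w = n then coef P w else 0)"
  by (simp add: homog_part_def)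

lemma deg_ge_trunc: "deg_ge n P \<Longrightarrow> deg_ge n (trunc c P)"
  by (simp add: deg_ge_def coef_trunc)

lemma deg_ge_trunc_diff: "deg_ge (Suc c) (P - trunc c P)"
  by (simp add: deg_ge_def coef_trunc)

lemma trunc_Suc: "trunc (Suc c) P = trunc c P + homog_part (Suc c) P"
  by (rule ncs_eqI) (simp add: coef_trunc coef_homog_part)

lemma homog_part_simps:
  "homog_part n 0 = 0" "homog_part n (P + Q) = homog_part n P + homog_part n Q" "homog_part n (qscale q P) = qscale q (homog_part n P)"
  by (auto intro!: ncs_eqI simp: coef_homog_part)


section \<open>Rational scalars\<close>

context cring
begin

definition int_elem :: "int \<Rightarrow> 'a" where
  "int_elem k = add_pow R k \<one>"

lemma int_elem_closed [simp]: "int_elem k \<in> carrier R"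
  by (simp add: int_elem_def)

lemma int_elem_0 [simp]: "int_elem 0 = \<zero>"
  by (simp add: int_elem_def add_pow_def int_pow_def2)

lemma int_elem_1 [simp]: "int_elem 1 = \<one>"
  using add.int_pow_1[of \<one>] by (simp add: int_elem_def)

lemma int_elem_add: "int_elem (k + l) = int_elem k \<oplus> int_elem l"
  by (simp add: int_elem_def add.int_pow_mult)

lemma int_elem_mult: "int_elem (k * l) = int_elem k \<otimes> int_elem l"
proof -
  have "int_elem (k * l) = add_pow R k (int_elem l)"
    by (simp add: int_elem_def add.int_pow_pow mult.commute)
  also have "\<dots> = add_pow R k (\<one> \<otimes> int_elem l)" by simp
  also have "\<dots> = int_elem k \<otimes> int_elem l"
    unfolding int_elem_def[of k] by (rule add_pow_ldistr_int[symmetric]) auto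
  finally show ?thesis .
qed

lemma int_elem_nat: "int_elem (int n) = add_pow R n \<one>"
  by (simp add: int_elem_def add_pow_def int_pow_int)

lemma Units_r_cancel:
  assumes "u \<in> Units R" "x \<in> carrier R" "y \<in> carrier R" "x \<otimes> u = y \<otimes> u"
  shows "x = y"
  using assms Units_l_cancel[of u x y] by (simp add: m_comm Units_closed)

lemma int_elem_dvd_unit:
  assumes "int_elem b \<in> Units R" "d dvd b"
  shows "int_elem d \<in> Units R"
proof -
  obtain e where "b = d * e" using assms(2) by (auto elim: dvdE)
  then show ?thesis
    using assms(1) unit_factor[of "int_elem d" "int_elem e"] by (simp add: int_elem_mult)
qed

lemma rat_to_ring_props:
  assumes "rat_defined_in R q"
  obtains n d where "d \<noteq> 0" "q = of_int n / of_int d" "int_elem d \<in> Units R"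
    "rat_to_ring R q \<in> carrier R" "rat_to_ring R q \<otimes> int_elem d = int_elem n"
proof -
  obtain n d where nd: "quotient_of q = (n, d)" by (cases "quotient_of q")
  have u: "int_elem d \<in> Units R"
    using assms nd by (simp add: rat_defined_in_def int_elem_def)
  have r: "rat_to_ring R q = int_elem n \<otimes> inv (int_elem d)"
    using nd by (simp add: rat_to_ring_def int_elem_def)
  have c: "rat_to_ring R q \<in> carrier R" using u unfolding r by simp
  have e: "rat_to_ring R q \<otimes> int_elem d = int_elem n"
    using u unfolding r by (simp add: m_assoc)
  show ?thesis
    using that[of d n] quotient_of_denom_pos[OF nd] quotient_of_div[OF nd] u c e by auto
qed

text \<open>
  The fraction \<open>n / d\<close> need not be in lowest terms: the reduced denominator divides \<open>d\<close>, and a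
  divisor of a unit is a unit.
\<close>

lemma rat_to_ring_eqI:
  assumes d: "d \<noteq> 0" and q: "q = of_int n / of_int d" and u: "int_elem d \<in> Units R"
    and x: "x \<in> carrier R" "x \<otimes> int_elem d = int_elem n"
  shows "rat_defined_in R q" "rat_to_ring R q = x"
proof -
  obtain m e where me: "quotient_of q = (m, e)" by (cases "quotient_of q")
  have e: "e > 0" "coprime m e" "q = of_int m / of_int e"
    using me quotient_of_denom_pos quotient_of_coprime quotient_of_div by blast+
  have "(of_int (n * e) :: rat) = of_int (m * d)"
    using d e q by (simp add: field_simps)
  then have ne: "n * e = m * d" by (simp only: of_int_eq_iff)
  then have "e dvd m * d" by (metis dvd_triv_right)
  then have "e dvd d" using e(2) by (simp add: coprime_commute coprime_dvd_mult_right_iff)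
  then have ue: "int_elem e \<in> Units R" using int_elem_dvd_unit u by blast
  then show def: "rat_defined_in R q"
    using me by (simp add: rat_defined_in_def int_elem_def)
  have r: "rat_to_ring R q = int_elem m \<otimes> inv (int_elem e)"
    using me by (simp add: rat_to_ring_def int_elem_def)
  have c: "rat_to_ring R q \<in> carrier R" using ue unfolding r by simp
  have re: "rat_to_ring R q \<otimes> int_elem e = int_elem m"
    using ue unfolding r by (simp add: m_assoc)
  have "rat_to_ring R q \<otimes> (int_elem e \<otimes> int_elem d) = int_elem m \<otimes> int_elem d"
    using c by (simp flip: re m_assoc)
  also have "\<dots> = int_elem n \<otimes> int_elem e"
    by (metis ne int_elem_mult)
  also have "\<dots> = x \<otimes> (int_elem e \<otimes> int_elem d)"
    using x(1) by (simp add: x(2)[symmetric] m_ac)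
  finally show "rat_to_ring R q = x"
    using c x(1) ue u Units_r_cancel Units_m_closed by blast
qed

lemma rat_to_ring_closed [simp]:
  assumes "rat_defined_in R q"
  shows "rat_to_ring R q \<in> carrier R"
  using assms by (rule rat_to_ring_props)

lemma rat_to_ring_add:
  assumes "rat_defined_in R p" "rat_defined_in R q"
  shows "rat_defined_in R (p + q)" "rat_to_ring R (p + q) = rat_to_ring R p \<oplus> rat_to_ring R q"
proof -
  obtain n d where p: "d \<noteq> 0" "p = of_int n / of_int d" "int_elem d \<in> Units R"
    "rat_to_ring R p \<in> carrier R" "rat_to_ring R p \<otimes> int_elem d = int_elem n"
    using rat_to_ring_props[OF assms(1)] .
  obtain m e where q: "e \<noteq> 0" "q = of_int m / of_int e" "int_elem e \<in> Units R"
    "rat_to_ring R q \<in> carrier R" "rat_to_ring R q \<otimes> int_elem e = int_elem m"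
    using rat_to_ring_props[OF assms(2)] .
  have "d * e \<noteq> 0" "p + q = of_int (n * e + m * d) / of_int (d * e)"
    "int_elem (d * e) \<in> Units R" "rat_to_ring R p \<oplus> rat_to_ring R q \<in> carrier R"
    using p q by (simp_all add: field_simps int_elem_mult)
  moreover have "(rat_to_ring R p \<oplus> rat_to_ring R q) \<otimes> int_elem (d * e) = int_elem (n * e + m * d)"
  proof -
    have "(rat_to_ring R p \<oplus> rat_to_ring R q) \<otimes> int_elem (d * e)
        = (rat_to_ring R p \<otimes> int_elem d) \<otimes> int_elem e
          \<oplus> (rat_to_ring R q \<otimes> int_elem e) \<otimes> int_elem d"
      unfolding l_distr[OF p(4) q(4) int_elem_closed] using p(4) q(4) by (simp add: int_elem_mult m_ac)
    then show ?thesis by (simp add: p(5) q(5) int_elem_add int_elem_mult)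
  qed
  ultimately show "rat_defined_in R (p + q)" 
    "rat_to_ring R (p + q) = rat_to_ring R p \<oplus> rat_to_ring R q"
    by (rule rat_to_ring_eqI)+
qed

lemma rat_to_ring_mult:
  assumes "rat_defined_in R p" "rat_defined_in R q"
  shows "rat_defined_in R (p * q)" "rat_to_ring R (p * q) = rat_to_ring R p \<otimes> rat_to_ring R q"
proof -
  obtain n d where p: "d \<noteq> 0" "p = of_int n / of_int d" "int_elem d \<in> Units R"
    "rat_to_ring R p \<in> carrier R" "rat_to_ring R p \<otimes> int_elem d = int_elem n"
    using rat_to_ring_props[OF assms(1)] .
  obtain m e where q: "e \<noteq> 0" "q = of_int m / of_int e" "int_elem e \<in> Units R"
    "rat_to_ring R q \<in> carrier R" "rat_to_ring R q \<otimes> int_elem e = int_elem m"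
    using rat_to_ring_props[OF assms(2)] .
  have "d * e \<noteq> 0" "p * q = of_int (n * m) / of_int (d * e)"
    "int_elem (d * e) \<in> Units R" "rat_to_ring R p \<otimes> rat_to_ring R q \<in> carrier R"
    using p q by (simp_all add: int_elem_mult)
  moreover have "(rat_to_ring R p \<otimes> rat_to_ring R q) \<otimes> int_elem (d * e) = int_elem (n * m)"
  proof -
    have "(rat_to_ring R p \<otimes> rat_to_ring R q) \<otimes> int_elem (d * e)
        = (rat_to_ring R p \<otimes> int_elem d) \<otimes> (rat_to_ring R q \<otimes> int_elem e)"
      using p(4) q(4) by (simp add: int_elem_mult m_ac)
    then show ?thesis by (simp add: p(5) q(5) int_elem_mult)
  qed
  ultimately show "rat_defined_in R (p * q)" 
    "rat_to_ring R (p * q) = rat_to_ring R p \<otimes> rat_to_ring R q"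
    by (rule rat_to_ring_eqI)+
qed

lemma rat_to_ring_int: "rat_defined_in R (of_int k)" "rat_to_ring R (of_int k) = int_elem k"
  using rat_to_ring_eqI[of 1 "of_int k" k "int_elem k"] by simp_all

lemma rat_to_ring_nat: "rat_defined_in R (of_nat k)" "rat_to_ring R (of_nat k) = int_elem (int k)"
  using rat_to_ring_int[of "int k"] by simp_all

lemma rat_defined_0 [simp]: "rat_defined_in R 0" and rat_defined_1 [simp]: "rat_defined_in R 1"
  and rat_to_ring_0 [simp]: "rat_to_ring R 0 = \<zero>" and rat_to_ring_1 [simp]: "rat_to_ring R 1 = \<one>"
  using rat_to_ring_int[of 0] rat_to_ring_int[of 1] by simp_all

lemma rat_defined_uminus: "rat_defined_in R q \<Longrightarrow> rat_defined_in R (- q)"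
  using rat_to_ring_mult(1)[of "-1" q] rat_to_ring_int(1)[of "-1"] by simp

lemma rat_to_ring_uminus:
  assumes "rat_defined_in R q"
  shows "rat_to_ring R (- q) = \<ominus> rat_to_ring R q"
proof -
  have "rat_to_ring R (- q) \<oplus> rat_to_ring R q = \<zero>"
    using rat_to_ring_add(2)[OF rat_defined_uminus[OF assms] assms] by simp
  then show ?thesis using assms rat_defined_uminus by (simp add: minus_equality)
qed

lemma rat_defined_diff: "rat_defined_in R p \<Longrightarrow> rat_defined_in R q \<Longrightarrow> rat_defined_in R (p - q)"
  using rat_to_ring_add(1)[of p "- q"] rat_defined_uminus by simp

lemma rat_defined_sum: "(\<And>i. i \<in> A \<Longrightarrow> rat_defined_in R (f i)) \<Longrightarrow> rat_defined_in R (sum f A)"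
  by (induction A rule: infinite_finite_induct) (auto intro: rat_to_ring_add)

lemma rat_defined_inverse:
  assumes "int_elem (int n) \<in> Units R" "k dvd n" "n \<noteq> 0"
  shows "rat_defined_in R (1 / of_nat k)"
proof -
  have u: "int_elem (int k) \<in> Units R"
    using int_elem_dvd_unit[OF assms(1), of "int k"] assms(2) by simp
  have "k \<noteq> 0" using assms by auto
  then show ?thesis
    using u by (intro rat_to_ring_eqI(1)[of "int k" _ 1 "inv (int_elem (int k))"]) auto
qed

end


section \<open>Nilpotent Lie algebras\<close>

lemma (in module) submodule_submodule_span:
  assumes "A \<subseteq> carrier M"
  shows "submodule (submodule_span R M A) R M" "A \<subseteq> submodule_span R M A"
proof -
  have z: "\<zero>\<^bsub>M\<^esub> \<in> N" if "submodule N R M" for N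
    using subgroup.one_closed[OF submodule.axioms(1)[OF that]] by simp
  have c: "carrier M \<in> {N. submodule N R M \<and> A \<subseteq> N}"
    using assms carrier_is_submodule by simp
  show "A \<subseteq> submodule_span R M A" unfolding submodule_span_def by auto
  show "submodule (submodule_span R M A) R M"
  proof (rule submoduleI)
    show "submodule_span R M A \<subseteq> carrier M"
      using c unfolding submodule_span_def by blast
    show "\<zero>\<^bsub>M\<^esub> \<in> submodule_span R M A"
      unfolding submodule_span_def using z by blast
  qed (auto simp: submodule_span_def dest: submoduleE)
qed

lemma submodule_span_least: "submodule N R M \<Longrightarrow> A \<subseteq> N \<Longrightarrow> submodule_span R M A \<subseteq> N"
  by (auto simp: submodule_span_def)

context lie_algebra
begin

abbreviation br where "br \<equiv> lbracket L"
abbreviation lc where "lc \<equiv> lower_central R L"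

definition rat_smult where "rat_smult q u = rat_to_ring R q \<odot>\<^bsub>L\<^esub> u"

lemmas lbracket_closed [simp]

lemma br_zero [simp]:
  assumes "x \<in> carrier L"
  shows "br \<zero>\<^bsub>L\<^esub> x = \<zero>\<^bsub>L\<^esub>" "br x \<zero>\<^bsub>L\<^esub> = \<zero>\<^bsub>L\<^esub>"
  using assms lbracket_smult_left[of \<zero> "\<zero>\<^bsub>L\<^esub>" x] lbracket_smult_right[of \<zero> x "\<zero>\<^bsub>L\<^esub>"]
  by simp_all

lemma br_minus_right: "x \<in> carrier L \<Longrightarrow> y \<in> carrier L \<Longrightarrow> br x (\<ominus>\<^bsub>L\<^esub> y) = \<ominus>\<^bsub>L\<^esub> br x y"
  using lbracket_add_right[of "\<ominus>\<^bsub>L\<^esub> y" y x] by (simp add: M.l_neg M.minus_equality)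

lemma br_swap:
  assumes "x \<in> carrier L" "y \<in> carrier L"
  shows "br x y = \<ominus>\<^bsub>L\<^esub> br y x"
proof -
  have "br x y \<oplus>\<^bsub>L\<^esub> br y x = br (x \<oplus>\<^bsub>L\<^esub> y) (x \<oplus>\<^bsub>L\<^esub> y)"
    using assms by (simp add: lbracket_add_left lbracket_add_right lbracket_self[of x] lbracket_self[of y] M.a_comm)
  also have "\<dots> = \<zero>\<^bsub>L\<^esub>" using assms by (simp add: lbracket_self)
  finally have "br x y \<oplus>\<^bsub>L\<^esub> br y x = \<zero>\<^bsub>L\<^esub>" .
  then show ?thesis using assms by (simp add: M.minus_equality)
qed

text \<open>
  The Jacobi identity, in the form that \<open>a \<mapsto> [a, u]\<close> is a right action.
\<close>

lemma br_br_right: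
  assumes "a \<in> carrier L" "u \<in> carrier L" "v \<in> carrier L"
  shows "br a (br u v) = br (br a u) v \<ominus>\<^bsub>L\<^esub> br (br a v) u"
proof -
  have 1: "br u (br v a) = br (br a v) u"
    using assms by (simp add: br_swap[of v a] br_swap[of u "br a v"] br_minus_right)
  have 2: "br v (br a u) = \<ominus>\<^bsub>L\<^esub> br (br a u) v"
    using assms by (simp add: br_swap[of v "br a u"])
  have "br a (br u v) \<oplus>\<^bsub>L\<^esub> br (br a v) u \<oplus>\<^bsub>L\<^esub> \<ominus>\<^bsub>L\<^esub> br (br a u) v = \<zero>\<^bsub>L\<^esub>"
    using jacobi[of a u v] assms by (simp only: 1 2)
  then have "br a (br u v) \<oplus>\<^bsub>L\<^esub> br (br a v) u = br (br a u) v"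
    using M.minus_equality[of "br a (br u v) \<oplus>\<^bsub>L\<^esub> br (br a v) u" "\<ominus>\<^bsub>L\<^esub> br (br a u) v"] assms
    by simp
  then show ?thesis
    using assms by (simp add: a_minus_def M.a_assoc M.r_neg flip: \<open>_ = br (br a u) v\<close>)
qed

lemma rat_smult_closed [simp]: "rat_defined_in R q \<Longrightarrow> u \<in> carrier L \<Longrightarrow> rat_smult q u \<in> carrier L"
  by (simp add: rat_smult_def)

lemma rat_smult_add_right:
  "rat_defined_in R q \<Longrightarrow> u \<in> carrier L \<Longrightarrow> v \<in> carrier L \<Longrightarrow> rat_smult q (u \<oplus>\<^bsub>L\<^esub> v) = rat_smult q u \<oplus>\<^bsub>L\<^esub> rat_smult q v"
  by (simp add: rat_smult_def smult_r_distr)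

lemma rat_smult_minus_right:
  "rat_defined_in R q \<Longrightarrow> u \<in> carrier L \<Longrightarrow> rat_smult q (\<ominus>\<^bsub>L\<^esub> u) = \<ominus>\<^bsub>L\<^esub> rat_smult q u"
  by (simp add: rat_smult_def smult_r_minus)

lemma rat_smult_add_left:
  "rat_defined_in R p \<Longrightarrow> rat_defined_in R q \<Longrightarrow> u \<in> carrier L \<Longrightarrow> rat_smult (p + q) u = rat_smult p u \<oplus>\<^bsub>L\<^esub> rat_smult q u"
  by (simp add: rat_smult_def rat_to_ring_add smult_l_distr)

lemma rat_smult_rat_smult:
  "rat_defined_in R p \<Longrightarrow> rat_defined_in R q \<Longrightarrow> u \<in> carrier L \<Longrightarrow> rat_smult p (rat_smult q u) = rat_smult (p * q) u"
  by (simp add: rat_smult_def rat_to_ring_mult smult_assoc1)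

lemma rat_smult_0 [simp]: "u \<in> carrier L \<Longrightarrow> rat_smult 0 u = \<zero>\<^bsub>L\<^esub>"
  and rat_smult_1 [simp]: "u \<in> carrier L \<Longrightarrow> rat_smult 1 u = u"
  and rat_smult_zero [simp]: "rat_defined_in R q \<Longrightarrow> rat_smult q \<zero>\<^bsub>L\<^esub> = \<zero>\<^bsub>L\<^esub>"
  by (simp_all add: rat_smult_def)

lemma br_rat_smult:
  assumes "rat_defined_in R q" "u \<in> carrier L" "v \<in> carrier L"
  shows "br (rat_smult q u) v = rat_smult q (br u v)" "br u (rat_smult q v) = rat_smult q (br u v)"
  using assms by (simp_all add: rat_smult_def lbracket_smult_left lbracket_smult_right)

text \<open>
  The \<open>i\<close>-th term here is the one usually written \<open>\<gamma>\<^sub>i\<^sub>+\<^sub>1\<close>, whence the shifts by one below.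
\<close>

lemma submodule_lc: "submodule (lc i) R L"
proof (induction i)
  case 0
  then show ?case using carrier_is_submodule by simp
next
  case (Suc i)
  have "{br x y |x y. x \<in> lc i \<and> y \<in> carrier L} \<subseteq> carrier L"
    using submoduleE(1)[OF Suc] by auto
  then show ?case by (simp add: submodule_submodule_span)
qed

lemma lc_carrier: "x \<in> lc i \<Longrightarrow> x \<in> carrier L"
  using submoduleE(1)[OF submodule_lc] by blast

lemma lc_closed:
  shows lc_zero: "\<zero>\<^bsub>L\<^esub> \<in> lc i"
    and lc_add: "x \<in> lc i \<Longrightarrow> y \<in> lc i \<Longrightarrow> x \<oplus>\<^bsub>L\<^esub> y \<in> lc i"
    and lc_minus: "x \<in> lc i \<Longrightarrow> \<ominus>\<^bsub>L\<^esub> x \<in> lc i"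
    and lc_smult: "r \<in> carrier R \<Longrightarrow> x \<in> lc i \<Longrightarrow> r \<odot>\<^bsub>L\<^esub> x \<in> lc i"
    and lc_rat_smult: "rat_defined_in R q \<Longrightarrow> x \<in> lc i \<Longrightarrow> rat_smult q x \<in> lc i"
  using submoduleE[OF submodule_lc[of i]]
    subgroup.one_closed[OF submodule.axioms(1)[OF submodule_lc[of i]]]
  by (simp_all add: rat_smult_def)

lemma lc_br: "x \<in> lc i \<Longrightarrow> y \<in> carrier L \<Longrightarrow> br x y \<in> lc (Suc i)"
proof -
  assume "x \<in> lc i" "y \<in> carrier L"
  moreover have "{br x y |x y. x \<in> lc i \<and> y \<in> carrier L} \<subseteq> lc (Suc i)"
    unfolding lower_central.simps
    by (rule submodule_submodule_span(2)) (auto dest: lc_carrier)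
  ultimately show ?thesis by blast
qed

lemma lc_Suc_subset: "lc (Suc i) \<subseteq> lc i"
proof (induction i)
  case 0
  then show ?case using lc_carrier[of _ "Suc 0"] lower_central.simps(1)[of R L] by blast
next
  case (Suc i)
  have "{br x y |x y. x \<in> lc (Suc i) \<and> y \<in> carrier L} \<subseteq> lc (Suc i)"
    using Suc lc_br[of _ i] by blast
  then show ?case
    unfolding lower_central.simps(2)[of R L "Suc i"] by (rule submodule_span_least[OF submodule_lc])
qed

lemma lc_mono: "i \<le> j \<Longrightarrow> x \<in> lc j \<Longrightarrow> x \<in> lc i"
  using lift_Suc_antimono_le[of lc] lc_Suc_subset by blast

text \<open>
  This is \<open>[\<gamma>\<^sub>i, \<gamma>\<^sub>j] \<subseteq> \<gamma>\<^sub>i\<^sub>+\<^sub>j\<close>: the Jacobi identity moves the last bracket of an element of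
  \<open>\<gamma>\<^sub>j\<close> to the other factor.
\<close>

lemma lc_br_lc: "x \<in> lc i \<Longrightarrow> y \<in> lc j \<Longrightarrow> br x y \<in> lc (Suc (i + j))"
proof (induction j arbitrary: i x y)
  case 0
  then show ?case using lc_br by simp
next
  case (Suc j)
  let ?N = "{y \<in> carrier L. br x y \<in> lc (Suc (i + Suc j))}"
  have x: "x \<in> carrier L" using Suc.prems lc_carrier by blast
  have "submodule ?N R L"
    by (rule submoduleI)
      (use x in \<open>auto simp: lbracket_add_right lbracket_smult_right br_minus_right
         intro: lc_closed simp del: lower_central.simps\<close>)
  moreover have "{br y z |y z. y \<in> lc j \<and> z \<in> carrier L} \<subseteq> ?N"
  proof clarify
    fix y z assume y: "y \<in> lc j" and z: "z \<in> carrier L"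
    then have yc: "y \<in> carrier L" using lc_carrier by blast
    have "br (br x y) z \<in> lc (Suc (i + Suc j))"
      using lc_br[OF Suc.IH[OF Suc.prems(1) y] z] by simp
    moreover have "br (br x z) y \<in> lc (Suc (i + Suc j))"
      using Suc.IH[OF lc_br[OF Suc.prems(1) z] y] by simp
    ultimately show "br y z \<in> carrier L \<and> br x (br y z) \<in> lc (Suc (i + Suc j))"
      using x yc z by (simp add: br_br_right a_minus_def lc_closed del: lower_central.simps)
  qed
  ultimately have "lc (Suc j) \<subseteq> ?N"
    by (simp only: lower_central.simps submodule_span_least)
  then show ?case using Suc.prems by blast
qed

end

locale nilpotent_lie_algebra = lie_algebra +
  fixes c :: nat
  assumes nilp: "lower_central R L c = {\<zero>\<^bsub>L\<^esub>}"
    and fact_unit: "add_pow R (fact c :: nat) \<one> \<in> Units R"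
begin

lemma lc_vanish: "c \<le> i \<Longrightarrow> x \<in> lc i \<Longrightarrow> x = \<zero>\<^bsub>L\<^esub>"
  using lc_mono[of c i x] nilp by auto

lemma rat_defined_dvd_fact: "k dvd fact c \<Longrightarrow> rat_defined_in R (1 / of_nat k)"
proof (rule rat_defined_inverse[of "fact c"])
  show "int_elem (int (fact c)) \<in> Units R"
    using fact_unit by (simp only: int_elem_nat)
qed auto

lemma rat_defined_inverse_fact: "k \<le> c \<Longrightarrow> rat_defined_in R (1 / fact k)"
  using rat_defined_dvd_fact[of "fact k"] by (simp add: fact_dvd)

lemma rat_defined_inverse_nat: "1 \<le> k \<Longrightarrow> k \<le> c \<Longrightarrow> rat_defined_in R (1 / of_nat k)"
  using rat_defined_dvd_fact[of k] by (simp add: dvd_fact)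

end


declare lower_central.simps(2) [simp del]

section \<open>Evaluating series in a nilpotent Lie algebra\<close>

context cring
begin

definition integral :: "ncs \<Rightarrow> bool" where
  "integral P \<longleftrightarrow> (\<forall>w. rat_defined_in R (coef P w))"

lemma integralD [simp]: "integral P \<Longrightarrow> rat_defined_in R (coef P w)"
  by (simp add: integral_def)

lemma integral_zero [simp]: "integral 0"
  and integral_one [simp]: "integral 1"
  and integral_var [simp]: "integral (var l)"
  and integral_add [simp]: "integral P \<Longrightarrow> integral Q \<Longrightarrow> integral (P + Q)"
  and integral_diff [simp]: "integral P \<Longrightarrow> integral Q \<Longrightarrow> integral (P - Q)"
  and integral_qscale [simp]: "rat_defined_in R q \<Longrightarrow> integral P \<Longrightarrow> integral (qscale q P)"
  and integral_lderiv [simp]: "integral P \<Longrightarrow> integral (lderiv l P)"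
  by (simp_all add: integral_def coef_one coef_var nc_var_def rat_to_ring_add rat_to_ring_mult
      rat_defined_diff)

lemma integral_times [simp]: "integral P \<Longrightarrow> integral Q \<Longrightarrow> integral (P * Q)"
  by (simp add: integral_def coef_times nc_mult_def rat_defined_sum rat_to_ring_mult)

lemma integral_power [simp]: "integral P \<Longrightarrow> integral (P ^ n)"
  by (induction n) auto

lemma integral_sum: "(\<And>i. i \<in> A \<Longrightarrow> integral (f i)) \<Longrightarrow> integral (sum f A)"
  by (induction A rule: infinite_finite_induct) auto

end

context lie_algebra
begin

text \<open>
  The free associative algebra over the rational numbers that make sense in \<open>R\<close> acts on \<open>L\<close> from
  the right, the letters by bracketing with \<open>x\<close> and \<open>y\<close>. Only words of length less than \<open>n\<close> are taken into account; for \<open>n = c\<close> these are all that act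
  non-trivially.
\<close>

primrec word_act :: "'g \<Rightarrow> 'g \<Rightarrow> nat \<Rightarrow> ncs \<Rightarrow> 'g \<Rightarrow> 'g" where
  "word_act x y 0 P a = \<zero>\<^bsub>L\<^esub>"
| "word_act x y (Suc n) P a = rat_smult (coef P []) a
     \<oplus>\<^bsub>L\<^esub> (word_act x y n (lderiv LetterX P) (br a x) \<oplus>\<^bsub>L\<^esub> word_act x y n (lderiv LetterY P) (br a y))"

definition lie_eval :: "'g \<Rightarrow> 'g \<Rightarrow> ncs \<Rightarrow> 'g \<Rightarrow> bool" where
  "lie_eval x y P u \<longleftrightarrow> lie_evaluates R L x y (coef P) u"

lemma lie_eval_var: "lie_eval x y VX x" "lie_eval x y VY y"
  by (simp_all add: lie_eval_def coef_var lie_evaluates.intros)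

lemma lie_eval_add:
  assumes "lie_eval x y P u" "lie_eval x y Q v"
  shows "lie_eval x y (P + Q) (u \<oplus>\<^bsub>L\<^esub> v)"
  using lie_evaluates.add[OF assms[unfolded lie_eval_def]] by (simp add: lie_eval_def plus_ncs_def)

lemma lie_eval_qscale:
  assumes "lie_eval x y P u" "rat_defined_in R q"
  shows "lie_eval x y (qscale q P) (rat_smult q u)"
  using lie_evaluates.scale[OF assms[unfolded lie_eval_def]] by (simp add: lie_eval_def qscale_def rat_smult_def)

lemma lie_eval_cmt:
  assumes "lie_eval x y P u" "lie_eval x y Q v"
  shows "lie_eval x y (cmt Q P) (br u v)"
  using lie_evaluates.commutator[OF assms[unfolded lie_eval_def]]
  by (simp add: lie_eval_def cmt_def minus_ncs_def coef_times)

text \<open>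
  The induction rule of the evaluation relation, with the operations on coefficient functions
  replaced by those of the ring of series.
\<close>

lemma lie_eval_induct [consumes 1, case_names X Y add qscale cmt]:
  assumes "lie_eval x y P u"
    and "A VX x" "A VY y"
    and "\<And>P u Q v. lie_eval x y P u \<Longrightarrow> A P u \<Longrightarrow> lie_eval x y Q v \<Longrightarrow> A Q v \<Longrightarrow> A (P + Q) (u \<oplus>\<^bsub>L\<^esub> v)"
    and "\<And>P u q. lie_eval x y P u \<Longrightarrow> A P u \<Longrightarrow> rat_defined_in R q \<Longrightarrow> A (qscale q P) (rat_smult q u)"
    and "\<And>P u Q v. lie_eval x y P u \<Longrightarrow> A P u \<Longrightarrow> lie_eval x y Q v \<Longrightarrow> A Q v \<Longrightarrow> A (cmt Q P) (br u v)"
  shows "A P u"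
proof -
  have "A (Series f) u" if "lie_evaluates R L x y f u" for f u
    using that
  proof (induction rule: lie_evaluates.induct)
    case var_X
    then show ?case using assms(2) by (simp add: var_def)
  next
    case var_Y
    then show ?case using assms(3) by (simp add: var_def)
  next
    case (add P u Q v)
    then show ?case using assms(4)[unfolded lie_eval_def, of "Series P" u "Series Q" v] by (simp add: plus_ncs_def)
  next
    case (scale P u q)
    then show ?case using assms(5)[unfolded lie_eval_def, of "Series P" u q] by (simp add: qscale_def rat_smult_def)
  next
    case (commutator P u Q v)
    then show ?case using assms(6)[unfolded lie_eval_def, of "Series P" u "Series Q" v]
      by (simp add: cmt_def minus_ncs_def coef_times)
  qed
  from this[OF assms(1)[unfolded lie_eval_def]] show ?thesis by (simp add: coef_inverse)
qed

lemma rat_smult_minus_one: "u \<in> carrier L \<Longrightarrow> rat_smult (- 1) u = \<ominus>\<^bsub>L\<^esub> u"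
  by (simp add: rat_smult_def rat_to_ring_uminus smult_l_minus)

text \<open>
  The evaluation of homogeneous Lie polynomials by homogeneous expressions. The index \<open>n\<close> stands
  for degree \<open>n + 1\<close>, so that the values lie in the \<open>n\<close>-th term of \<open>lower_central\<close>. Zero is
  admitted in every degree because each component of a series needs a value.
\<close>

inductive homog_eval :: "'g \<Rightarrow> 'g \<Rightarrow> nat \<Rightarrow> ncs \<Rightarrow> 'g \<Rightarrow> bool" for x y where
  homog_eval_X: "homog_eval x y 0 VX x"
| homog_eval_Y: "homog_eval x y 0 VY y"
| homog_eval_zero: "homog_eval x y n 0 \<zero>\<^bsub>L\<^esub>"
| homog_eval_add: "homog_eval x y n P u \<Longrightarrow> homog_eval x y n Q v \<Longrightarrow> homog_eval x y n (P + Q) (u \<oplus>\<^bsub>L\<^esub> v)"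
| homog_eval_qscale: "homog_eval x y n P u \<Longrightarrow> rat_defined_in R q \<Longrightarrow> homog_eval x y n (qscale q P) (rat_smult q u)"
| homog_eval_cmt: "homog_eval x y i P u \<Longrightarrow> homog_eval x y j Q v \<Longrightarrow> homog_eval x y (Suc (i + j)) (cmt Q P) (br u v)"

text \<open>
  Sums of homogeneous evaluations. Every evaluation is of this kind, because expressions can be
  expanded by bilinearity of the bracket.
\<close>

inductive decomp :: "'g \<Rightarrow> 'g \<Rightarrow> ncs \<Rightarrow> 'g \<Rightarrow> bool" for x y where
  decomp_zero: "decomp x y 0 \<zero>\<^bsub>L\<^esub>"
| decomp_add_homog_eval: "homog_eval x y n P u \<Longrightarrow> decomp x y Q v \<Longrightarrow> decomp x y (P + Q) (u \<oplus>\<^bsub>L\<^esub> v)"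

lemma homog_eval_homogeneous: "homog_eval x y n P u \<Longrightarrow> length w \<noteq> Suc n \<Longrightarrow> coef P w = 0"
proof (induction arbitrary: w rule: homog_eval.induct)
  case (homog_eval_cmt i P u j Q v)
  have "nc_mult (coef P) (coef Q) w = 0"
    unfolding nc_mult_def
  proof (rule sum.neutral, rule ballI)
    fix k assume "k \<in> {..length w}"
    then have "length (take k w) \<noteq> Suc i \<or> length (drop k w) \<noteq> Suc j"
      using homog_eval_cmt.prems by auto
    then show "coef P (take k w) * coef Q (drop k w) = 0"
      using homog_eval_cmt.IH by auto
  qed
  moreover have "nc_mult (coef Q) (coef P) w = 0"
    unfolding nc_mult_def
  proof (rule sum.neutral, rule ballI)
    fix k assume "k \<in> {..length w}"
    then have "length (take k w) \<noteq> Suc j \<or> length (drop k w) \<noteq> Suc i"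
      using homog_eval_cmt.prems by auto
    then show "coef Q (take k w) * coef P (drop k w) = 0"
      using homog_eval_cmt.IH by auto
  qed
  ultimately show ?case by (simp add: cmt_def coef_times)
qed (auto simp: coef_var nc_var_def)

lemma homog_part_homog_eval: "homog_eval x y n P u \<Longrightarrow> homog_part k P = (if k = Suc n then P else 0)"
  using homog_eval_homogeneous by (auto intro!: ncs_eqI simp: coef_homog_part)

context
  fixes x y
  assumes x: "x \<in> carrier L" and y: "y \<in> carrier L"
begin

lemma lie_eval_closed: "lie_eval x y P u \<Longrightarrow> u \<in> carrier L"
  by (induction rule: lie_eval_induct) (use x y in auto)

lemma lie_eval_integral: "lie_eval x y P u \<Longrightarrow> integral P"
  by (induction rule: lie_eval_induct) (auto simp: cmt_def)

lemma lie_eval_Nil: "lie_eval x y P u \<Longrightarrow> coef P [] = 0"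
  by (induction rule: lie_eval_induct) (auto simp: cmt_def)

lemma lie_eval_zero: "lie_eval x y 0 \<zero>\<^bsub>L\<^esub>"
  using lie_eval_qscale[OF lie_eval_var(1)[of x y], of 0] x by simp

lemma lie_eval_uminus:
  assumes "lie_eval x y P u"
  shows "lie_eval x y (- P) (\<ominus>\<^bsub>L\<^esub> u)"
  using lie_eval_qscale[OF assms, of "- 1"] lie_eval_closed[OF assms] by (simp add: rat_smult_minus_one rat_defined_uminus)

lemma homog_eval_lie_eval: "homog_eval x y n P u \<Longrightarrow> lie_eval x y P u"
  by (induction rule: homog_eval.induct) (auto intro: lie_eval_zero lie_eval_var lie_eval_add lie_eval_qscale lie_eval_cmt)

lemma homog_eval_lc: "homog_eval x y n P u \<Longrightarrow> u \<in> lc n"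
  by (induction rule: homog_eval.induct) (use x y in \<open>auto intro: lc_closed lc_br_lc\<close>)

lemma homog_eval_closed: "homog_eval x y n P u \<Longrightarrow> u \<in> carrier L"
  using homog_eval_lc lc_carrier by blast

lemma decomp_closed: "decomp x y P u \<Longrightarrow> u \<in> carrier L"
  by (induction rule: decomp.induct) (auto intro: homog_eval_closed)

lemma decomp_add: "decomp x y P u \<Longrightarrow> decomp x y Q v \<Longrightarrow> decomp x y (P + Q) (u \<oplus>\<^bsub>L\<^esub> v)"
proof (induction rule: decomp.induct)
  case (decomp_add_homog_eval n P u Q' v')
  then show ?case
    using decomp.decomp_add_homog_eval[OF decomp_add_homog_eval(1), of "Q' + Q" "v' \<oplus>\<^bsub>L\<^esub> v"] homog_eval_closed decomp_closed
    by (simp add: M.a_assoc add.assoc)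
qed (use decomp_closed in auto)

lemma decomp_qscale: "decomp x y P u \<Longrightarrow> rat_defined_in R q \<Longrightarrow> decomp x y (qscale q P) (rat_smult q u)"
proof (induction rule: decomp.induct)
  case (decomp_add_homog_eval n P u Q v)
  then show ?case
    using decomp.decomp_add_homog_eval[OF homog_eval_qscale[OF decomp_add_homog_eval(1), of q]] homog_eval_closed decomp_closed
    by (simp add: qscale.scale_right_distrib rat_smult_add_right)
qed (auto intro: decomp_zero)

lemma cmt_add: "cmt Q (P + P') = cmt Q P + cmt Q P'" "cmt (Q + Q') P = cmt Q P + cmt Q' P"
  by (simp_all add: cmt_def algebra_simps)

lemma decomp_cmt: "decomp x y P u \<Longrightarrow> decomp x y Q v \<Longrightarrow> decomp x y (cmt Q P) (br u v)"
proof (induction rule: decomp.induct)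
  case decomp_zero
  then show ?case using decomp_closed decomp.decomp_zero by (simp add: cmt_def)
next
  case (decomp_add_homog_eval n P u P' u')
  \<comment> \<open>Expand the second argument for a homogeneous first one.\<close>
  have "decomp x y (cmt Q P) (br u v)"
    using decomp_add_homog_eval.prems
  proof (induction rule: decomp.induct)
    case decomp_zero
    then show ?case using decomp_add_homog_eval(1) homog_eval_closed decomp.decomp_zero by (simp add: cmt_def)
  next
    case (decomp_add_homog_eval m Q v Q' v')
    then show ?case
      using decomp.decomp_add_homog_eval[OF homog_eval_cmt[OF \<open>homog_eval x y n P u\<close> decomp_add_homog_eval(1)]]
        homog_eval_closed decomp_closed \<open>homog_eval x y n P u\<close>
      by (simp add: cmt_add lbracket_add_right)
  qed
  then show ?case
    using decomp_add[OF _ decomp_add_homog_eval.IH[OF decomp_add_homog_eval.prems]] decomp_add_homog_eval.hyps decomp_add_homog_eval.prems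
      homog_eval_closed decomp_closed
    by (simp add: cmt_add lbracket_add_left)
qed

lemma lie_eval_decomp: "lie_eval x y P u \<Longrightarrow> decomp x y P u"
proof (induction rule: lie_eval_induct)
  case X
  then show ?case using decomp_add_homog_eval[OF homog_eval_X decomp_zero, of x y] x by simp
next
  case Y
  then show ?case using decomp_add_homog_eval[OF homog_eval_Y decomp_zero, of x y] y by simp
qed (auto intro: decomp_add decomp_qscale decomp_cmt)

end

primrec partial_sum :: "(nat \<Rightarrow> 'g) \<Rightarrow> nat \<Rightarrow> 'g" where
  "partial_sum U 0 = \<zero>\<^bsub>L\<^esub>"
| "partial_sum U (Suc n) = partial_sum U n \<oplus>\<^bsub>L\<^esub> U n"

lemma partial_sum_closed: "(\<And>n. U n \<in> carrier L) \<Longrightarrow> partial_sum U m \<in> carrier L"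
  by (induction m) auto

lemma partial_sum_cong: "(\<And>n. n < m \<Longrightarrow> U n = V n) \<Longrightarrow> partial_sum U m = partial_sum V m"
  by (induction m) auto

text \<open>
  Adding a homogeneous term changes one component; it changes the partial sum if its degree is
  within the range.
\<close>

lemma partial_sum_update:
  assumes "\<And>n. U n \<in> carrier L" "u \<in> carrier L"
  shows "partial_sum (U(n := u \<oplus>\<^bsub>L\<^esub> U n)) m = (if n < m then u \<oplus>\<^bsub>L\<^esub> partial_sum U m else partial_sum U m)"
proof (induction m)
  case (Suc m)
  then show ?case using assms partial_sum_closed[of U m]
    by (cases m n rule: linorder_cases) (auto simp: M.a_ac)
qed simp

end

context nilpotent_lie_algebra
begin

context
  fixes x y
  assumes x: "x \<in> carrier L" and y: "y \<in> carrier L"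
begin

lemma word_act_lc: "integral P \<Longrightarrow> a \<in> lc m \<Longrightarrow> word_act x y n P a \<in> lc m"
proof (induction n arbitrary: P a)
  case (Suc n)
  have "br a x \<in> lc m" "br a y \<in> lc m"
    using lc_br[OF Suc.prems(2)] x y lc_mono[of m "Suc m"] by auto
  then show ?case using Suc by (auto intro!: lc_closed)
qed (simp add: lc_closed)

lemma word_act_closed [simp]: "integral P \<Longrightarrow> a \<in> carrier L \<Longrightarrow> word_act x y n P a \<in> carrier L"
  using word_act_lc[of P a 0] by simp

lemma word_act_cong_words:
  "(\<And>w. length w < n \<Longrightarrow> coef P w = coef Q w) \<Longrightarrow> word_act x y n P a = word_act x y n Q a"
proof (induction n arbitrary: P Q a)
  case (Suc n)
  have "word_act x y n (lderiv l P) b = word_act x y n (lderiv l Q) b" for l b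
    by (rule Suc.IH) (simp add: Suc.prems)
  then show ?case using Suc.prems by simp
qed simp

lemma word_act_zero_left [simp]: "a \<in> carrier L \<Longrightarrow> word_act x y n 0 a = \<zero>\<^bsub>L\<^esub>"
  by (induction n arbitrary: a) (use x y in auto)

lemma word_act_add_right:
  "integral P \<Longrightarrow> a \<in> carrier L \<Longrightarrow> b \<in> carrier L \<Longrightarrow>
    word_act x y n P (a \<oplus>\<^bsub>L\<^esub> b) = word_act x y n P a \<oplus>\<^bsub>L\<^esub> word_act x y n P b"
  by (induction n arbitrary: P a b) (use x y in \<open>auto simp: rat_smult_add_right lbracket_add_left M.a_ac\<close>)

lemma word_act_rat_smult_right:
  "integral P \<Longrightarrow> a \<in> carrier L \<Longrightarrow> rat_defined_in R q \<Longrightarrow>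
    word_act x y n P (rat_smult q a) = rat_smult q (word_act x y n P a)"
  by (induction n arbitrary: P a)
    (use x y in \<open>auto simp: rat_smult_add_right rat_smult_rat_smult br_rat_smult mult.commute\<close>)

lemma word_act_add_left:
  "integral P \<Longrightarrow> integral Q \<Longrightarrow> a \<in> carrier L \<Longrightarrow>
    word_act x y n (P + Q) a = word_act x y n P a \<oplus>\<^bsub>L\<^esub> word_act x y n Q a"
  by (induction n arbitrary: P Q a) (use x y in \<open>auto simp: rat_smult_add_left M.a_ac\<close>)

lemma word_act_qscale:
  "integral P \<Longrightarrow> a \<in> carrier L \<Longrightarrow> rat_defined_in R q \<Longrightarrow>
    word_act x y n (qscale q P) a = rat_smult q (word_act x y n P a)"
  by (induction n arbitrary: P a) (use x y in \<open>auto simp: rat_smult_add_right rat_smult_rat_smult\<close>)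

text \<open>
  An element of \<open>\<gamma>\<^sub>m\<^sub>+\<^sub>1\<close> is annihilated by all words of length at least \<open>c - m\<close>.
\<close>

lemma word_act_stable:
  "integral P \<Longrightarrow> a \<in> lc m \<Longrightarrow> c \<le> m + n \<Longrightarrow> word_act x y (Suc n) P a = word_act x y n P a"
proof (induction n arbitrary: P a m)
  case 0
  then have "a = \<zero>\<^bsub>L\<^esub>" using lc_vanish by simp
  then show ?case using 0 x y by simp
next
  case (Suc n)
  have "word_act x y (Suc n) (lderiv l P) (br a b) = word_act x y n (lderiv l P) (br a b)"
    if "b \<in> carrier L" for l b
    using Suc.IH[OF _ lc_br[OF Suc.prems(2) that]] Suc.prems by (simp del: word_act.simps)
  then show ?case using x y by (simp only: word_act.simps(2)[of x y "Suc n"] word_act.simps(2)[of x y n P])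
qed

lemma word_act_one: "a \<in> lc m \<Longrightarrow> c \<le> m + n \<Longrightarrow> word_act x y n 1 a = a"
  using lc_vanish[of m a] lc_carrier[of a m] x y by (cases n) auto

text \<open>
  The action is multiplicative: the product rule for left derivatives reproduces the recursion, and
  the bound \<open>n\<close> may be kept for the second factor because the first one moves \<open>a\<close> down the lower
  central series.
\<close>

lemma word_act_times:
  "integral P \<Longrightarrow> integral Q \<Longrightarrow> a \<in> lc m \<Longrightarrow> c \<le> m + n \<Longrightarrow>
    word_act x y n (P * Q) a = word_act x y n Q (word_act x y n P a)"
proof (induction n arbitrary: P Q a m)
  case (Suc n)
  have a: "a \<in> carrier L" using Suc.prems lc_carrier by blast
  have ax: "br a x \<in> lc (Suc m)" "br a y \<in> lc (Suc m)"
    using lc_br Suc.prems x y by auto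
  have c: "c \<le> Suc m + n" using Suc.prems by simp
  define p where "p = coef P []"
  have p: "rat_defined_in R p" using Suc.prems by (simp add: p_def)
  define f where "f = (\<lambda>l. if l = LetterX then br a x else br a y)"
  have f: "f l \<in> lc (Suc m)" for l using ax by (simp add: f_def)
  have fc: "f l \<in> carrier L" for l using f lc_carrier by blast
  define b where "b = (\<lambda>l. word_act x y n (lderiv l P) (f l))"
  have b: "b l \<in> lc (Suc m)" for l unfolding b_def using f Suc.prems by (intro word_act_lc) auto
  have bc: "b l \<in> carrier L" for l using b lc_carrier by blast
  have s: "word_act x y n (lderiv l (P * Q)) (f l)
      = word_act x y n Q (b l) \<oplus>\<^bsub>L\<^esub> rat_smult p (word_act x y n (lderiv l Q) (f l))" for l
    using Suc.IH[OF _ _ f c, of "lderiv l P" Q] Suc.prems fc p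
    by (simp add: word_act_add_left word_act_qscale b_def flip: p_def)
  have st: "word_act x y (Suc n) Q (b l) = word_act x y n Q (b l)" for l
    using word_act_stable[OF _ b c] Suc.prems by blast
  have "word_act x y (Suc n) Q (word_act x y (Suc n) P a)
      = word_act x y (Suc n) Q (rat_smult p a \<oplus>\<^bsub>L\<^esub> (b LetterX \<oplus>\<^bsub>L\<^esub> b LetterY))"
    by (simp add: b_def f_def p_def)
  also have "\<dots> = rat_smult p (word_act x y (Suc n) Q a) \<oplus>\<^bsub>L\<^esub>
      (word_act x y n Q (b LetterX) \<oplus>\<^bsub>L\<^esub> word_act x y n Q (b LetterY))"
    using Suc.prems a p bc
    by (simp only: word_act_add_right word_act_rat_smult_right rat_smult_closed M.a_closed st)
  also have "\<dots> = rat_smult p (rat_smult (coef Q []) a \<oplus>\<^bsub>L\<^esub>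
        (word_act x y n (lderiv LetterX Q) (f LetterX) \<oplus>\<^bsub>L\<^esub> word_act x y n (lderiv LetterY Q) (f LetterY)))
      \<oplus>\<^bsub>L\<^esub> (word_act x y n Q (b LetterX) \<oplus>\<^bsub>L\<^esub> word_act x y n Q (b LetterY))"
    by (simp add: f_def)
  also have "\<dots> = rat_smult (coef (P * Q) []) a \<oplus>\<^bsub>L\<^esub>
      (word_act x y n (lderiv LetterX (P * Q)) (f LetterX) \<oplus>\<^bsub>L\<^esub> word_act x y n (lderiv LetterY (P * Q)) (f LetterY))"
    unfolding s using Suc.prems a p bc fc
    by (simp add: rat_smult_add_right rat_smult_rat_smult rat_to_ring_mult M.a_ac p_def[symmetric])
  also have "\<dots> = word_act x y (Suc n) (P * Q) a"
    by (simp add: f_def)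
  finally show ?case by simp
qed (use lc_carrier in auto)

lemma word_act_times': "integral P \<Longrightarrow> integral Q \<Longrightarrow> a \<in> carrier L \<Longrightarrow>
    word_act x y c (P * Q) a = word_act x y c Q (word_act x y c P a)"
  using word_act_times[of P Q a 0 c] by simp

lemma word_act_one': "a \<in> carrier L \<Longrightarrow> word_act x y c 1 a = a"
  using word_act_one[of a 0 c] by simp

lemma word_act_var:
  assumes a: "a \<in> carrier L"
  shows "word_act x y c VX a = br a x" "word_act x y c VY a = br a y"
proof -
  have "word_act x y c VX a = br a x \<and> word_act x y c VY a = br a y"
  proof (cases c)
    case 0
    then have "a = \<zero>\<^bsub>L\<^esub>" using lc_vanish[of 0 a] a by simp
    then show ?thesis using 0 x y by simp
  next
    case (Suc n)
    have "word_act x y n 1 (br a b) = br a b" if "b \<in> carrier L" for b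
      using word_act_one[OF lc_br[of a 0 b], of n] a that Suc by simp
    then show ?thesis using Suc a x y by (simp add: lderiv_var)
  qed
  then show "word_act x y c VX a = br a x" "word_act x y c VY a = br a y" by auto
qed

lemma word_act_diff:
  assumes "integral P" "integral Q" "a \<in> carrier L"
  shows "word_act x y n (P - Q) a = word_act x y n P a \<ominus>\<^bsub>L\<^esub> word_act x y n Q a"
proof -
  have "P - Q = P + qscale (- 1) Q" by simp
  then show ?thesis
    using assms word_act_add_left[of P "qscale (- 1) Q" a n] 
    by (simp only: integral_qscale rat_defined_uminus rat_defined_1 word_act_qscale)
       (simp add: rat_smult_minus_one a_minus_def)
qed

text \<open>
  If a Lie polynomial has the value \<open>u\<close>, then as an associative polynomial it acts by the right
  adjoint action of \<open>u\<close>. For a commutator this is the Jacobi identity.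
\<close>

lemma word_act_lie_eval: "lie_eval x y P u \<Longrightarrow> a \<in> carrier L \<Longrightarrow> word_act x y c P a = br a u"
proof (induction arbitrary: a rule: lie_eval_induct)
  case (add P u Q v)
  then show ?case
    using lie_eval_integral[OF x y] lie_eval_closed[OF x y] by (simp add: word_act_add_left lbracket_add_right)
next
  case (qscale P u q)
  then show ?case
    using lie_eval_integral[OF x y] lie_eval_closed[OF x y] by (simp add: word_act_qscale br_rat_smult)
next
  case (cmt P u Q v)
  have "integral P" "integral Q" "u \<in> carrier L" "v \<in> carrier L"
    using cmt lie_eval_integral[OF x y] lie_eval_closed[OF x y] by blast+
  then show ?case using cmt.IH cmt.prems
    by (simp add: cmt_def word_act_diff word_act_times' br_br_right)
qed (auto simp: word_act_var)

text \<open>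
  Dynkin's map: a word \<open>w\<^sub>1 w\<^sub>2 .. w\<^sub>k\<close> goes to the left-normed bracket \<open>[..[w\<^sub>1, w\<^sub>2], .., w\<^sub>k]\<close> of the
  elements \<open>x\<close>, \<open>y\<close> that its letters stand for.
\<close>

definition dynkin :: "ncs \<Rightarrow> 'c" where
  "dynkin P = word_act x y c (lderiv LetterX P) x \<oplus>\<^bsub>L\<^esub> word_act x y c (lderiv LetterY P) y"

lemma dynkin_add: "integral P \<Longrightarrow> integral Q \<Longrightarrow> dynkin (P + Q) = dynkin P \<oplus>\<^bsub>L\<^esub> dynkin Q"
  using x y by (simp add: dynkin_def word_act_add_left M.a_ac)

lemma dynkin_qscale: "integral P \<Longrightarrow> rat_defined_in R q \<Longrightarrow> dynkin (qscale q P) = rat_smult q (dynkin P)"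
  using x y by (simp add: dynkin_def word_act_qscale rat_smult_add_right)

lemma dynkin_closed: "integral P \<Longrightarrow> dynkin P \<in> carrier L"
  using x y by (simp add: dynkin_def)

lemma dynkin_diff: 
  assumes "integral P" "integral Q"
  shows "dynkin (P - Q) = dynkin P \<ominus>\<^bsub>L\<^esub> dynkin Q"
proof -
  have "P - Q = P + qscale (- 1) Q" by simp
  then show ?thesis
    using assms dynkin_add[of P "qscale (- 1) Q"] dynkin_closed
    by (simp only: integral_qscale rat_defined_uminus rat_defined_1 dynkin_qscale)
       (simp add: rat_smult_minus_one a_minus_def)
qed

lemma dynkin_times:
  assumes "integral P" "integral Q" "coef P [] = 0"
  shows "dynkin (P * Q) = word_act x y c Q (dynkin P)"
  using assms x y by (simp add: dynkin_def word_act_times' word_act_add_right)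

text \<open>
  The Dynkin-Specht-Wever argument. A product goes to the image of its first factor, acted on by
  the second. So if \<open>P\<close> and \<open>Q\<close> have degrees \<open>i\<close> and \<open>j\<close> and values \<open>u\<close> and \<open>v\<close>, then the commutator
  goes to \<open>[i u, v] - [j v, u] = (i + j) [u, v]\<close>.
\<close>

lemma dynkin_homog_eval: "homog_eval x y n P u \<Longrightarrow> dynkin P = rat_smult (of_nat (Suc n)) u"
proof (induction rule: homog_eval.induct)
  case (homog_eval_add n P u Q v)
  then have "integral P" "integral Q" "u \<in> carrier L" "v \<in> carrier L"
    using homog_eval_lie_eval[OF x y] lie_eval_integral[OF x y] homog_eval_closed[OF x y] by blast+
  then show ?case
    using homog_eval_add.IH by (simp add: dynkin_add rat_smult_add_right rat_to_ring_nat del: of_nat_Suc)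
next
  case (homog_eval_qscale n P u q)
  then have "integral P" "u \<in> carrier L"
    using homog_eval_lie_eval[OF x y] lie_eval_integral[OF x y] homog_eval_closed[OF x y] by blast+
  then show ?case
    using homog_eval_qscale by (simp add: dynkin_qscale rat_smult_rat_smult rat_to_ring_nat mult.commute del: of_nat_Suc)
next
  case (homog_eval_cmt i P u j Q v)
  have lie_eval: "lie_eval x y P u" "lie_eval x y Q v" using homog_eval_cmt homog_eval_lie_eval[OF x y] by auto
  have int: "integral P" "integral Q" using lie_eval lie_eval_integral[OF x y] by auto
  have uv: "u \<in> carrier L" "v \<in> carrier L" using lie_eval lie_eval_closed[OF x y] by auto
  have z: "coef P [] = 0" "coef Q [] = 0" using lie_eval lie_eval_Nil[OF x y] by auto
  have g: "rat_defined_in R (of_nat k)" for k by (simp add: rat_to_ring_nat)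
  have "dynkin (cmt Q P) = word_act x y c Q (dynkin P) \<ominus>\<^bsub>L\<^esub> word_act x y c P (dynkin Q)"
    using int z by (simp add: cmt_def dynkin_diff dynkin_times)
  also have "\<dots> = rat_smult (of_nat (Suc i)) (br u v) \<ominus>\<^bsub>L\<^esub> rat_smult (of_nat (Suc j)) (br v u)"
    using int uv g lie_eval by (simp add: homog_eval_cmt.IH word_act_rat_smult_right word_act_lie_eval del: of_nat_Suc)
  also have "\<dots> = rat_smult (of_nat (Suc i)) (br u v) \<oplus>\<^bsub>L\<^esub> rat_smult (of_nat (Suc j)) (br u v)"
    using uv g by (subst br_swap[of v u]) (simp_all add: rat_smult_minus_right a_minus_def del: of_nat_Suc)
  also have "\<dots> = rat_smult (of_nat (Suc i) + of_nat (Suc j)) (br u v)"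
    using uv g by (intro rat_smult_add_left[symmetric] g lbracket_closed)
  also have "of_nat (Suc i) + of_nat (Suc j) = (of_nat (Suc (Suc (i + j))) :: rat)"
    by simp
  finally show ?case .
qed (use x y word_act_one' in \<open>simp_all add: dynkin_def lderiv_var rat_to_ring_nat del: of_nat_Suc\<close>, simp_all)

lemma lie_eval_components:
  assumes "lie_eval x y P u"
  obtains U where "\<And>n. homog_eval x y n (homog_part (Suc n) P) (U n)" "u = partial_sum U c"
proof -
  have "decomp x y P u" using lie_eval_decomp[OF x y assms] .
  then have "\<exists>U. (\<forall>n. homog_eval x y n (homog_part (Suc n) P) (U n)) \<and> u = partial_sum U c"
  proof (induction rule: decomp.induct)
    case decomp_zero
    have "partial_sum (\<lambda>_. \<zero>\<^bsub>L\<^esub>) m = \<zero>\<^bsub>L\<^esub>" for m by (induction m) auto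
    then show ?case by (intro exI[of _ "\<lambda>_. \<zero>\<^bsub>L\<^esub>"]) (auto simp: homog_part_simps intro: homog_eval_zero)
  next
    case (decomp_add_homog_eval n P u Q v)
    then obtain U where U: "\<And>n. homog_eval x y n (homog_part (Suc n) Q) (U n)" "v = partial_sum U c" by blast
    have Uc: "U n \<in> carrier L" for n using U homog_eval_closed[OF x y] by blast
    have u: "u \<in> carrier L" using decomp_add_homog_eval homog_eval_closed[OF x y] by blast
    have "homog_eval x y m (homog_part (Suc m) (P + Q)) ((U(n := u \<oplus>\<^bsub>L\<^esub> U n)) m)" for m
      using homog_eval_add[OF decomp_add_homog_eval(1) U(1)[of n]] U(1)[of m]
      by (simp add: homog_part_simps homog_part_homog_eval[OF decomp_add_homog_eval(1)])
    moreover have "u \<oplus>\<^bsub>L\<^esub> v = partial_sum (U(n := u \<oplus>\<^bsub>L\<^esub> U n)) c"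
    proof (cases "n < c")
      case False
      then have "u = \<zero>\<^bsub>L\<^esub>" using lc_vanish[OF _ homog_eval_lc[OF x y decomp_add_homog_eval(1)]] by simp
      then show ?thesis using Uc u False partial_sum_closed[of U c] by (simp add: partial_sum_update U(2))
    qed (use Uc u in \<open>simp add: partial_sum_update U(2)\<close>)
    ultimately show ?case by blast
  qed
  then show ?thesis using that by blast
qed

text \<open>
  The component \<open>u\<^sub>n\<close> of degree \<open>n \<le> c\<close> of a value satisfies \<open>n u\<^sub>n = dynkin P\<^sub>n\<close>, which depends on
  \<open>P\<close> alone, and \<open>n\<close> is invertible. Components of degree greater than \<open>c\<close> lie in \<open>\<gamma>\<^sub>c\<^sub>+\<^sub>1 = 0\<close>.
\<close>

theorem lie_eval_unique:
  assumes "lie_eval x y P u" "lie_eval x y Q v" "\<And>w. length w \<le> c \<Longrightarrow> coef P w = coef Q w"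
  shows "u = v"
proof -
  obtain U where U: "\<And>n. homog_eval x y n (homog_part (Suc n) P) (U n)" "u = partial_sum U c"
    using lie_eval_components[OF assms(1)] by blast
  obtain V where V: "\<And>n. homog_eval x y n (homog_part (Suc n) Q) (V n)" "v = partial_sum V c"
    using lie_eval_components[OF assms(2)] by blast
  have "U n = V n" if n: "n < c" for n
  proof -
    have g: "rat_defined_in R (of_nat (Suc n))" "rat_defined_in R (1 / of_nat (Suc n))"
      using n rat_defined_inverse_nat[of "Suc n"] by (simp_all add: rat_to_ring_nat del: of_nat_Suc)
    have c: "U n \<in> carrier L" "V n \<in> carrier L" using U V homog_eval_closed[OF x y] by blast+
    have "homog_part (Suc n) P = homog_part (Suc n) Q"
      by (rule ncs_eqI) (use n assms(3) in \<open>auto simp: coef_homog_part\<close>)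
    then have "rat_smult (of_nat (Suc n)) (U n) = rat_smult (of_nat (Suc n)) (V n)"
      using dynkin_homog_eval[OF U(1)] dynkin_homog_eval[OF V(1)] by metis
    then have "rat_smult (1 / of_nat (Suc n)) (rat_smult (of_nat (Suc n)) (U n))
        = rat_smult (1 / of_nat (Suc n)) (rat_smult (of_nat (Suc n)) (V n))" by simp
    then show ?thesis using g c by (simp add: rat_smult_rat_smult del: of_nat_Suc)
  qed
  then show ?thesis using U(2) V(2) partial_sum_cong by blast
qed

lemma lie_eval_homog_part: "lie_eval x y P u \<Longrightarrow> \<exists>v. lie_eval x y (homog_part (Suc n) P) v"
  using lie_eval_components homog_eval_lie_eval[OF x y] by metis

text \<open>
  Values can be inserted into values: the substituted series is built by the same operations.
\<close>

lemma lie_eval_substitute: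
  assumes "lie_eval u v T z" "lie_eval x y P u" "lie_eval x y Q v"
  shows "lie_eval x y (substitute P Q T) z"
proof -
  have PQ: "deg_ge (Suc 0) P" "deg_ge (Suc 0) Q"
    using assms(2,3) lie_eval_Nil[OF x y] by (auto simp: deg_ge_1_iff)
  show ?thesis using assms(1)
    by (induction rule: lie_eval_induct)
      (use assms(2,3) lie_eval_cmt in \<open>auto simp: substitute_var[OF PQ] substitute_add[OF PQ] substitute_qscale[OF PQ] cmt_def
        substitute_diff[OF PQ] substitute_times[OF PQ] intro: lie_eval_add lie_eval_qscale\<close>)
qed

end

end


section \<open>The Hausdorff product\<close>

text \<open>
  Such estimates allow replacing a series by its truncation inside powers and, below, inside
  iterated commutators.
\<close>

lemma deg_ge_power_diff: "deg_ge m (P - Q) \<Longrightarrow> deg_ge m (P ^ k - Q ^ k)"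
  by (induction k) (auto intro: deg_ge_times_diff)

lemma deg_ge_cmt_funpow_diff:
  assumes Z: "deg_ge (Suc 0) Z" "deg_ge (Suc 0) Z'" and W: "deg_ge (Suc 0) W" "deg_ge (Suc 0) W'"
    and d: "deg_ge m (Z - Z')" "deg_ge m (W - W')"
  shows "deg_ge (m + k) ((cmt Z ^^ k) W - (cmt Z' ^^ k) W')"
proof (induction k)
  case (Suc k)
  let ?V = "(cmt Z ^^ k) W" and ?V' = "(cmt Z' ^^ k) W'"
  have V: "deg_ge (Suc k) ?V" and V': "deg_ge (Suc k) ?V'"
    using deg_ge_cmt_funpow[OF Z(1) W(1), of k] deg_ge_cmt_funpow[OF Z(2) W(2), of k] by simp_all
  have "deg_ge (Suc (m + k)) ((?V - ?V') * Z)" "deg_ge (Suc (m + k)) (Z * (?V - ?V'))"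
    using deg_ge_times[OF Suc Z(1)] deg_ge_times[OF Z(1) Suc] by simp_all
  moreover have "deg_ge (Suc (m + k)) (?V' * (Z - Z'))" "deg_ge (Suc (m + k)) ((Z - Z') * ?V')"
    using deg_ge_times[OF V' d(1)] deg_ge_times[OF d(1) V'] by (simp_all add: add.commute)
  moreover have "cmt Z ?V - cmt Z' ?V'
      = ((?V - ?V') * Z + ?V' * (Z - Z')) - (Z * (?V - ?V') + (Z - Z') * ?V')"
    by (simp add: cmt_def algebra_simps)
  ultimately have "deg_ge (Suc (m + k)) (cmt Z ?V - cmt Z' ?V')"
    by (simp only: deg_ge_add deg_ge_diff)
  then show ?case by simp
qed (use d in simp)

text \<open>
  The part of degree \<open>n + 1\<close> of the recursion for the Hausdorff series, solved for \<open>(n + 1) H\<^sub>n\<^sub>+\<^sub>1\<close>.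
  In the remaining terms \<open>H\<close> is bracketed at least once with a series without constant term, so
  its components of degree greater than \<open>n\<close> do not matter and \<open>H\<close> may be truncated.
\<close>

lemma trunc_bch_Suc:
  fixes n
  defines "H \<equiv> trunc n bch"
  shows "qscale (of_nat (Suc n)) (homog_part (Suc n) bch)
    = homog_part (Suc n) (VY + (\<Sum>k\<le>n. qscale (1 / fact k) ((cmt H ^^ k) VX))
        - (\<Sum>k=1..n. qscale (1 / fact (Suc k)) ((cmt H ^^ k) (euler H))))"
proof (rule ncs_eqI)
  fix w :: "letter list"
  have H: "deg_ge (Suc 0) H" "deg_ge (Suc n) (bch - H)"
    using deg_ge_trunc[OF deg_ge_bch] deg_ge_trunc_diff by (auto simp: H_def)
  have E: "deg_ge (Suc n) (euler bch - euler H)"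
    using deg_ge_euler[OF H(2)] by (simp add: euler_simps)
  show "coef (qscale (of_nat (Suc n)) (homog_part (Suc n) bch)) w
    = coef (homog_part (Suc n) (VY + (\<Sum>k\<le>n. qscale (1 / fact k) ((cmt H ^^ k) VX))
        - (\<Sum>k=1..n. qscale (1 / fact (Suc k)) ((cmt H ^^ k) (euler H))))) w"
  proof (cases "length w = Suc n")
    case w: True
    let ?f = "\<lambda>Z W k. coef ((cmt Z ^^ k) W) w"
    \<comment> \<open>An \<open>(n+1)\<close>-fold commutator has degree at least \<open>n + 2\<close>.\<close>
    have top: "?f bch W (Suc n) = 0" if "deg_ge (Suc 0) W" for W
      using deg_geD[OF deg_ge_cmt_funpow[OF deg_ge_bch that, of "Suc n"], of w] w by simp
    have eqE: "?f bch (euler bch) k = ?f H (euler H) k" if "k \<ge> 1" for k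
      using deg_geD[OF deg_ge_cmt_funpow_diff[OF deg_ge_bch H(1) deg_ge_1_euler deg_ge_1_euler H(2) E],
          of w k] that w by simp
    have eqX: "?f bch VX k = ?f H VX k" for k
      using deg_geD[OF deg_ge_cmt_funpow_diff[OF deg_ge_bch H(1) deg_ge_var deg_ge_var H(2), of LetterX LetterX],
          of w k] w by (cases k) simp_all
    have "(\<Sum>k\<le>Suc n. 1 / fact (Suc k) * ?f bch (euler bch) k)
        = (\<Sum>k\<le>Suc n. 1 / fact k * ?f bch VX k) + coef VY w"
      using arg_cong[OF hausdorff_recursion, of "\<lambda>P. coef P w"] w
      by (simp only: coef_tsum coef_add coef_qscale)
    then have "(\<Sum>k\<le>n. 1 / fact (Suc k) * ?f bch (euler bch) k)
        = (\<Sum>k\<le>n. 1 / fact k * ?f bch VX k) + coef VY w"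
      unfolding sum.atMost_Suc by (simp only: top deg_ge_1_euler deg_ge_var mult_zero_right add_0_right)
    also have "(\<Sum>k\<le>n. 1 / fact (Suc k) * ?f bch (euler bch) k)
        = of_nat (Suc n) * coef bch w + (\<Sum>k=1..n. 1 / fact (Suc k) * ?f bch (euler bch) k)"
      by (simp add: sum.atLeast_Suc_atMost w flip: atLeast0AtMost del: of_nat_Suc fact_Suc)
    also have "(\<Sum>k=1..n. 1 / fact (Suc k) * ?f bch (euler bch) k)
        = (\<Sum>k=1..n. 1 / fact (Suc k) * ?f H (euler H) k)"
      by (rule sum.cong) (auto simp: eqE)
    finally show ?thesis
      using w by (simp add: coef_homog_part eqX algebra_simps del: fact_Suc of_nat_Suc)
  qed (simp add: coef_homog_part)
qed

context nilpotent_lie_algebra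
begin

primrec exp_ad_sum :: "'c \<Rightarrow> nat \<Rightarrow> 'c \<Rightarrow> 'c" where
  "exp_ad_sum u 0 a = \<zero>\<^bsub>L\<^esub>"
| "exp_ad_sum u (Suc k) a = exp_ad_sum u k a \<oplus>\<^bsub>L\<^esub> rat_smult (1 / fact k) (((\<lambda>b. br b u) ^^ k) a)"

text \<open>
  The exponential \<open>a \<cdot> e\<^sup>u\<close> of the right adjoint action. The sum stops at \<open>k = c\<close>: up to there \<open>k!\<close> is
  invertible in \<open>R\<close>, and a \<open>c\<close>-fold bracket is already zero.
\<close>

definition exp_ad :: "'c \<Rightarrow> 'c \<Rightarrow> 'c" where
  "exp_ad u a = exp_ad_sum u (Suc c) a"

lemma funpow_br_lc: "a \<in> lc m \<Longrightarrow> u \<in> carrier L \<Longrightarrow> ((\<lambda>b. br b u) ^^ k) a \<in> lc (m + k)"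
  by (induction k) (auto intro: lc_br)

lemma funpow_br_closed [simp]: "a \<in> carrier L \<Longrightarrow> u \<in> carrier L \<Longrightarrow> ((\<lambda>b. br b u) ^^ k) a \<in> carrier L"
  by (induction k) auto

lemma exp_ad_sum_closed [simp]: "a \<in> carrier L \<Longrightarrow> u \<in> carrier L \<Longrightarrow> k \<le> Suc c \<Longrightarrow> exp_ad_sum u k a \<in> carrier L"
  by (induction k) (auto simp: rat_defined_inverse_fact)

lemma exp_ad_closed [simp]: "a \<in> carrier L \<Longrightarrow> u \<in> carrier L \<Longrightarrow> exp_ad u a \<in> carrier L"
  unfolding exp_ad_def by (rule exp_ad_sum_closed) auto

text \<open>
  The Hausdorff product \<open>x \<star> y\<close>, which is the multiplication of \<open>exp(L)\<close>.
\<close>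

definition bch_prod :: "'c \<Rightarrow> 'c \<Rightarrow> 'c" where
  "bch_prod x y = (THE z. lie_eval x y (trunc c bch) z)"

context
  fixes x y
  assumes x: "x \<in> carrier L" and y: "y \<in> carrier L"
begin

lemma ex_lie_eval_sum:
  "(\<And>i. i \<in> A \<Longrightarrow> \<exists>u. lie_eval x y (f i) u) \<Longrightarrow> \<exists>u. lie_eval x y (sum f A) u"
proof (induction A rule: infinite_finite_induct)
  case (insert i A)
  then obtain u v where "lie_eval x y (f i) u" "lie_eval x y (sum f A) v" by blast
  from lie_eval_add[OF this] show ?case using insert.hyps by auto
qed (use lie_eval_zero[OF x y] in auto)

lemma ex_lie_eval_euler: "lie_eval x y P u \<Longrightarrow> \<exists>v. lie_eval x y (euler P) v"
proof (induction rule: lie_eval_induct)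
  case (cmt P u Q v)
  then obtain u' v' where u': "lie_eval x y (euler P) u'" and v': "lie_eval x y (euler Q) v'" by blast
  have "lie_eval x y (cmt Q (euler P) + cmt (euler Q) P) (br u' v \<oplus>\<^bsub>L\<^esub> br u v')"
    by (rule lie_eval_add[OF lie_eval_cmt[OF u' cmt.hyps(2)] lie_eval_cmt[OF cmt.hyps(1) v']])
  moreover have "cmt Q (euler P) + cmt (euler Q) P = euler (cmt Q P)"
    by (simp add: cmt_def euler_simps euler_times algebra_simps)
  ultimately show ?case by metis
qed (use lie_eval_var[of x y] in \<open>auto simp: euler_simps intro: lie_eval_add lie_eval_qscale\<close>)

lemma ex_lie_eval_cmt_funpow:
  "lie_eval x y Z z \<Longrightarrow> lie_eval x y W w \<Longrightarrow> lie_eval x y ((cmt Z ^^ k) W) (((\<lambda>b. br b z) ^^ k) w)"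
  by (induction k) (auto intro: lie_eval_cmt)

text \<open>
  By induction on the degree: the recursion expresses \<open>(n + 1) H\<^sub>n\<^sub>+\<^sub>1\<close> by brackets of lower components
  with denominators that divide \<open>(n + 1)!\<close>, and \<open>n + 1\<close> and \<open>(n + 1)!\<close> are invertible in \<open>R\<close> as long
  as \<open>n + 1 \<le> c\<close>.
\<close>

theorem ex_lie_eval_hausdorff: "n \<le> c \<Longrightarrow> \<exists>z. lie_eval x y (trunc n bch) z"
proof (induction n)
  case 0
  have "trunc 0 bch = 0"
    using deg_geD[OF deg_ge_bch] by (auto intro!: ncs_eqI simp: coef_trunc)
  then show ?case using lie_eval_zero[OF x y] by auto
next
  case (Suc n)
  let ?H = "trunc n bch"
  obtain z where z: "lie_eval x y ?H z" using Suc by auto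
  obtain z' where z': "lie_eval x y (euler ?H) z'" using ex_lie_eval_euler[OF z] by blast
  have 1: "\<exists>u. lie_eval x y (\<Sum>k\<le>n. qscale (1 / fact k) ((cmt ?H ^^ k) VX)) u"
    using Suc.prems lie_eval_qscale[OF ex_lie_eval_cmt_funpow[OF z lie_eval_var(1)]] rat_defined_inverse_fact
    by (intro ex_lie_eval_sum) (meson atMost_iff le_trans Suc_leD)
  have 2: "\<exists>u. lie_eval x y (\<Sum>k=1..n. qscale (1 / fact (Suc k)) ((cmt ?H ^^ k) (euler ?H))) u"
  proof (rule ex_lie_eval_sum)
    fix k assume "k \<in> {1..n}"
    then have "rat_defined_in R (1 / fact (Suc k))"
      using Suc.prems by (intro rat_defined_inverse_fact) auto
    then show "\<exists>u. lie_eval x y (qscale (1 / fact (Suc k)) ((cmt ?H ^^ k) (euler ?H))) u"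
      using lie_eval_qscale[OF ex_lie_eval_cmt_funpow[OF z z']] by blast
  qed
  obtain u v where u: "lie_eval x y (\<Sum>k\<le>n. qscale (1 / fact k) ((cmt ?H ^^ k) VX)) u"
    and v: "lie_eval x y (\<Sum>k=1..n. qscale (1 / fact (Suc k)) ((cmt ?H ^^ k) (euler ?H))) v"
    using 1 2 by blast
  have "\<exists>z. lie_eval x y (VY + (\<Sum>k\<le>n. qscale (1 / fact k) ((cmt ?H ^^ k) VX))
        - (\<Sum>k=1..n. qscale (1 / fact (Suc k)) ((cmt ?H ^^ k) (euler ?H)))) z"
    using lie_eval_add[OF lie_eval_add[OF lie_eval_var(2) u] lie_eval_uminus[OF x y v]] by (auto simp: algebra_simps)
  then obtain t where t: "lie_eval x y (qscale (of_nat (Suc n)) (homog_part (Suc n) bch)) t"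
    using lie_eval_homog_part[OF x y] unfolding trunc_bch_Suc by blast
  have "rat_defined_in R (1 / of_nat (Suc n))"
    using Suc.prems by (intro rat_defined_inverse_nat) auto
  from lie_eval_qscale[OF t this] have "\<exists>t. lie_eval x y (homog_part (Suc n) bch) t"
    by (auto simp del: of_nat_Suc)
  then show ?case using z lie_eval_add unfolding trunc_Suc by blast
qed

lemma lie_eval_bch_prod: "lie_eval x y (trunc c bch) (bch_prod x y)"
  unfolding bch_prod_def using ex_lie_eval_hausdorff[of c] lie_eval_unique[OF x y] by (metis (lifting) theI order_refl)

lemma bch_prod_closed [simp]: "bch_prod x y \<in> carrier L"
  using lie_eval_closed[OF x y lie_eval_bch_prod] .

end

context
  fixes x y
  assumes x: "x \<in> carrier L" and y: "y \<in> carrier L"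
begin

text \<open>
  The transfer principle: an identity that computes \<open>H(P', Q')\<close> for Lie series \<open>P'\<close> and \<open>Q'\<close> holds
  for the values in \<open>L\<close>, and it suffices to know all series modulo terms of degree greater than \<open>c\<close>.
\<close>

lemma bch_prod_substitute:
  assumes P: "lie_eval x y P u" "deg_ge (Suc c) (P - P')"
    and Q: "lie_eval x y Q v" "deg_ge (Suc c) (Q - Q')"
    and S: "lie_eval x y S s" "deg_ge (Suc c) (S - substitute P' Q' bch)"
  shows "bch_prod u v = s"
proof (rule lie_eval_unique[OF x y lie_eval_substitute[OF x y lie_eval_bch_prod P(1) Q(1)] S(1)])
  show "u \<in> carrier L" "v \<in> carrier L" using P(1) Q(1) lie_eval_closed[OF x y] by auto
  have PQ: "deg_ge (Suc 0) P" "deg_ge (Suc 0) Q"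
    using P(1) Q(1) lie_eval_Nil[OF x y] by (auto simp: deg_ge_1_iff)
  have "deg_ge (Suc c) (trunc c bch - bch)"
    using deg_ge_qscale[OF deg_ge_trunc_diff[of c bch], of "- 1"] by simp
  then have "deg_ge (Suc c) (substitute P Q (trunc c bch) - substitute P' Q' bch)"
    by (rule deg_ge_substitute_diff[OF P(2) Q(2) _ PQ])
  then show "coef (substitute P Q (trunc c bch)) w = coef S w" if "length w \<le> c" for w
    using that S(2) by (auto dest!: deg_geD[of _ _ w])
qed

lemma lie_eval_exp_ad_sum:
  assumes "lie_eval x y Z z" "lie_eval x y W w" "m \<le> Suc c"
  shows "lie_eval x y (\<Sum>k<m. qscale (1 / fact k) ((cmt Z ^^ k) W)) (exp_ad_sum z m w)"
  using assms(3)
  by (induction m)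
    (auto intro!: lie_eval_zero[OF x y] lie_eval_add lie_eval_qscale ex_lie_eval_cmt_funpow[OF x y] assms(1,2) rat_defined_inverse_fact)

lemma word_act_exp_ad_sum:
  assumes P: "lie_eval x y P u" and a: "a \<in> carrier L"
  shows "m \<le> Suc c \<Longrightarrow> word_act x y c (\<Sum>k<m. qscale (1 / fact k) (P ^ k)) a = exp_ad_sum u m a"
proof (induction m)
  case (Suc m)
  have i: "integral P" and u: "u \<in> carrier L"
    using lie_eval_integral[OF x y P] lie_eval_closed[OF x y P] by auto
  have p: "word_act x y c (P ^ k) a = ((\<lambda>b. br b u) ^^ k) a" for k
  proof (induction k)
    case (Suc k)
    then show ?case using i a u P x y
      by (simp add: power_Suc2 word_act_times' word_act_lie_eval del: power_Suc)
  qed (use a x y word_act_one' in simp)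
  have g: "rat_defined_in R (1 / fact k)" if "k \<le> m" for k
    using that Suc.prems by (intro rat_defined_inverse_fact) simp
  have "word_act x y c (\<Sum>k<Suc m. qscale (1 / fact k) (P ^ k)) a
      = word_act x y c (\<Sum>k<m. qscale (1 / fact k) (P ^ k)) a \<oplus>\<^bsub>L\<^esub> word_act x y c (qscale (1 / fact m) (P ^ m)) a"
    using i a g x y by (simp only: sum.lessThan_Suc) (intro word_act_add_left integral_sum; simp)
  then show ?case
    using Suc i a g p x y by (simp add: word_act_qscale)
qed (use a x y in simp)

text \<open>
  Consider the action of words on \<open>L\<close>. The series \<open>exp H\<close> acts as the exponential of the adjoint
  action of \<open>x \<star> y\<close>, and \<open>exp X * exp Y\<close> as the composition of the exponentials for \<open>x\<close> and \<open>y\<close>.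
\<close>

lemma exp_ad_bch_prod:
  assumes a: "a \<in> carrier L"
  shows "exp_ad (bch_prod x y) a = exp_ad y (exp_ad x a)"
proof -
  let ?e = "\<lambda>P. \<Sum>k<Suc c. qscale (1 / fact k) (P ^ k)"
  let ?H = "trunc c bch"
  have e: "deg_ge (Suc c) (ncs_exp P - ?e P)" if "deg_ge (Suc 0) P" for P
    unfolding ncs_exp_eq lessThan_Suc_atMost using that by (intro deg_ge_tsum deg_ge_fps_eval_term)
  have 1: "deg_ge (Suc c) (ncs_exp bch - ?e ?H)"
  proof -
    have "deg_ge (Suc c) (?e bch - ?e ?H)"
      unfolding sum_subtractf[symmetric] qscale.scale_right_diff_distrib[symmetric]
      by (intro deg_ge_sum deg_ge_qscale deg_ge_power_diff deg_ge_trunc_diff)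
    moreover have "(A - B) + (B - C) = A - C" for A B C :: ncs by simp
    ultimately show ?thesis using deg_ge_add[OF e[OF deg_ge_bch]] by metis
  qed
  have 2: "deg_ge (Suc c) (ncs_exp VX * ncs_exp VY - ?e VX * ?e VY)"
    using e[OF deg_ge_var] by (intro deg_ge_times_diff) auto
  have i: "integral (?e P)" if "integral P" for P
    using that rat_defined_inverse_fact by (intro integral_sum) auto
  have "exp_ad (bch_prod x y) a = word_act x y c (?e ?H) a"
    unfolding exp_ad_def by (rule word_act_exp_ad_sum[OF lie_eval_bch_prod[OF x y] a order_refl, symmetric])
  also have "\<dots> = word_act x y c (?e VX * ?e VY) a"
  proof (rule word_act_cong_words[OF x y])
    fix w :: "letter list" assume "length w < c"
    then show "coef (?e ?H) w = coef (?e VX * ?e VY) w"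
      using deg_geD[OF 1, of w] deg_geD[OF 2, of w] by (simp add: ncs_exp_bch)
  qed
  also have "\<dots> = word_act x y c (?e VY) (word_act x y c (?e VX) a)"
    using i a by (intro word_act_times'[OF x y]) auto
  also have "\<dots> = exp_ad y (exp_ad x a)"
    unfolding exp_ad_def word_act_exp_ad_sum[OF lie_eval_var(1)[of x y] a order_refl]
    by (rule word_act_exp_ad_sum[OF lie_eval_var(2) exp_ad_sum_closed order_refl]) (use a x in auto)
  finally show ?thesis .
qed

lemma bch_prod_conj: "bch_prod (bch_prod x y) (\<ominus>\<^bsub>L\<^esub> x) = exp_ad (\<ominus>\<^bsub>L\<^esub> x) y"
proof (rule bch_prod_substitute[OF lie_eval_bch_prod[OF x y] _ lie_eval_uminus[OF x y lie_eval_var(1)]])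
  show "deg_ge (Suc c) (trunc c bch - bch)"
    using deg_ge_qscale[OF deg_ge_trunc_diff[of c bch], of "- 1"] by simp
  show "deg_ge (Suc c) (- VX - (- VX))" by simp
  show "lie_eval x y (\<Sum>k<Suc c. qscale (1 / fact k) ((cmt (- VX) ^^ k) VY)) (exp_ad (\<ominus>\<^bsub>L\<^esub> x) y)"
    unfolding exp_ad_def by (intro lie_eval_exp_ad_sum lie_eval_uminus[OF x y lie_eval_var(1)] lie_eval_var(2)) simp
  have m: "deg_ge (Suc 0) (- VX)" by (simp add: deg_ge_1_iff)
  have "deg_ge (Suc c) (substitute bch (- VX) bch - (\<Sum>k<Suc c. qscale (1 / fact k) ((cmt (- VX) ^^ k) VY)))"
    unfolding hausdorff_conjugation lessThan_Suc_atMost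
    using deg_ge_cmt_funpow[OF m, of 0] by (intro deg_ge_tsum deg_ge_qscale) simp
  from deg_ge_qscale[OF this, of "- 1"]
  show "deg_ge (Suc c) ((\<Sum>k<Suc c. qscale (1 / fact k) ((cmt (- VX) ^^ k) VY)) - substitute bch (- VX) bch)"
    by simp
qed

lemma bch_prod_left_inverse: "bch_prod (\<ominus>\<^bsub>L\<^esub> x) (bch_prod x y) = y"
proof (rule bch_prod_substitute[OF lie_eval_uminus[OF x y lie_eval_var(1)] _ lie_eval_bch_prod[OF x y] _ lie_eval_var(2)])
  show "deg_ge (Suc c) (trunc c bch - bch)"
    using deg_ge_qscale[OF deg_ge_trunc_diff[of c bch], of "- 1"] by simp
  show "deg_ge (Suc c) (VY - substitute (- VX) bch bch)" by (simp add: hausdorff_left_inverse)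
qed simp

lemma bch_prod_right_inverse: "bch_prod (bch_prod x y) (\<ominus>\<^bsub>L\<^esub> y) = x"
proof (rule bch_prod_substitute[OF lie_eval_bch_prod[OF x y] _ lie_eval_uminus[OF x y lie_eval_var(2)] _ lie_eval_var(1)])
  show "deg_ge (Suc c) (trunc c bch - bch)"
    using deg_ge_qscale[OF deg_ge_trunc_diff[of c bch], of "- 1"] by simp
  show "deg_ge (Suc c) (VX - substitute bch (- VY) bch)" by (simp add: hausdorff_right_inverse)
qed simp

end

lemma bch_prod_zero_right: "x \<in> carrier L \<Longrightarrow> bch_prod x \<zero>\<^bsub>L\<^esub> = x"
  by (rule bch_prod_substitute[of x x VX x VX 0 "\<zero>\<^bsub>L\<^esub>" 0 VX])
    (simp_all add: lie_eval_var lie_eval_zero hausdorff_zero)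

lemma bch_prod_neg: "x \<in> carrier L \<Longrightarrow> bch_prod x (\<ominus>\<^bsub>L\<^esub> x) = \<zero>\<^bsub>L\<^esub>"
  by (rule bch_prod_substitute[of x x VX x VX "- VX" "\<ominus>\<^bsub>L\<^esub> x" "- VX" 0])
    (simp_all add: lie_eval_var lie_eval_zero lie_eval_uminus hausdorff_uminus)

lemma neg_bch_prod: "x \<in> carrier L \<Longrightarrow> bch_prod (\<ominus>\<^bsub>L\<^esub> x) x = \<zero>\<^bsub>L\<^esub>"
  by (rule bch_prod_substitute[of x x "- VX" "\<ominus>\<^bsub>L\<^esub> x" "- VX" VX x VX 0])
    (simp_all add: lie_eval_var lie_eval_zero lie_eval_uminus hausdorff_uminus)

lemma exp_ad_eq_self:
  assumes "h \<in> carrier L" "u \<in> carrier L" "br h u = \<zero>\<^bsub>L\<^esub>"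
  shows "exp_ad u h = h"
proof -
  have 0: "((\<lambda>b. br b u) ^^ Suc k) h = \<zero>\<^bsub>L\<^esub>" for k
    using assms by (induction k) auto
  have "k \<le> c \<Longrightarrow> exp_ad_sum u (Suc k) h = h" for k
  proof (induction k)
    case (Suc k)
    then show ?case
      using assms rat_defined_inverse_fact[of "Suc k"]
      by (simp only: exp_ad_sum.simps(2)[of u "Suc k"] 0) simp
  qed (use assms in simp)
  then show ?thesis by (simp only: exp_ad_def order_refl)
qed

text \<open>
  All terms with \<open>k \<ge> 2\<close> of the exponential are brackets of \<open>[h, u]\<close>, hence lie one step further down
  the lower central series than \<open>[h, u]\<close>.
\<close>

lemma exp_ad_sum_leading_terms:
  assumes h: "h \<in> carrier L" and u: "u \<in> carrier L" and d: "br h u \<in> lc j"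
  shows "Suc k \<le> c \<Longrightarrow> \<exists>e\<in>lc (Suc j). exp_ad_sum u (Suc (Suc k)) h = (h \<oplus>\<^bsub>L\<^esub> br h u) \<oplus>\<^bsub>L\<^esub> e"
proof (induction k)
  case 0
  then show ?case using h u lc_zero by (intro bexI[of _ "\<zero>\<^bsub>L\<^esub>"]) simp_all
next
  case (Suc k)
  then obtain e where e: "e \<in> lc (Suc j)"
    "exp_ad_sum u (Suc (Suc k)) h = (h \<oplus>\<^bsub>L\<^esub> br h u) \<oplus>\<^bsub>L\<^esub> e" by auto
  let ?f = "((\<lambda>b. br b u) ^^ Suc (Suc k)) h"
  have f: "?f = ((\<lambda>b. br b u) ^^ Suc k) (br h u)"
    by (simp only: funpow_Suc_right o_apply)
  have "?f \<in> lc (j + Suc k)" unfolding f by (rule funpow_br_lc[OF d u])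
  then have "?f \<in> lc (Suc j)" by (rule lc_mono[rotated]) simp
  then have t: "rat_smult (1 / fact (Suc (Suc k))) ?f \<in> lc (Suc j)"
    using Suc.prems by (intro lc_rat_smult rat_defined_inverse_fact)
  show ?case
  proof (intro bexI)
    show "e \<oplus>\<^bsub>L\<^esub> rat_smult (1 / fact (Suc (Suc k))) ?f \<in> lc (Suc j)"
      using e t by (intro lc_add)
    show "exp_ad_sum u (Suc (Suc (Suc k))) h
        = (h \<oplus>\<^bsub>L\<^esub> br h u) \<oplus>\<^bsub>L\<^esub> (e \<oplus>\<^bsub>L\<^esub> rat_smult (1 / fact (Suc (Suc k))) ?f)"
      unfolding exp_ad_sum.simps(2)[of u "Suc (Suc k)"] e(2)
      using h u lc_carrier[OF e(1)] lc_carrier[OF t] by (simp only: M.a_assoc M.a_closed lbracket_closed)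
  qed
qed

text \<open>
  If \<open>h\<close> is fixed, then \<open>[h, u]\<close> cancels against the terms with \<open>k \<ge> 2\<close>. Membership in a term of the
  lower central series then implies membership in the next one, so \<open>[h, u] = 0\<close>.
\<close>

lemma exp_ad_fixed_iff:
  assumes h: "h \<in> carrier L" and u: "u \<in> carrier L"
  shows "exp_ad u h = h \<longleftrightarrow> br h u = \<zero>\<^bsub>L\<^esub>"
proof
  assume fix_h: "exp_ad u h = h"
  have "br h u \<in> lc j" for j
  proof (induction j)
    case 0
    then show ?case using h u by simp
  next
    case (Suc j)
    show ?case
    proof (cases c)
      case 0
      then show ?thesis using lc_vanish[of 0 "br h u"] h u lc_zero by simp
    next
      case (Suc k)
      then obtain e where e: "e \<in> lc (Suc j)" "h = (h \<oplus>\<^bsub>L\<^esub> br h u) \<oplus>\<^bsub>L\<^esub> e"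
        using exp_ad_sum_leading_terms[OF h u \<open>br h u \<in> lc j\<close>, of k] fix_h
        unfolding exp_ad_def by (metis order_refl)
      have ec: "e \<in> carrier L" using e(1) lc_carrier by blast
      have "br h u \<oplus>\<^bsub>L\<^esub> e = \<zero>\<^bsub>L\<^esub>"
        using e(2) h u ec M.add.l_cancel_one'[of h "br h u \<oplus>\<^bsub>L\<^esub> e"] by (simp add: M.a_assoc)
      then have "br h u = \<ominus>\<^bsub>L\<^esub> e" using h u ec by (simp add: M.minus_equality)
      then show ?thesis using lc_minus[OF e(1)] by simp
    qed
  qed
  then show "br h u = \<zero>\<^bsub>L\<^esub>" using lc_vanish[of c] by blast
qed (use assms exp_ad_eq_self in blast)

end


section \<open>Conjugacy classes\<close>

text \<open>
  Burnside's argument for a right action of a finite set \<open>U\<close> with a multiplication \<open>m\<close> whose right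
  translations are invertible. The elements that take \<open>h\<close> to \<open>E v h\<close> are the right translates by \<open>v\<close>
  of those that fix \<open>h\<close>, so orbits have size \<open>|U| / |{u. E u h = h}|\<close>, and each orbit contributes \<open>|U|\<close>
  to the sum.
\<close>

lemma orbit_counting:
  fixes E :: "'a \<Rightarrow> 'b \<Rightarrow> 'b"
  assumes fin: "finite U" "finite Y"
    and z: "z \<in> U" "\<And>h. h \<in> Y \<Longrightarrow> E z h = h"
    and m: "\<And>u v. u \<in> U \<Longrightarrow> v \<in> U \<Longrightarrow> m u v \<in> U"
    and n: "\<And>u. u \<in> U \<Longrightarrow> n u \<in> U"
    and E: "\<And>u h. u \<in> U \<Longrightarrow> h \<in> Y \<Longrightarrow> E u h \<in> Y"
    and Em: "\<And>u v h. u \<in> U \<Longrightarrow> v \<in> U \<Longrightarrow> h \<in> Y \<Longrightarrow> E (m u v) h = E v (E u h)"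
    and En: "\<And>u h. u \<in> U \<Longrightarrow> h \<in> Y \<Longrightarrow> E (n u) (E u h) = h"
    and mn: "\<And>u v. u \<in> U \<Longrightarrow> v \<in> U \<Longrightarrow> m (m u v) (n v) = u"
    and nm: "\<And>u v. u \<in> U \<Longrightarrow> v \<in> U \<Longrightarrow> m (m u (n v)) v = u"
  shows "(\<Sum>h\<in>Y. card {u\<in>U. E u h = h}) = card U * card ((\<lambda>h. (\<lambda>u. E u h) ` U) ` Y)"
proof -
  define O' where "O' = (\<lambda>h. (\<lambda>u. E u h) ` U)"
  define C where "C = (\<lambda>h. {u\<in>U. E u h = h})"
  have orbit_size: "card (O' h) * card (C h) = card U" if h: "h \<in> Y" for h
  proof -
    have "card {u\<in>U. E u h = k} = card (C h)" if k: "k \<in> O' h" for k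
    proof -
      obtain v where v: "v \<in> U" "k = E v h" using k by (auto simp: O'_def)
      have "bij_betw (\<lambda>u. m u (n v)) {u\<in>U. E u h = k} (C h)"
        by (rule bij_betw_byWitness[where f' = "\<lambda>u. m u v"])
          (use v h in \<open>auto simp: C_def m n mn nm Em En\<close>)
      then show ?thesis by (rule bij_betw_same_card)
    qed
    then have "(\<Sum>k\<in>O' h. card {u\<in>U. E u h = k}) = card (O' h) * card (C h)" by simp
    moreover have "card U = (\<Sum>k\<in>O' h. card {u\<in>U. E u h = k})"
      using sum.image_gen[OF fin(1), of "\<lambda>_. 1 :: nat" "\<lambda>u. E u h"] by (simp add: O'_def)
    ultimately show ?thesis by simp
  qed
  have self: "h \<in> O' h" if "h \<in> Y" for h
    using z that unfolding O'_def by force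
  have sub: "O' k \<subseteq> O' h" if h: "h \<in> Y" and k: "k \<in> O' h" for h k
  proof
    fix l assume "l \<in> O' k"
    then obtain u v where "u \<in> U" "v \<in> U" "l = E v (E u h)"
      using k by (auto simp: O'_def)
    then have "m u v \<in> U" "l = E (m u v) h" using m Em h by auto
    then show "l \<in> O' h" by (auto simp: O'_def)
  qed
  have eq: "O' k = O' h" if h: "h \<in> Y" and k: "k \<in> O' h" for h k
  proof
    obtain v where v: "v \<in> U" "k = E v h" using k by (auto simp: O'_def)
    then have "h = E (n v) k" "k \<in> Y" using h En E by auto
    then have "h \<in> O' k" "k \<in> Y" using n v by (auto simp: O'_def)
    then show "O' h \<subseteq> O' k" using sub by blast
  qed (use sub h k in blast)
  have fibre: "{h\<in>Y. O' h = O' k} = O' k" if "k \<in> Y" for k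
  proof -
    have "O' k \<subseteq> Y" using E that by (auto simp: O'_def)
    then show ?thesis using self eq[OF that] by blast
  qed
  have "(\<Sum>h\<in>Y. card (C h)) = (\<Sum>B\<in>O' ` Y. \<Sum>h\<in>{h\<in>Y. O' h = B}. card (C h))"
    by (rule sum.image_gen[OF fin(2)])
  also have "\<dots> = (\<Sum>B\<in>O' ` Y. card U)"
  proof (rule sum.cong[OF refl])
    fix B assume "B \<in> O' ` Y"
    then obtain k where k: "k \<in> Y" "B = O' k" by blast
    have "card (C h) = card (C k)" if "h \<in> B" for h
    proof -
      have "h \<in> Y" "O' h = O' k" using fibre[OF k(1)] k(2) that by auto
      moreover have "card (O' k) \<noteq> 0" using self[OF k(1)] fin(1) by (auto simp: O'_def)
      ultimately show ?thesis
        using orbit_size[of h] orbit_size[OF k(1)] by (metis mult_left_cancel)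
    qed
    then show "(\<Sum>h\<in>{h\<in>Y. O' h = B}. card (C h)) = card U"
      using orbit_size[OF k(1)] fibre[OF k(1)] k(2) by simp
  qed
  finally show ?thesis by (simp add: O'_def C_def)
qed

context nilpotent_lie_algebra
begin

context
  assumes cls: "c = nilpotency_class R L" and fin: "finite (carrier L)"
begin

abbreviation "G \<equiv> lie_exp R L"

lemma lie_exp_mult: "x \<otimes>\<^bsub>G\<^esub> y = bch_prod x y"
  by (simp add: lie_exp_def bch_prod_def lie_eval_def trunc_def flip: cls coef_bch)

lemma lie_exp_carrier [simp]: "carrier G = carrier L"
  and lie_exp_one [simp]: "\<one>\<^bsub>G\<^esub> = \<zero>\<^bsub>L\<^esub>"
  by (simp_all add: lie_exp_def)

text \<open>
  An inverse \<open>y\<close> of \<open>x\<close> equals \<open>(-x) \<star> (x \<star> y) = (-x) \<star> 0 = -x\<close>.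
\<close>

lemma lie_exp_inv:
  assumes x: "x \<in> carrier L"
  shows "inv\<^bsub>G\<^esub> x = \<ominus>\<^bsub>L\<^esub> x"
  unfolding m_inv_def lie_exp_mult lie_exp_carrier lie_exp_one
proof (rule the_equality)
  show "\<ominus>\<^bsub>L\<^esub> x \<in> carrier L \<and> bch_prod x (\<ominus>\<^bsub>L\<^esub> x) = \<zero>\<^bsub>L\<^esub> \<and> bch_prod (\<ominus>\<^bsub>L\<^esub> x) x = \<zero>\<^bsub>L\<^esub>"
    using x bch_prod_neg neg_bch_prod by simp
  fix y assume y: "y \<in> carrier L \<and> bch_prod x y = \<zero>\<^bsub>L\<^esub> \<and> bch_prod y x = \<zero>\<^bsub>L\<^esub>"
  then show "y = \<ominus>\<^bsub>L\<^esub> x"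
    using bch_prod_left_inverse[of x y] bch_prod_zero_right[of "\<ominus>\<^bsub>L\<^esub> x"] x by simp
qed

lemma exp_ad_neg: "u \<in> carrier L \<Longrightarrow> h \<in> carrier L \<Longrightarrow> exp_ad (\<ominus>\<^bsub>L\<^esub> u) (exp_ad u h) = h"
  using exp_ad_bch_prod[of u "\<ominus>\<^bsub>L\<^esub> u" h] bch_prod_neg[of u] exp_ad_eq_self[of h "\<zero>\<^bsub>L\<^esub>"] by simp

text \<open>
  Conjugacy classes are the orbits of the exponentials \<open>e\<^sup>u\<close>, and the elements \<open>u\<close> that fix \<open>h\<close> form
  the kernel of \<open>ad h\<close>, since \<open>[h, u] = 0\<close> and \<open>[u, h] = 0\<close> are equivalent.
\<close>

theorem num_conjugacy_classes_lie_exp: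
  "of_nat (num_conjugacy_classes G) = ask L L L (lie_ad L)"
proof -
  let ?X = "carrier L"
  have "(\<Sum>h\<in>?X. card {u\<in>?X. exp_ad u h = h})
      = card ?X * card ((\<lambda>h. (\<lambda>u. exp_ad u h) ` ?X) ` ?X)"
  proof (rule orbit_counting[OF fin fin, where z = "\<zero>\<^bsub>L\<^esub>" and m = bch_prod and n = "a_inv L"])
    show "bch_prod (bch_prod u (\<ominus>\<^bsub>L\<^esub> v)) v = u" if "u \<in> ?X" "v \<in> ?X" for u v
      using bch_prod_right_inverse[of u "\<ominus>\<^bsub>L\<^esub> v"] that by simp
  qed (simp_all add: exp_ad_eq_self bch_prod_closed exp_ad_bch_prod bch_prod_right_inverse exp_ad_neg)
  moreover have "orbits G ?X (\<lambda>g. \<lambda>h\<in>carrier G. g \<otimes>\<^bsub>G\<^esub> h \<otimes>\<^bsub>G\<^esub> inv\<^bsub>G\<^esub> g)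
      = (\<lambda>h. (\<lambda>u. exp_ad u h) ` ?X) ` ?X"
  proof -
    have "orbit G (\<lambda>g. \<lambda>h\<in>carrier G. g \<otimes>\<^bsub>G\<^esub> h \<otimes>\<^bsub>G\<^esub> inv\<^bsub>G\<^esub> g) h = (\<lambda>u. exp_ad u h) ` ?X"
      if h: "h \<in> ?X" for h
    proof -
      have "orbit G (\<lambda>g. \<lambda>h\<in>carrier G. g \<otimes>\<^bsub>G\<^esub> h \<otimes>\<^bsub>G\<^esub> inv\<^bsub>G\<^esub> g) h
          = (\<lambda>g. exp_ad (\<ominus>\<^bsub>L\<^esub> g) h) ` ?X"
        unfolding orbit_def lie_exp_carrier setcompr_eq_image Collect_mem_eq
        by (rule image_cong) (use h in \<open>simp_all add: lie_exp_mult lie_exp_inv bch_prod_conj\<close>)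
      also have "\<dots> = (\<lambda>u. exp_ad u h) ` ?X"
      proof -
        have "u \<in> a_inv L ` ?X" if "u \<in> ?X" for u
          by (rule image_eqI[of _ _ "\<ominus>\<^bsub>L\<^esub> u"]) (use that in simp_all)
        then have X: "a_inv L ` ?X = ?X" by auto
        have "(\<lambda>g. exp_ad (\<ominus>\<^bsub>L\<^esub> g) h) ` ?X = (\<lambda>u. exp_ad u h) ` (a_inv L ` ?X)"
          by (simp only: image_image)
        then show ?thesis by (simp only: X)
      qed
      finally show ?thesis .
    qed
    then show ?thesis unfolding orbits_def by (auto simp: image_iff)
  qed
  moreover have "a_kernel L L (lie_ad L h) = {u\<in>?X. exp_ad u h = h}" if h: "h \<in> ?X" for h
  proof -
    have "br u h = \<zero>\<^bsub>L\<^esub> \<longleftrightarrow> br h u = \<zero>\<^bsub>L\<^esub>" if "u \<in> ?X" for u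
      using br_swap[of u h] br_swap[of h u] h that by auto
    then show ?thesis
      using h by (auto simp: a_kernel_def' lie_ad_def exp_ad_fixed_iff)
  qed
  ultimately have "(\<Sum>h\<in>?X. card (a_kernel L L (lie_ad L h))) = card ?X * num_conjugacy_classes G"
    by (simp add: num_conjugacy_classes_def)
  then have "of_nat (\<Sum>h\<in>?X. card (a_kernel L L (lie_ad L h)))
      = (of_nat (card ?X * num_conjugacy_classes G) :: rat)" by simp
  moreover have "card ?X \<noteq> 0" using fin by auto
  ultimately show ?thesis by (simp add: ask_def)
qed

end

end


section \<open>Duality over finite principal ideal rings\<close>

context abelian_group_hom
begin

lemma card_fibre:
  assumes a0: "a0 \<in> carrier G"
  shows "card {a\<in>carrier G. h a = h a0} = card {a\<in>carrier G. h a = \<zero>\<^bsub>H\<^esub>}"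
proof -
  have "bij_betw (\<lambda>a. a \<ominus>\<^bsub>G\<^esub> a0) {a\<in>carrier G. h a = h a0} {a\<in>carrier G. h a = \<zero>\<^bsub>H\<^esub>}"
    by (rule bij_betw_byWitness[where f' = "\<lambda>a. a \<oplus>\<^bsub>G\<^esub> a0"])
      (use a0 in \<open>auto simp: a_minus_def G.a_assoc G.l_neg G.r_neg H.r_neg\<close>)
  then show ?thesis by (rule bij_betw_same_card)
qed

lemma card_image_kernel:
  assumes fin: "finite (carrier G)"
  shows "card (h ` carrier G) * card {a\<in>carrier G. h a = \<zero>\<^bsub>H\<^esub>} = card (carrier G)"
proof -
  have "card (carrier G) = (\<Sum>b\<in>h ` carrier G. card {a\<in>carrier G. h a = b})"
    using sum.image_gen[OF fin, of "\<lambda>_. 1 :: nat" h] by simp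
  also have "\<dots> = (\<Sum>b\<in>h ` carrier G. card {a\<in>carrier G. h a = \<zero>\<^bsub>H\<^esub>})"
    by (rule sum.cong) (auto simp: card_fibre)
  finally show ?thesis by simp
qed

end

locale finite_principal_ring = cring +
  assumes finite_ring: "finite (carrier R)"
    and principal: "ideal I R \<Longrightarrow> \<exists>d\<in>carrier R. I = PIdl d"
begin

lemma mult_hom: 
  assumes "d \<in> carrier R"
  shows "abelian_group_hom R R (\<lambda>r. r \<otimes> d)"
  by (rule abelian_group_homI; (rule abelian_group_axioms)?)
    (use assms in \<open>auto simp: group_hom_def group_hom_axioms_def hom_def l_distr a_group\<close>)

lemma card_PIdl:
  assumes "d \<in> carrier R"
  shows "card (PIdl d) * card {r\<in>carrier R. r \<otimes> d = \<zero>} = card (carrier R)"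
proof -
  have "PIdl d = (\<lambda>r. r \<otimes> d) ` carrier R" by (auto simp: cgenideal_def)
  then show ?thesis using abelian_group_hom.card_image_kernel[OF mult_hom[OF assms] finite_ring] by simp
qed

lemma annihilator_ideal:
  assumes d: "d \<in> carrier R"
  shows "ideal {r\<in>carrier R. r \<otimes> d = \<zero>} R"
proof (rule idealI[OF ring_axioms])
  show "subgroup {r \<in> carrier R. r \<otimes> d = \<zero>} (add_monoid R)"
    by (rule add.subgroupI) (use d in \<open>auto simp: l_distr l_minus\<close>)
next
  fix a x assume a: "a \<in> {r\<in>carrier R. r \<otimes> d = \<zero>}" and x: "x \<in> carrier R"
  then have "x \<otimes> a \<otimes> d = \<zero>" using d by (simp add: m_assoc)
  then show "x \<otimes> a \<in> {r\<in>carrier R. r \<otimes> d = \<zero>}" "a \<otimes> x \<in> {r\<in>carrier R. r \<otimes> d = \<zero>}"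
    using a x by (simp_all add: m_comm[of a x])
qed

text \<open>
  The ideal \<open>Ann d\<close> has a generator \<open>e\<close>. Then \<open>dR \<subseteq> Ann e = Ann (Ann d)\<close>, and equality follows from
  \<open>|Ann e| = |R| / |eR| = |R| / |Ann d| = |dR|\<close>. It is this property of \<open>R\<close> that lets functionals be
  extended.
\<close>

lemma double_annihilator:
  assumes d: "d \<in> carrier R" and x: "x \<in> carrier R"
    and ann: "\<And>s. s \<in> carrier R \<Longrightarrow> s \<otimes> d = \<zero> \<Longrightarrow> s \<otimes> x = \<zero>"
  shows "x \<in> PIdl d"
proof -
  let ?A = "\<lambda>d. {r\<in>carrier R. r \<otimes> d = \<zero>}"
  obtain e where e: "e \<in> carrier R" "?A d = PIdl e"
    using principal[OF annihilator_ideal[OF d]] by blast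
  have fin: "finite (?A e)" using finite_ring by simp
  have eA: "e \<in> ?A d" using e cgenideal_self by auto
  have "x \<otimes> d \<otimes> e = \<zero>" if "x \<in> carrier R" for x
    using eA d e(1) that by (simp add: m_assoc m_comm[of d e])
  then have "PIdl d \<subseteq> ?A e"
    using d by (auto simp: cgenideal_def)
  moreover have "card (PIdl d) = card (?A e)"
  proof -
    have "card (PIdl e) * card (?A e) = card (PIdl e) * card (PIdl d)"
      using card_PIdl[OF e(1)] card_PIdl[OF d] e(2) by (simp add: mult.commute)
    moreover have "card (PIdl e) \<noteq> 0"
      using cgenideal_self[OF e(1)] e(2) finite_ring by (metis (no_types, lifting) card_0_eq
          empty_iff finite_subset mem_Collect_eq subsetI)
    ultimately show ?thesis by simp
  qed
  ultimately have "PIdl d = ?A e" using fin by (metis card_subset_eq)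
  moreover have "x \<in> ?A e" using ann[of e] eA x e(1) by (simp add: m_comm)
  ultimately show ?thesis by simp
qed

end

text \<open>
  A generator of the preimage of an ideal maps to a generator of the ideal.
\<close>

lemma surj_image_principal:
  assumes D: "principal_domain D" and R: "cring R"
    and g: "g \<in> ring_hom D R" "g ` carrier D = carrier R" and J: "ideal J R"
  shows "\<exists>d\<in>carrier R. J = PIdl\<^bsub>R\<^esub> d"
proof -
  interpret D: principal_domain D by fact
  interpret R: cring R by fact
  interpret g: ring_hom_ring D R g
    by (rule ring_hom_ringI2[OF D.ring_axioms R.ring_axioms g(1)])
  obtain a where a: "a \<in> carrier D" "{x\<in>carrier D. g x \<in> J} = PIdl\<^bsub>D\<^esub> a"
    using D.exists_gen[OF g.ideal_vimage[OF J]] by blast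
  have ga: "g a \<in> J" using a D.cgenideal_self by blast
  have "J = PIdl\<^bsub>R\<^esub> (g a)"
  proof
    show "PIdl\<^bsub>R\<^esub> (g a) \<subseteq> J" using R.cgenideal_minimal[OF J ga] .
    show "J \<subseteq> PIdl\<^bsub>R\<^esub> (g a)"
    proof
      fix y assume y: "y \<in> J"
      then have "y \<in> carrier R" using ideal.Icarr[OF J] by blast
      then obtain x where x: "x \<in> carrier D" "y = g x" using g(2) by blast
      then have "x \<in> PIdl\<^bsub>D\<^esub> a" using a(2) y by blast
      then obtain r where "r \<in> carrier D" "x = r \<otimes>\<^bsub>D\<^esub> a" by (auto simp: cgenideal_def)
      then show "y \<in> PIdl\<^bsub>R\<^esub> (g a)" using x a by (auto simp: cgenideal_def)
    qed
  qed
  then show ?thesis using g.hom_closed[OF a(1)] by (rule bexI)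
qed

lemma truncated_dvr_finite_principal_ring:
  assumes "truncated_dvr D R" "finite (carrier R)"
  shows "finite_principal_ring R"
proof -
  obtain P n where R: "cring R" and D: "principal_domain D" and P: "maximalideal P D"
    and iso: "R \<simeq> D Quot (P [^]\<^bsub>ideals_set D\<^esub> (n :: nat))"
    using assms(1) unfolding truncated_dvr_def discrete_valuation_ring_def by blast
  interpret R: cring R by fact
  interpret D: principal_domain D by fact
  interpret IS: comm_monoid "ideals_set D" by (rule D.ideals_set_is_comm_monoid)
  let ?I = "P [^]\<^bsub>ideals_set D\<^esub> n"
  have "P \<in> carrier (ideals_set D)"
    using P by (simp add: ideals_set_def maximalideal_def)
  then have "?I \<in> carrier (ideals_set D)" by simp
  then have "ideal ?I D" by (simp add: ideals_set_def)
  then interpret I: ideal ?I D .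
  obtain h where h: "h \<in> ring_iso (D Quot ?I) R"
    using ring_iso_sym[OF R.ring_axioms iso] by (auto simp: is_ring_iso_def)
  have g: "h \<circ> (+>\<^bsub>D\<^esub>) ?I \<in> ring_hom D R"
    using ring_hom_trans[OF I.rcos_ring_hom] h by (auto simp: ring_iso_def)
  have "(+>\<^bsub>D\<^esub>) ?I ` carrier D = carrier (D Quot ?I)"
    by (auto simp: FactRing_def A_RCOSETS_def')
  then have "(h \<circ> (+>\<^bsub>D\<^esub>) ?I) ` carrier D = carrier R"
    using h unfolding image_comp[symmetric] ring_iso_def bij_betw_def by simp
  then show ?thesis
    using surj_image_principal[OF D R g] assms(2) R
    by (simp add: finite_principal_ring_def finite_principal_ring_axioms_def)
qed

locale finite_principal_module = R?: finite_principal_ring R + module R M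
  for R (structure) and M (structure) +
  assumes finite_module: "finite (carrier M)"
begin

text \<open>
  The submodule \<open>N\<close> is a parameter because functionals are extended one generator at a time;
  \<open>I = {}\<close> gives the dual of \<open>N\<close>.
\<close>

definition functionals :: "'c set \<Rightarrow> 'c set \<Rightarrow> ('c \<Rightarrow> 'a) set" where
  "functionals I N = {\<psi> \<in> N \<rightarrow>\<^sub>E carrier R.
     (\<forall>x\<in>N. \<forall>y\<in>N. \<psi> (x \<oplus>\<^bsub>M\<^esub> y) = \<psi> x \<oplus> \<psi> y) \<and>
     (\<forall>r\<in>carrier R. \<forall>x\<in>N. \<psi> (r \<odot>\<^bsub>M\<^esub> x) = r \<otimes> \<psi> x) \<and> (\<forall>x\<in>I. \<psi> x = \<zero>)}"

text \<open>
  The scalars \<open>r\<close> with \<open>r u \<in> N\<close> form an ideal \<open>dR\<close>. An extension of \<open>\<phi>\<close> to \<open>N + R u\<close> is given by a value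
  \<open>v\<close> at \<open>u\<close> with \<open>v d = \<phi>(d u)\<close>. Every scalar that annihilates \<open>d\<close> annihilates \<open>\<phi>(d u)\<close>, so this
  equation is solvable by the double annihilator property, and it has \<open>|Ann d| = |R| / |dR|\<close>
  solutions. This number is also the index of \<open>N\<close> in \<open>N + R u\<close>.
\<close>

lemma functionals_step:
  assumes N: "submodule N R M" and IN: "I \<subseteq> N" and u: "u \<in> carrier M"
  defines "N' \<equiv> {x \<oplus>\<^bsub>M\<^esub> r \<odot>\<^bsub>M\<^esub> u | x r. x \<in> N \<and> r \<in> carrier R}"
  shows "submodule N' R M" "N \<subseteq> N'" "u \<in> N'"
    "card (functionals I N') * card N = card (functionals I N) * card N'"
proof -
  note NE = submoduleE[OF N]
  have Nc: "x \<in> carrier M" if "x \<in> N" for x using NE(1) that by blast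
  have N0: "\<zero>\<^bsub>M\<^esub> \<in> N" using subgroup.one_closed[OF submodule.axioms(1)[OF N]] by simp
  have Nm: "x \<ominus>\<^bsub>M\<^esub> y \<in> N" if "x \<in> N" "y \<in> N" for x y
    using NE(3,5) that by (simp add: a_minus_def)
  show N': "submodule N' R M"
  proof (rule submoduleI)
    show "N' \<subseteq> carrier M" using Nc u by (auto simp: N'_def)
    show "\<zero>\<^bsub>M\<^esub> \<in> N'" unfolding N'_def using N0 u
      by (intro CollectI exI[of _ "\<zero>\<^bsub>M\<^esub>"] exI[of _ "\<zero>"]) simp
    show "\<ominus>\<^bsub>M\<^esub> a \<in> N'" if "a \<in> N'" for a
    proof -
      obtain x r where "a = x \<oplus>\<^bsub>M\<^esub> r \<odot>\<^bsub>M\<^esub> u" "x \<in> N" "r \<in> carrier R"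
        using \<open>a \<in> N'\<close> by (auto simp: N'_def)
      then show ?thesis unfolding N'_def using NE(3) Nc u
        by (intro CollectI exI[of _ "\<ominus>\<^bsub>M\<^esub> x"] exI[of _ "\<ominus> r"])
          (simp add: M.minus_add smult_l_minus)
    qed
    show "a \<oplus>\<^bsub>M\<^esub> b \<in> N'" if ab: "a \<in> N'" "b \<in> N'" for a b
    proof -
      obtain x r where x: "a = x \<oplus>\<^bsub>M\<^esub> r \<odot>\<^bsub>M\<^esub> u" "x \<in> N" "r \<in> carrier R"
        using ab by (auto simp: N'_def)
      obtain y s where y: "b = y \<oplus>\<^bsub>M\<^esub> s \<odot>\<^bsub>M\<^esub> u" "y \<in> N" "s \<in> carrier R"
        using ab by (auto simp: N'_def)
      show ?thesis unfolding N'_def using NE(5) Nc u x y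
        by (intro CollectI exI[of _ "x \<oplus>\<^bsub>M\<^esub> y"] exI[of _ "r \<oplus> s"])
          (simp add: smult_l_distr M.a_ac)
    qed
    show "s \<odot>\<^bsub>M\<^esub> a \<in> N'" if "s \<in> carrier R" "a \<in> N'" for s a
    proof -
      obtain x r where "a = x \<oplus>\<^bsub>M\<^esub> r \<odot>\<^bsub>M\<^esub> u" "x \<in> N" "r \<in> carrier R"
        using \<open>a \<in> N'\<close> by (auto simp: N'_def)
      then show ?thesis unfolding N'_def using NE(4) Nc u that
        by (intro CollectI exI[of _ "s \<odot>\<^bsub>M\<^esub> x"] exI[of _ "s \<otimes> r"])
          (simp add: smult_r_distr smult_assoc1)
    qed
  qed
  show NN': "N \<subseteq> N'"
  proof
    fix x assume "x \<in> N"
    then show "x \<in> N'" unfolding N'_def using Nc u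
      by (intro CollectI exI[of _ x] exI[of _ "\<zero>"]) simp
  qed
  show uN': "u \<in> N'" unfolding N'_def using N0 u
    by (intro CollectI exI[of _ "\<zero>\<^bsub>M\<^esub>"] exI[of _ "\<one>"]) simp
  have N'I: "x \<oplus>\<^bsub>M\<^esub> r \<odot>\<^bsub>M\<^esub> u \<in> N'" if "x \<in> N" "r \<in> carrier R" for x r
    using that by (auto simp: N'_def)
  define J where "J = {r\<in>carrier R. r \<odot>\<^bsub>M\<^esub> u \<in> N}"
  have "ideal J R"
  proof (rule idealI[OF R.ring_axioms])
    show "subgroup J (add_monoid R)"
    proof (rule R.add.subgroupI)
      have "\<zero> \<in> J" using N0 u by (simp add: J_def)
      then show "J \<noteq> {}" by blast
    qed (use u NE in \<open>auto simp: J_def smult_l_distr smult_l_minus\<close>)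
    fix a x assume a: "a \<in> J" and x: "x \<in> carrier R"
    then show xa: "x \<otimes> a \<in> J" using NE(4) u by (simp add: J_def smult_assoc1)
    show "a \<otimes> x \<in> J" using xa a x by (simp add: J_def R.m_comm[of a x])
  qed
  then obtain d where d: "d \<in> carrier R" "J = PIdl d" using principal by blast
  have dJ: "d \<in> J" using d cgenideal_self by blast
  then have duN: "d \<odot>\<^bsub>M\<^esub> u \<in> N" by (simp add: J_def)
  have fin: "finite N" "finite N'" "finite J" "finite (carrier R)"
    using finite_module finite_ring NE(1) submoduleE(1)[OF N'] finite_subset by (auto simp: J_def)
  \<comment> \<open>Two representations of an element of \<open>N + R u\<close> differ by a scalar in \<open>J\<close>.\<close>
  have rep: "r \<ominus> r' \<in> J \<and> x' \<ominus>\<^bsub>M\<^esub> x = (r \<ominus> r') \<odot>\<^bsub>M\<^esub> u"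
    if "x \<in> N" "x' \<in> N" "r \<in> carrier R" "r' \<in> carrier R"
      "x \<oplus>\<^bsub>M\<^esub> r \<odot>\<^bsub>M\<^esub> u = x' \<oplus>\<^bsub>M\<^esub> r' \<odot>\<^bsub>M\<^esub> u" for x x' r r'
  proof -
    have c: "x \<in> carrier M" "x' \<in> carrier M" "r \<odot>\<^bsub>M\<^esub> u \<in> carrier M" "r' \<odot>\<^bsub>M\<^esub> u \<in> carrier M"
      using that Nc u by auto
    have "x' \<ominus>\<^bsub>M\<^esub> x = (x' \<oplus>\<^bsub>M\<^esub> r' \<odot>\<^bsub>M\<^esub> u) \<ominus>\<^bsub>M\<^esub> r' \<odot>\<^bsub>M\<^esub> u \<ominus>\<^bsub>M\<^esub> x"
      using c by (simp add: a_minus_def M.a_assoc M.r_neg)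
    also have "\<dots> = r \<odot>\<^bsub>M\<^esub> u \<ominus>\<^bsub>M\<^esub> r' \<odot>\<^bsub>M\<^esub> u"
      unfolding that(5)[symmetric] using c by (simp add: a_minus_def M.a_ac M.r_neg M.r_neg2 M.r_neg1)
    also have "\<dots> = (r \<ominus> r') \<odot>\<^bsub>M\<^esub> u"
      using that u by (simp add: a_minus_def smult_l_distr smult_l_minus)
    finally have e: "x' \<ominus>\<^bsub>M\<^esub> x = (r \<ominus> r') \<odot>\<^bsub>M\<^esub> u" .
    then show ?thesis using Nm[OF that(2,1)] that(3,4) by (simp add: J_def)
  qed
  \<comment> \<open>The map \<open>(x, r) \<mapsto> x + r u\<close> from \<open>N \<times> R\<close> onto \<open>N + R u\<close> has fibres of size \<open>|J|\<close>.\<close>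
  have card_N': "card N' * card J = card N * card (carrier R)"
  proof -
    let ?f = "\<lambda>(x, r). x \<oplus>\<^bsub>M\<^esub> r \<odot>\<^bsub>M\<^esub> u"
    have "card {p\<in>N \<times> carrier R. ?f p = b} = card J" if "b \<in> N'" for b
    proof -
      obtain x r where b: "b = x \<oplus>\<^bsub>M\<^esub> r \<odot>\<^bsub>M\<^esub> u" "x \<in> N" "r \<in> carrier R"
        using \<open>b \<in> N'\<close> by (auto simp: N'_def)
      have "bij_betw (\<lambda>j. (x \<ominus>\<^bsub>M\<^esub> j \<odot>\<^bsub>M\<^esub> u, r \<oplus> j)) J {p\<in>N \<times> carrier R. ?f p = b}"
      proof (rule bij_betw_byWitness[where f' = "\<lambda>p. snd p \<ominus> r"])
        show "\<forall>j\<in>J. snd (x \<ominus>\<^bsub>M\<^esub> j \<odot>\<^bsub>M\<^esub> u, r \<oplus> j) \<ominus> r = j"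
          using b by (auto simp: J_def a_minus_def R.a_ac R.r_neg)
        show "\<forall>p\<in>{p\<in>N \<times> carrier R. ?f p = b}.
            (x \<ominus>\<^bsub>M\<^esub> (snd p \<ominus> r) \<odot>\<^bsub>M\<^esub> u, r \<oplus> (snd p \<ominus> r)) = p"
        proof
          fix p assume "p \<in> {p\<in>N \<times> carrier R. ?f p = b}"
          then obtain y s where p: "p = (y, s)"
            and y: "y \<in> N" "s \<in> carrier R" "y \<oplus>\<^bsub>M\<^esub> s \<odot>\<^bsub>M\<^esub> u = b" by auto
          have 1: "r \<oplus> (s \<ominus> r) = s"
            using y b by (simp add: a_minus_def R.a_lcomm[of r s] R.r_neg)
          have "x \<ominus>\<^bsub>M\<^esub> y = (s \<ominus> r) \<odot>\<^bsub>M\<^esub> u" using rep[of y x s r] y b by simp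
          then have "x \<ominus>\<^bsub>M\<^esub> (s \<ominus> r) \<odot>\<^bsub>M\<^esub> u = x \<ominus>\<^bsub>M\<^esub> (x \<ominus>\<^bsub>M\<^esub> y)" by simp
          also have "\<dots> = y" using Nc[OF b(2)] Nc[OF y(1)]
            by (simp add: a_minus_def M.minus_add M.r_neg M.r_neg1 M.r_neg2 flip: M.a_assoc)
          finally show "(x \<ominus>\<^bsub>M\<^esub> (snd p \<ominus> r) \<odot>\<^bsub>M\<^esub> u, r \<oplus> (snd p \<ominus> r)) = p"
            using 1 p by simp
        qed
        show "(\<lambda>j. (x \<ominus>\<^bsub>M\<^esub> j \<odot>\<^bsub>M\<^esub> u, r \<oplus> j)) ` J \<subseteq> {p\<in>N \<times> carrier R. ?f p = b}"
        proof (rule image_subsetI)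
          fix j assume j: "j \<in> J"
          then have jc: "j \<in> carrier R" "j \<odot>\<^bsub>M\<^esub> u \<in> N" by (auto simp: J_def)
          have "(x \<ominus>\<^bsub>M\<^esub> j \<odot>\<^bsub>M\<^esub> u) \<oplus>\<^bsub>M\<^esub> (r \<oplus> j) \<odot>\<^bsub>M\<^esub> u
              = x \<oplus>\<^bsub>M\<^esub> r \<odot>\<^bsub>M\<^esub> u \<oplus>\<^bsub>M\<^esub> (j \<odot>\<^bsub>M\<^esub> u \<oplus>\<^bsub>M\<^esub> \<ominus>\<^bsub>M\<^esub> (j \<odot>\<^bsub>M\<^esub> u))"
            using Nc[OF b(2)] b(3) jc u by (simp add: a_minus_def smult_l_distr M.a_ac)
          also have "\<dots> = b" using b Nc[OF b(2)] jc u by (simp add: M.r_neg)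
          finally show "(x \<ominus>\<^bsub>M\<^esub> j \<odot>\<^bsub>M\<^esub> u, r \<oplus> j) \<in> {p\<in>N \<times> carrier R. ?f p = b}"
            using jc b Nm by simp
        qed
        show "(\<lambda>p. snd p \<ominus> r) ` {p\<in>N \<times> carrier R. ?f p = b} \<subseteq> J"
        proof (rule image_subsetI)
          fix p assume "p \<in> {p\<in>N \<times> carrier R. ?f p = b}"
          then obtain y s where p: "p = (y, s)"
            and y: "y \<in> N" "s \<in> carrier R" "y \<oplus>\<^bsub>M\<^esub> s \<odot>\<^bsub>M\<^esub> u = b" by auto
          show "snd p \<ominus> r \<in> J" using rep[of y x s r] y b p by simp
        qed
      qed
      from bij_betw_same_card[OF this] show ?thesis by (rule sym)
    qed
    moreover have "?f ` (N \<times> carrier R) = N'" by (auto simp: N'_def)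
    moreover have "card (N \<times> carrier R) = (\<Sum>b\<in>?f ` (N \<times> carrier R). card {p\<in>N \<times> carrier R. ?f p = b})"
      using sum.image_gen[of "N \<times> carrier R" "\<lambda>_. 1 :: nat" ?f] fin by simp
    ultimately show ?thesis by (simp add: card_cartesian_product)
  qed
  let ?V = "\<lambda>\<phi>. {v\<in>carrier R. v \<otimes> d = \<phi> (d \<odot>\<^bsub>M\<^esub> u)}"
  have V: "card (?V \<phi>) * card J = card (carrier R)" if \<phi>: "\<phi> \<in> functionals I N" for \<phi>
  proof -
    have \<phi>c: "\<phi> x \<in> carrier R" if "x \<in> N" for x using \<phi> that by (auto simp: functionals_def)
    have \<phi>s: "\<phi> (r \<odot>\<^bsub>M\<^esub> x) = r \<otimes> \<phi> x" if "x \<in> N" "r \<in> carrier R" for x r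
      using \<phi> that by (auto simp: functionals_def)
    have \<phi>0: "\<phi> \<zero>\<^bsub>M\<^esub> = \<zero>" using \<phi>s[OF N0, of \<zero>] N0 \<phi>c by simp
    have "\<phi> (d \<odot>\<^bsub>M\<^esub> u) \<in> PIdl d"
    proof (rule double_annihilator[OF d(1) \<phi>c[OF duN]])
      fix s assume s: "s \<in> carrier R" "s \<otimes> d = \<zero>"
      have "s \<otimes> \<phi> (d \<odot>\<^bsub>M\<^esub> u) = \<phi> ((s \<otimes> d) \<odot>\<^bsub>M\<^esub> u)"
        by (simp only: smult_assoc1[OF s(1) d(1) u] \<phi>s[OF duN s(1)])
      then show "s \<otimes> \<phi> (d \<odot>\<^bsub>M\<^esub> u) = \<zero>" using s u \<phi>0 by simp
    qed
    then obtain v where "v \<in> carrier R" "\<phi> (d \<odot>\<^bsub>M\<^esub> u) = v \<otimes> d"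
      by (auto simp: cgenideal_def)
    then have "card (?V \<phi>) = card {v\<in>carrier R. v \<otimes> d = \<zero>}"
      using abelian_group_hom.card_fibre[OF mult_hom[OF d(1)], of v] by simp
    then show ?thesis using card_PIdl[OF d(1)] d(2) by (simp add: mult.commute)
  qed
  have "bij_betw (\<lambda>\<psi>. (restrict \<psi> N, \<psi> u)) (functionals I N') (SIGMA \<phi>:functionals I N. ?V \<phi>)"
    unfolding bij_betw_def
  proof
    show "inj_on (\<lambda>\<psi>. (restrict \<psi> N, \<psi> u)) (functionals I N')"
    proof (rule inj_onI)
      fix \<psi> \<chi> assume \<psi>: "\<psi> \<in> functionals I N'" and \<chi>: "\<chi> \<in> functionals I N'"
        and eq: "(restrict \<psi> N, \<psi> u) = (restrict \<chi> N, \<chi> u)"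
      have val: "\<psi> (x \<oplus>\<^bsub>M\<^esub> r \<odot>\<^bsub>M\<^esub> u) = \<psi> x \<oplus> r \<otimes> \<psi> u"
        if "\<psi> \<in> functionals I N'" "x \<in> N" "r \<in> carrier R" for \<psi> x r
        using that NN' uN' submoduleE(4)[OF N'] by (auto simp: functionals_def)
      show "\<psi> = \<chi>"
      proof
        fix y
        show "\<psi> y = \<chi> y"
        proof (cases "y \<in> N'")
          case True
          then obtain x r where "y = x \<oplus>\<^bsub>M\<^esub> r \<odot>\<^bsub>M\<^esub> u" "x \<in> N" "r \<in> carrier R"
            by (auto simp: N'_def)
          then show ?thesis
            using val[OF \<psi>] val[OF \<chi>] eq by (auto simp: restrict_def fun_eq_iff) metis
        next
          case False
          then show ?thesis using \<psi> \<chi> by (auto simp: functionals_def PiE_def extensional_def)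
        qed
      qed
    qed
    show "(\<lambda>\<psi>. (restrict \<psi> N, \<psi> u)) ` functionals I N' = (SIGMA \<phi>:functionals I N. ?V \<phi>)"
    proof (intro equalityI subsetI)
      fix p assume "p \<in> (\<lambda>\<psi>. (restrict \<psi> N, \<psi> u)) ` functionals I N'"
      then obtain \<psi> where \<psi>: "\<psi> \<in> functionals I N'" and p: "p = (restrict \<psi> N, \<psi> u)" by blast
      have "restrict \<psi> N \<in> functionals I N"
        using \<psi> NN' IN NE(4,5) by (auto simp: functionals_def subset_iff)
      moreover have "\<psi> u \<in> carrier R" using \<psi> uN' by (auto simp: functionals_def)
      then have "\<psi> u \<in> ?V (restrict \<psi> N)"
        using \<psi> uN' duN d(1) R.m_comm[of "\<psi> u" d] by (simp add: functionals_def)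
      ultimately show "p \<in> (SIGMA \<phi>:functionals I N. ?V \<phi>)" unfolding p by blast
    next
      fix p assume "p \<in> (SIGMA \<phi>:functionals I N. ?V \<phi>)"
      then obtain \<phi> v where p: "p = (\<phi>, v)" and \<phi>: "\<phi> \<in> functionals I N"
        and v: "v \<in> carrier R" "v \<otimes> d = \<phi> (d \<odot>\<^bsub>M\<^esub> u)" by auto
      have \<phi>c: "\<phi> x \<in> carrier R" if "x \<in> N" for x using \<phi> that by (auto simp: functionals_def)
      have \<phi>s: "\<phi> (r \<odot>\<^bsub>M\<^esub> x) = r \<otimes> \<phi> x" if "x \<in> N" "r \<in> carrier R" for x r
        using \<phi> that by (auto simp: functionals_def)
      have \<phi>a: "\<phi> (x \<oplus>\<^bsub>M\<^esub> y) = \<phi> x \<oplus> \<phi> y" if "x \<in> N" "y \<in> N" for x y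
        using \<phi> that by (auto simp: functionals_def)
      have \<phi>0: "\<phi> \<zero>\<^bsub>M\<^esub> = \<zero>" using \<phi>s[OF N0, of \<zero>] N0 \<phi>c by simp
      have \<phi>J: "\<phi> (r \<odot>\<^bsub>M\<^esub> u) = r \<otimes> v" if r: "r \<in> J" for r
      proof -
        obtain t where t: "t \<in> carrier R" "r = t \<otimes> d" using r d(2) by (auto simp: cgenideal_def)
        have "\<phi> (r \<odot>\<^bsub>M\<^esub> u) = t \<otimes> \<phi> (d \<odot>\<^bsub>M\<^esub> u)"
          by (simp only: t(2) smult_assoc1[OF t(1) d(1) u] \<phi>s[OF duN t(1)])
        also have "\<dots> = t \<otimes> (v \<otimes> d)" by (simp only: v(2))
        also have "\<dots> = t \<otimes> d \<otimes> v" using t(1) v(1) d(1) by (simp add: R.m_ac)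
        finally show ?thesis by (simp only: t(2))
      qed
      \<comment> \<open>The extension of \<open>\<phi>\<close> with value \<open>v\<close> at \<open>u\<close> sends \<open>x + r u\<close> to \<open>\<phi>(x) + r v\<close>.\<close>
      define \<psi> where "\<psi> = (\<lambda>y\<in>N'. THE w. \<exists>x\<in>N. \<exists>r\<in>carrier R. y = x \<oplus>\<^bsub>M\<^esub> r \<odot>\<^bsub>M\<^esub> u \<and> w = \<phi> x \<oplus> r \<otimes> v)"
      have \<psi>: "\<psi> (x \<oplus>\<^bsub>M\<^esub> r \<odot>\<^bsub>M\<^esub> u) = \<phi> x \<oplus> r \<otimes> v" if x: "x \<in> N" and r: "r \<in> carrier R" for x r
      proof -
        have "(THE w. \<exists>x'\<in>N. \<exists>r'\<in>carrier R. x \<oplus>\<^bsub>M\<^esub> r \<odot>\<^bsub>M\<^esub> u = x' \<oplus>\<^bsub>M\<^esub> r' \<odot>\<^bsub>M\<^esub> u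
            \<and> w = \<phi> x' \<oplus> r' \<otimes> v) = \<phi> x \<oplus> r \<otimes> v"
        proof (rule the_equality)
          fix w assume "\<exists>x'\<in>N. \<exists>r'\<in>carrier R. x \<oplus>\<^bsub>M\<^esub> r \<odot>\<^bsub>M\<^esub> u = x' \<oplus>\<^bsub>M\<^esub> r' \<odot>\<^bsub>M\<^esub> u
            \<and> w = \<phi> x' \<oplus> r' \<otimes> v"
          then obtain x' r' where x': "x' \<in> N" "r' \<in> carrier R"
            "x \<oplus>\<^bsub>M\<^esub> r \<odot>\<^bsub>M\<^esub> u = x' \<oplus>\<^bsub>M\<^esub> r' \<odot>\<^bsub>M\<^esub> u" "w = \<phi> x' \<oplus> r' \<otimes> v" by blast
          have rr: "r \<ominus> r' \<in> J" "x' \<ominus>\<^bsub>M\<^esub> x = (r \<ominus> r') \<odot>\<^bsub>M\<^esub> u"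
            using rep[OF x x'(1) r x'(2,3)] by auto
          have "x' = x \<oplus>\<^bsub>M\<^esub> (x' \<ominus>\<^bsub>M\<^esub> x)"
            using Nc[OF x] Nc[OF x'(1)] by (simp add: a_minus_def M.a_ac M.r_neg M.r_neg1 M.r_neg2)
          then have "\<phi> x' = \<phi> x \<oplus> \<phi> (x' \<ominus>\<^bsub>M\<^esub> x)" using \<phi>a x Nm[OF x'(1) x] by metis
          also have "\<dots> = \<phi> x \<oplus> (r \<ominus> r') \<otimes> v" using \<phi>J rr by simp
          finally have "w = \<phi> x \<oplus> ((r \<ominus> r') \<otimes> v \<oplus> r' \<otimes> v)"
            using x' r v \<phi>c[OF x] by (simp add: R.a_assoc)
          also have "(r \<ominus> r') \<otimes> v \<oplus> r' \<otimes> v = (r \<ominus> r' \<oplus> r') \<otimes> v"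
            using r x'(2) v by (simp add: R.l_distr)
          also have "r \<ominus> r' \<oplus> r' = r" using r x'(2) by (simp add: a_minus_def R.a_assoc R.l_neg)
          finally show "w = \<phi> x \<oplus> r \<otimes> v" .
        qed (use x r in blast)
        then show ?thesis using N'I[OF x r] by (simp add: \<psi>_def)
      qed
      have "\<psi> \<in> functionals I N'"
        unfolding functionals_def
      proof (intro CollectI conjI ballI)
        show "\<psi> \<in> N' \<rightarrow>\<^sub>E carrier R"
        proof (rule PiE_I)
          fix y assume "y \<in> N'"
          then obtain x r where "y = x \<oplus>\<^bsub>M\<^esub> r \<odot>\<^bsub>M\<^esub> u" "x \<in> N" "r \<in> carrier R" by (auto simp: N'_def)
          then show "\<psi> y \<in> carrier R" using \<psi> \<phi>c v by simp
        qed (simp add: \<psi>_def)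
        fix y z assume "y \<in> N'" "z \<in> N'"
        then obtain x r x' r' where y: "y = x \<oplus>\<^bsub>M\<^esub> r \<odot>\<^bsub>M\<^esub> u" "x \<in> N" "r \<in> carrier R"
          and z: "z = x' \<oplus>\<^bsub>M\<^esub> r' \<odot>\<^bsub>M\<^esub> u" "x' \<in> N" "r' \<in> carrier R" by (auto simp: N'_def)
        have "y \<oplus>\<^bsub>M\<^esub> z = (x \<oplus>\<^bsub>M\<^esub> x') \<oplus>\<^bsub>M\<^esub> (r \<oplus> r') \<odot>\<^bsub>M\<^esub> u"
          using y z Nc u by (simp add: smult_l_distr M.a_ac)
        then have "\<psi> (y \<oplus>\<^bsub>M\<^esub> z) = \<phi> (x \<oplus>\<^bsub>M\<^esub> x') \<oplus> (r \<oplus> r') \<otimes> v"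
          using \<psi>[of "x \<oplus>\<^bsub>M\<^esub> x'" "r \<oplus> r'"] NE(5) y z by simp
        also have "\<dots> = (\<phi> x \<oplus> r \<otimes> v) \<oplus> (\<phi> x' \<oplus> r' \<otimes> v)"
          using y z v \<phi>c \<phi>a by (simp add: R.l_distr R.a_ac)
        finally show "\<psi> (y \<oplus>\<^bsub>M\<^esub> z) = \<psi> y \<oplus> \<psi> z" using y z \<psi> by simp
      next
        fix s y assume s: "s \<in> carrier R" and "y \<in> N'"
        then obtain x r where y: "y = x \<oplus>\<^bsub>M\<^esub> r \<odot>\<^bsub>M\<^esub> u" "x \<in> N" "r \<in> carrier R"
          by (auto simp: N'_def)
        have "s \<odot>\<^bsub>M\<^esub> y = s \<odot>\<^bsub>M\<^esub> x \<oplus>\<^bsub>M\<^esub> (s \<otimes> r) \<odot>\<^bsub>M\<^esub> u"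
          using y s Nc u by (simp add: smult_r_distr smult_assoc1)
        then have "\<psi> (s \<odot>\<^bsub>M\<^esub> y) = s \<otimes> \<phi> x \<oplus> (s \<otimes> r) \<otimes> v"
          using \<psi>[of "s \<odot>\<^bsub>M\<^esub> x" "s \<otimes> r"] NE(4) y s \<phi>s by simp
        then show "\<psi> (s \<odot>\<^bsub>M\<^esub> y) = s \<otimes> \<psi> y"
          using y s v \<phi>c \<psi> by (simp add: R.r_distr R.m_assoc)
      next
        fix x assume x: "x \<in> I"
        then have xN: "x \<in> N" using IN by blast
        then have "\<psi> x = \<phi> x" using \<psi>[of x \<zero>] Nc u v \<phi>c by simp
        then show "\<psi> x = \<zero>" using x \<phi> by (simp add: functionals_def)
      qed
      moreover have "restrict \<psi> N = \<phi>"
      proof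
        fix x
        show "restrict \<psi> N x = \<phi> x"
          using \<psi>[of x \<zero>] Nc[of x] u v \<phi>c[of x] \<phi>
          by (cases "x \<in> N") (auto simp: functionals_def PiE_def extensional_def)
      qed
      moreover have "\<psi> u = v" using \<psi>[OF N0, of \<one>] u v \<phi>0 by simp
      ultimately show "p \<in> (\<lambda>\<psi>. (restrict \<psi> N, \<psi> u)) ` functionals I N'"
        unfolding p by force
    qed
  qed
  then have "card (functionals I N') = card (SIGMA \<phi>:functionals I N. ?V \<phi>)"
    by (rule bij_betw_same_card)
  also have "\<dots> = (\<Sum>\<phi>\<in>functionals I N. card (?V \<phi>))"
  proof (rule card_SigmaI)
    have "functionals I N \<subseteq> N \<rightarrow>\<^sub>E carrier R" by (auto simp: functionals_def)
    then show "finite (functionals I N)" by (rule finite_subset) (intro finite_PiE fin)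
  qed (use fin in auto)
  finally have "card (functionals I N') * card J = (\<Sum>\<phi>\<in>functionals I N. card (?V \<phi>) * card J)"
    by (simp add: sum_distrib_right)
  also have "\<dots> = card (functionals I N) * card (carrier R)"
    by (simp add: V)
  finally have "card (functionals I N') * card J * card N = card (functionals I N) * card (carrier R) * card N"
    by simp
  also have "\<dots> = card (functionals I N) * (card N' * card J)"
    by (simp add: card_N')
  finally have "(card (functionals I N') * card N) * card J = (card (functionals I N) * card N') * card J"
    by (simp add: mult_ac)
  moreover have "card J \<noteq> 0" using dJ fin by auto
  ultimately show "card (functionals I N') * card N = card (functionals I N) * card N'"
    by (metis mult_right_cancel)
qed

text \<open>
  On \<open>I\<close> itself only the zero functional vanishes on \<open>I\<close>. In each step of a chain of submodules from
  \<open>I\<close> to the whole module that adjoins one element, the number of functionals vanishing on \<open>I\<close> grows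
  by the same factor as the submodule.
\<close>

lemma card_functionals:
  assumes I: "submodule I R M"
  shows "card (functionals I (carrier M)) * card I = card (carrier M)"
proof -
  have goal: "card (functionals I (carrier M)) * card I = card (carrier M)"
    if "submodule N R M" "I \<subseteq> N" "card (functionals I N) * card I = card N" for N
    using that
  proof (induction "card (carrier M) - card N" arbitrary: N rule: less_induct)
    case less
    have sub: "N \<subseteq> carrier M" using submoduleE(1) less.prems by blast
    show ?case
    proof (cases "N = carrier M")
      case False
      then obtain u where u: "u \<in> carrier M" "u \<notin> N" using sub by blast
      define N' where "N' = {x \<oplus>\<^bsub>M\<^esub> r \<odot>\<^bsub>M\<^esub> u | x r. x \<in> N \<and> r \<in> carrier R}"
      note step = functionals_step[OF less.prems(1,2) u(1), folded N'_def]
      have sub': "N' \<subseteq> carrier M" using submoduleE(1)[OF step(1)] .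
      have "card N < card N'" "card N' \<le> card (carrier M)"
        using step(2,3) u sub' finite_module finite_subset[OF sub' finite_module]
        by (auto intro!: psubset_card_mono card_mono)
      moreover have "card (functionals I N') * card I = card N'"
      proof -
        have "card N * (card (functionals I N') * card I) = card N * card N'"
          using step(4) less.prems(3) by (metis mult.assoc mult.commute)
        moreover have "card N \<noteq> 0"
          using submoduleE(2)[OF less.prems(1)] sub finite_module finite_subset by fastforce
        ultimately show ?thesis by simp
      qed
      ultimately show ?thesis using less.hyps[of N'] step(1,2) less.prems(2) by auto
    qed (use less.prems in simp)
  qed
  have I0: "x \<in> carrier M" if "x \<in> I" for x using submoduleE(1)[OF I] that by blast
  have "functionals I I = {\<lambda>x\<in>I. \<zero>}"
    using submoduleE(4,5)[OF I]
    by (auto simp: functionals_def fun_eq_iff PiE_def extensional_def)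
  then show ?thesis using goal[OF I order_refl] by simp
qed

end

text \<open>
  Both sides count pairs, sorted by \<open>x\<close>. For fixed \<open>x\<close>, let \<open>I\<close> be the image of \<open>a \<mapsto> x(a\<theta>)\<close>. The kernel of
  this map has \<open>|M| / |I|\<close> elements, and \<open>|W| / |I|\<close> of the \<open>|W|\<close> functionals on \<open>W\<close> vanish on \<open>I\<close>; both
  proportions are \<open>1 / |I|\<close>.
\<close>

theorem ask_bullet:
  assumes R: "finite_principal_ring R" and M: "module R M" and V: "module R V" and W: "module R W"
    and fin: "finite (carrier M)" "finite (carrier V)" "finite (carrier W)"
    and rep: "module_rep R M V W \<theta>"
  shows "ask M V W \<theta> = ask (dual_module R W) V (dual_module R M) (rep_bullet R M V W \<theta>)"
proof -
  interpret R: finite_principal_ring R by fact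
  interpret M: module R M by fact
  interpret V: module R V by fact
  interpret W: finite_principal_module R W
    by (simp add: finite_principal_module_def finite_principal_module_axioms_def R W fin)
  have c: "\<theta> a x \<in> carrier W" if "a \<in> carrier M" "x \<in> carrier V" for a x
    using rep that by (auto simp: module_rep_def hom_module_def Pi_iff PiE_iff)
  have add: "\<theta> (a \<oplus>\<^bsub>M\<^esub> b) x = \<theta> a x \<oplus>\<^bsub>W\<^esub> \<theta> b x"
    if "a \<in> carrier M" "b \<in> carrier M" "x \<in> carrier V" for a b x
    using rep that by (auto simp: module_rep_def hom_module_def)
  have smult: "\<theta> (r \<odot>\<^bsub>M\<^esub> a) x = r \<odot>\<^bsub>W\<^esub> \<theta> a x"
    if "a \<in> carrier M" "r \<in> carrier R" "x \<in> carrier V" for a r x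
    using rep that by (auto simp: module_rep_def hom_module_def)
  let ?K = "\<lambda>x. {a\<in>carrier M. \<theta> a x = \<zero>\<^bsub>W\<^esub>}"
  let ?I = "\<lambda>x. (\<lambda>a. \<theta> a x) ` carrier M"
  let ?Wd = "carrier (dual_module R W)"
  have Wd: "?Wd = W.functionals {} (carrier W)"
    by (auto simp: dual_module_def hom_module_def regular_module_def W.functionals_def)
  have hom: "abelian_group_hom M W (\<lambda>a. \<theta> a x)" if "x \<in> carrier V" for x
    by (rule abelian_group_homI; (rule M.abelian_group_axioms W.abelian_group_axioms)?)
      (use that c add in \<open>auto simp: group_hom_def group_hom_axioms_def hom_def M.a_group W.M.a_group\<close>)
  have KI: "card (?I x) * card (?K x) = card (carrier M)" if "x \<in> carrier V" for x
    using abelian_group_hom.card_image_kernel[OF hom[OF that] fin(1)] .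
  have I: "submodule (?I x) R W" if x: "x \<in> carrier V" for x
  proof (rule W.submoduleI)
    interpret h: abelian_group_hom M W "\<lambda>a. \<theta> a x" by (rule hom[OF x])
    show "\<zero>\<^bsub>W\<^esub> \<in> ?I x" using h.hom_zero by (metis M.zero_closed imageI)
    show "\<ominus>\<^bsub>W\<^esub> y \<in> ?I x" if y: "y \<in> ?I x" for y
    proof -
      obtain a where a: "a \<in> carrier M" "y = \<theta> a x" using y by blast
      then have "\<ominus>\<^bsub>W\<^esub> y = \<theta> (\<ominus>\<^bsub>M\<^esub> a) x" using h.hom_a_inv[OF a(1)] by simp
      then show ?thesis using a by (intro image_eqI[of _ _ "\<ominus>\<^bsub>M\<^esub> a"]) auto
    qed
    show "y \<oplus>\<^bsub>W\<^esub> z \<in> ?I x" if yz: "y \<in> ?I x" "z \<in> ?I x" for y z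
    proof -
      obtain a b where "a \<in> carrier M" "y = \<theta> a x" "b \<in> carrier M" "z = \<theta> b x"
        using yz by blast
      then show ?thesis using add x by (intro image_eqI[of _ _ "a \<oplus>\<^bsub>M\<^esub> b"]) simp_all
    qed
    show "r \<odot>\<^bsub>W\<^esub> y \<in> ?I x" if r: "r \<in> carrier R" "y \<in> ?I x" for r y
    proof -
      obtain a where "a \<in> carrier M" "y = \<theta> a x" using r by blast
      then show ?thesis using r smult x by (intro image_eqI[of _ _ "r \<odot>\<^bsub>M\<^esub> a"]) simp_all
    qed
  qed (use c x in auto)
  have cardWd: "card ?Wd = card (carrier W)"
  proof -
    have "submodule {\<zero>\<^bsub>W\<^esub>} R W" by (rule W.submoduleI) auto
    moreover have "W.functionals {\<zero>\<^bsub>W\<^esub>} (carrier W) = ?Wd"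
    proof -
      have "\<psi> \<zero>\<^bsub>W\<^esub> = \<zero>\<^bsub>R\<^esub>" if "\<psi> \<in> W.functionals {} (carrier W)" for \<psi>
      proof -
        have "\<psi> (r \<odot>\<^bsub>W\<^esub> x) = r \<otimes>\<^bsub>R\<^esub> \<psi> x" "\<psi> x \<in> carrier R"
          if "r \<in> carrier R" "x \<in> carrier W" for r x
          using \<open>\<psi> \<in> _\<close> that by (auto simp: W.functionals_def)
        from this[of "\<zero>\<^bsub>R\<^esub>" "\<zero>\<^bsub>W\<^esub>"] show ?thesis by simp
      qed
      then show ?thesis unfolding Wd by (auto simp: W.functionals_def)
    qed
    ultimately show ?thesis using W.card_functionals by fastforce
  qed
  have finWd: "finite ?Wd"
  proof -
    have "?Wd \<subseteq> carrier W \<rightarrow>\<^sub>E carrier R" unfolding Wd by (auto simp: W.functionals_def)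
    then show ?thesis by (rule finite_subset) (intro finite_PiE fin(3) R.finite_ring)
  qed
  have pos: "card (carrier M) \<noteq> 0" "card (carrier W) \<noteq> 0" using fin by auto
  have swap: "(\<Sum>a\<in>A. card {x\<in>B. P a x}) = (\<Sum>x\<in>B. card {a\<in>A. P a x})"
    if "finite A" "finite B" for A :: "'q set" and B :: "'s set" and P
    using sum.swap[of "\<lambda>a x. if P a x then 1 else 0 :: nat" B A] that
    by (simp add: sum.If_cases Int_def)
  have "ask M V W \<theta> = 1 / of_nat (card (carrier M)) * of_nat (\<Sum>a\<in>carrier M. card {x\<in>carrier V. \<theta> a x = \<zero>\<^bsub>W\<^esub>})"
    by (simp add: ask_def a_kernel_def')
  also have "\<dots> = (\<Sum>x\<in>carrier V. of_nat (card (?K x)) / of_nat (card (carrier M)))"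
    using swap[OF fin(1,2)] by (simp add: sum_divide_distrib)
  also have "\<dots> = (\<Sum>x\<in>carrier V. of_nat (card (W.functionals (?I x) (carrier W))) / of_nat (card (carrier W)))"
  proof (rule sum.cong[OF refl])
    fix x assume x: "x \<in> carrier V"
    have 1: "of_nat (card (?I x)) * of_nat (card (?K x)) = (of_nat (card (carrier M)) :: rat)"
      unfolding KI[OF x, symmetric] by simp
    have 2: "of_nat (card (W.functionals (?I x) (carrier W))) * of_nat (card (?I x))
        = (of_nat (card (carrier W)) :: rat)"
      unfolding W.card_functionals[OF I[OF x], symmetric] by simp
    show "of_nat (card (?K x)) / of_nat (card (carrier M))
        = (of_nat (card (W.functionals (?I x) (carrier W))) / of_nat (card (carrier W)) :: rat)"
    proof (subst frac_eq_eq)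
      show "of_nat (card (?K x)) * of_nat (card (carrier W))
          = (of_nat (card (W.functionals (?I x) (carrier W))) * of_nat (card (carrier M)) :: rat)"
        unfolding 1[symmetric] 2[symmetric] by (simp only: mult_ac)
    qed (use pos in simp_all)
  qed
  also have "\<dots> = 1 / of_nat (card ?Wd) * of_nat (\<Sum>x\<in>carrier V. card (W.functionals (?I x) (carrier W)))"
    by (simp add: cardWd sum_divide_distrib)
  also have "(\<Sum>x\<in>carrier V. card (W.functionals (?I x) (carrier W)))
      = (\<Sum>x\<in>carrier V. card {\<psi>\<in>?Wd. \<forall>a\<in>carrier M. \<psi> (\<theta> a x) = \<zero>\<^bsub>R\<^esub>})"
    unfolding Wd by (intro sum.cong refl arg_cong[of _ _ card]) (auto simp: W.functionals_def)
  also have "\<dots> = (\<Sum>\<psi>\<in>?Wd. card {x\<in>carrier V. \<forall>a\<in>carrier M. \<psi> (\<theta> a x) = \<zero>\<^bsub>R\<^esub>})"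
    by (rule swap[OF fin(2) finWd])
  also have "\<dots> = (\<Sum>\<psi>\<in>?Wd. card (a_kernel V (dual_module R M) (rep_bullet R M V W \<theta> \<psi>)))"
  proof (intro sum.cong refl arg_cong[of _ _ card])
    fix \<psi> assume "\<psi> \<in> ?Wd"
    then show "{x\<in>carrier V. \<forall>a\<in>carrier M. \<psi> (\<theta> a x) = \<zero>\<^bsub>R\<^esub>}
        = a_kernel V (dual_module R M) (rep_bullet R M V W \<theta> \<psi>)"
      by (auto simp: a_kernel_def' rep_bullet_def dual_module_def hom_module_def regular_module_def
          fun_eq_iff restrict_def)
  qed
  finally show ?thesis by (simp add: ask_def)
qed


theorem proposition6p4:
  fixes D :: "('o, 'd) ring_scheme"
    and R :: "('r, 'm) ring_scheme"
    and L :: "('r, 'g, 'n) lie_scheme"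
    and c :: nat
  assumes "truncated_dvr D R"
    and "finite (carrier R)"
    and "lie_algebra R L"
    and "finite (carrier L)"
    and "lie_nilpotent R L"
    and "c = nilpotency_class R L"
    and "add_pow R (fact c :: nat) \<one>\<^bsub>R\<^esub> \<in> Units R"
  shows "of_nat (num_conjugacy_classes (lie_exp R L)) = ask L L L (lie_ad L)
    \<and> ask L L L (lie_ad L)
        = ask (dual_module R L) L (dual_module R L) (rep_bullet R L L L (lie_ad L))"
proof
  interpret lie_algebra R L by fact
  interpret nilpotent_lie_algebra R L c
  proof
    show "lower_central R L c = {\<zero>\<^bsub>L\<^esub>}"
      using assms(5) unfolding assms(6) lie_nilpotent_def nilpotency_class_def by (rule LeastI_ex)
  qed fact
  show "of_nat (num_conjugacy_classes (lie_exp R L)) = ask L L L (lie_ad L)"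
    by (rule num_conjugacy_classes_lie_exp) fact+
  show "ask L L L (lie_ad L)
      = ask (dual_module R L) L (dual_module R L) (rep_bullet R L L L (lie_ad L))"
    using lie_algebra.axioms(1)[OF assms(3)]
    by (intro ask_bullet truncated_dvr_finite_principal_ring[OF assms(1,2)] assms(4)
        module_rep_lie_ad)
qed

end
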